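(* Let $\alpha\in[-1/2,1/2]$ and let $H_\alpha$ be the Aharonov–Bohm Hamiltonian defined below. For $x=r(\cos\theta,\sin\theta)$, $y=r'(\cos\theta',\sin\theta')$ with $r,r'>0$: if $|\alpha|<1/2$, $$\lim_{t\to\infty}t^{1+|\alpha|}e^{-tH_\alpha}(x,y)=\frac{1}{4\pi\Gamma(1+|\alpha|)}\Big(\frac{rr'}{4}\Big)^{|\alpha|};$$ if $\alpha=\pm1/2$, $$\lim_{t\to\infty}t^{3/2}e^{-tH_\alpha}(x,y)=\frac{1}{4\pi\Gamma(3/2)}\Big(\frac{rr'}{4}\Big)^{1/2}\big(1+e^{\mp i(\theta-\theta')}\big).$$
   Context: $H_\alpha$ is the non-negative self-adjoint operator in $L^2(\mathbb{R}^2)$ associated with the closure of the quadratic form $Q_\alpha[u]=\int_0^{2\pi}\int_0^\infty\big(|\partial_r u|^2+r^{-2}|(-i\partial_\theta+\alpha)u|^2\big)r\,dr\,d\theta$ defined on smooth functions compactly supported in $\mathbb{R}^2\setminus\{0\}$ (in polar coordinates $(r,\theta)$); equivalently, the Friedrichs extension of $(i\nabla+A)^2$ on $C_0^\infty(\mathbb{R}^2\setminus\{0\})$ with $A$ having radial component $0$ and azimuthal component $\alpha/r$. $e^{-tH_\alpha}(x,y)$ is its heat kernel with respect to Lebesgue measure. *)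

theory Defs
  imports "HOL-Analysis.Analysis"
begin

text \<open>The plane R^2 is identified with the type complex (x = Re, y = Im), with
Lebesgue measure lborel.  Functions on R^2 are complex-valued functions on complex.\<close>

definition L2 :: "(complex \<Rightarrow> complex) set" where
  "L2 = {f. f \<in> borel_measurable lborel \<and> integrable lborel (\<lambda>x. (cmod (f x))^2)}"

definition L2_norm :: "(complex \<Rightarrow> complex) \<Rightarrow> real" where
  "L2_norm f = sqrt (\<integral>x. (cmod (f x))^2 \<partial>lborel)"

definition L2_inner :: "(complex \<Rightarrow> complex) \<Rightarrow> (complex \<Rightarrow> complex) \<Rightarrow> complex" where
  "L2_inner f g = (\<integral>x. f x * cnj (g x) \<partial>lborel)"

definition pd :: "complex \<Rightarrow> (complex \<Rightarrow> complex) \<Rightarrow> complex \<Rightarrow> complex" where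
  "pd v f = (\<lambda>x. frechet_derivative f (at x) v)"

definition smooth_fun :: "(complex \<Rightarrow> complex) \<Rightarrow> bool" where
  "smooth_fun f \<longleftrightarrow> (\<forall>ds x. (foldr pd ds f) differentiable (at x))"

definition test_fun :: "(complex \<Rightarrow> complex) \<Rightarrow> bool" where
  "test_fun \<phi> \<longleftrightarrow> smooth_fun \<phi> \<and> compact (closure {x. \<phi> x \<noteq> 0})
      \<and> 0 \<notin> closure {x. \<phi> x \<noteq> 0}"

definition dr :: "(complex \<Rightarrow> complex) \<Rightarrow> complex \<Rightarrow> complex" where
  "dr f x = frechet_derivative f (at x) (x / of_real (cmod x))"

definition dth :: "(complex \<Rightarrow> complex) \<Rightarrow> complex \<Rightarrow> complex" where
  "dth f x = frechet_derivative f (at x) (\<i> * x)"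

text \<open>Sesquilinear form of Q_alpha on test functions (r dr dtheta = Lebesgue measure).\<close>
definition AB_form0 :: "real \<Rightarrow> (complex \<Rightarrow> complex) \<Rightarrow> (complex \<Rightarrow> complex) \<Rightarrow> complex" where
  "AB_form0 \<alpha> \<phi> \<psi> = (\<integral>x. dr \<phi> x * cnj (dr \<psi> x)
       + ((- \<i> * dth \<phi> x + of_real \<alpha> * \<phi> x) * cnj (- \<i> * dth \<psi> x + of_real \<alpha> * \<psi> x))
         / of_real ((cmod x)^2) \<partial>lborel)"

definition approx_seq :: "real \<Rightarrow> (complex \<Rightarrow> complex) \<Rightarrow> (nat \<Rightarrow> complex \<Rightarrow> complex) \<Rightarrow> bool" where
  "approx_seq \<alpha> u \<phi> \<longleftrightarrow> (\<forall>n. test_fun (\<phi> n))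
     \<and> (\<lambda>n. L2_norm (\<lambda>x. \<phi> n x - u x)) \<longlonglongrightarrow> 0
     \<and> (\<forall>\<epsilon>>0. \<exists>N. \<forall>m\<ge>N. \<forall>n\<ge>N.
          Re (AB_form0 \<alpha> (\<lambda>x. \<phi> m x - \<phi> n x) (\<lambda>x. \<phi> m x - \<phi> n x)) < \<epsilon>)"

definition form_dom :: "real \<Rightarrow> (complex \<Rightarrow> complex) set" where
  "form_dom \<alpha> = {u \<in> L2. \<exists>\<phi>. approx_seq \<alpha> u \<phi>}"

definition AB_form :: "real \<Rightarrow> (complex \<Rightarrow> complex) \<Rightarrow> (complex \<Rightarrow> complex) \<Rightarrow> complex" where
  "AB_form \<alpha> u v = lim (\<lambda>n. AB_form0 \<alpha> ((SOME \<phi>. approx_seq \<alpha> u \<phi>) n) ((SOME \<psi>. approx_seq \<alpha> v \<psi>) n))"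

text \<open>The operator H_alpha associated with the closed form, as a relation:
  AB_op alpha u w  means  u in D(H_alpha) and H_alpha u = w.\<close>
definition AB_op :: "real \<Rightarrow> (complex \<Rightarrow> complex) \<Rightarrow> (complex \<Rightarrow> complex) \<Rightarrow> bool" where
  "AB_op \<alpha> u w \<longleftrightarrow> u \<in> form_dom \<alpha> \<and> w \<in> L2 \<and> (\<forall>v \<in> form_dom \<alpha>. AB_form \<alpha> u v = L2_inner w v)"

text \<open>u(t) = e^{-t H_alpha} f, characterised as the (unique) solution of the abstract
  Cauchy problem u' = - H_alpha u (strong derivative in L^2) for t > 0, u(0+) = f in L^2.\<close>
definition heat_solution :: "real \<Rightarrow> (complex \<Rightarrow> complex) \<Rightarrow> (real \<Rightarrow> complex \<Rightarrow> complex) \<Rightarrow> bool" where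
  "heat_solution \<alpha> f u \<longleftrightarrow>
     (\<forall>t>0. u t \<in> L2) \<and>
     (\<forall>t>0. \<exists>w. AB_op \<alpha> (u t) w \<and>
        ((\<lambda>h. L2_norm (\<lambda>x. (u (t + h) x - u t x) / of_real h + w x)) \<longlongrightarrow> 0) (at 0)) \<and>
     ((\<lambda>t. L2_norm (\<lambda>x. u t x - f x)) \<longlongrightarrow> 0) (at_right 0)"

definition AB_heat_kernel :: "real \<Rightarrow> (real \<Rightarrow> complex \<Rightarrow> complex \<Rightarrow> complex) \<Rightarrow> bool" where
  "AB_heat_kernel \<alpha> p \<longleftrightarrow>
     (\<forall>t>0. continuous_on {(x, y). x \<noteq> 0 \<and> y \<noteq> 0} (\<lambda>(x, y). p t x y)) \<and>
     (\<forall>f \<in> L2. (\<forall>t>0. \<forall>x. x \<noteq> 0 \<longrightarrow> integrable lborel (\<lambda>y. p t x y * f y)) \<and>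
        heat_solution \<alpha> f (\<lambda>t x. \<integral>y. p t x y * f y \<partial>lborel))"

end

theory Submission
  imports Defs
begin

text \<open>
  For \<open>\<nu> = |m + \<alpha>|\<close> the functions \<open>r powr \<nu> * exp (- a r\<^sup>2) * e^{i m \<theta>}\<close> evolve explicitly under the
  heat flow: \<open>a\<close> becomes \<open>a / (1 + 4 a t)\<close> and a factor \<open>(1 + 4 a t) powr (- 1 - \<nu>)\<close> appears. They lie in
  the domain of the operator because the cutoffs \<open>\<beta> (ln r / n)\<close>, \<open>\<beta>\<close> a bump function, have vanishing
  energy cost, and the energy identity for \<open>d/dt |u - v|\<^sup>2\<close> shows that any heat solution with this
  initial value agrees with the explicit one. Hence a heat kernel has, for almost every \<open>x\<close>, the
  same integrals against all these functions as the Bessel series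
  \<open>exp (- (r\<^sup>2 + r'\<^sup>2) / 4 t) / (4 \<pi> t) * (\<Sum>m. I_\<nu> (r r' / 2 t) * e^{i m (\<theta> - \<theta>')})\<close>.
  By the Weierstrass theorem, applied first in the variable \<open>exp (- r\<^sup>2)\<close> and then to polynomials in the
  plane, these integrals determine a function that is continuous off the origin. The
  modes minimising \<open>|m + \<alpha>|\<close> dominate the series as \<open>t\<close> tends to infinity.
\<close>

section \<open>Square-integrable functions\<close>

text \<open>The kernel is known only through \<open>heat_solution\<close> and continuity off the
  origin, so it has to be recovered from its action on enough initial values. Gaussian modes serve
  because the flow maps their family to itself, and because the Bessel series integrates against
  them term by term, the Gamma factors cancelling to an exponential series. The exponent is
  \<open>+ nu\<close>, never \<open>- nu\<close>: this is the behaviour at the origin selected by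
  closing the form on functions supported away from \<open>0\<close>. Rates \<open>a = 1 + k\<close>
  with natural \<open>k\<close> make the family countable, so that one null set of points
  \<open>x\<close> serves all modes, and they turn the integrals into moments in powers of
  \<open>exp (- r^2)\<close>. The values of \<open>AB_form\<close> are limits along sequences picked
  by \<open>SOME\<close>; they are computed by exchanging the diagonal limit with an iterated one.
  The large-time limit has two terms exactly when \<open>|m + \<alpha>|\<close> has two minimisers,
  which in the range \<open>|\<alpha>| <= 1/2\<close> happens only at the endpoints.\<close>

lemma L2_measurable: "f \<in> L2 \<Longrightarrow> f \<in> borel_measurable lborel"
  by (simp add: L2_def)

lemma L2_integrable_sq: "f \<in> L2 \<Longrightarrow> integrable lborel (\<lambda>x. (cmod (f x))^2)"
  by (simp add: L2_def)

lemma L2_bound: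
  assumes "f \<in> borel_measurable lborel" "integrable lborel w" "\<And>x. (cmod (f x))\<^sup>2 \<le> w x"
  shows "f \<in> L2"
  unfolding L2_def
proof (intro CollectI conjI assms(1))
  show "integrable lborel (\<lambda>x. (cmod (f x))\<^sup>2)"
    by (rule Bochner_Integration.integrable_bound[OF assms(2)])
      (use assms in \<open>auto intro!: AE_I2 order_trans[OF assms(3)]\<close>)
qed

lemma L2_add:
  assumes "f \<in> L2" "g \<in> L2"
  shows "(\<lambda>x. f x + g x) \<in> L2"
proof (rule L2_bound)
  show "(\<lambda>x. f x + g x) \<in> borel_measurable lborel"
    using assms by (auto simp: L2_def)
  show "integrable lborel (\<lambda>x. 2 * (cmod (f x))^2 + 2 * (cmod (g x))^2)"
    using assms by (auto simp: L2_def)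
  fix x
  have "(cmod (f x + g x))\<^sup>2 \<le> (cmod (f x) + cmod (g x))\<^sup>2"
    by (intro power_mono norm_triangle_ineq) auto
  also have "\<dots> \<le> 2 * (cmod (f x))^2 + 2 * (cmod (g x))^2"
    using sum_squares_bound[of "cmod (f x)" "cmod (g x)"] by (simp add: power2_sum)
  finally show "(cmod (f x + g x))\<^sup>2 \<le> 2 * (cmod (f x))^2 + 2 * (cmod (g x))^2" .
qed

lemma L2_cmult:
  assumes "f \<in> L2"
  shows "(\<lambda>x. c * f x) \<in> L2"
  using assms by (auto simp: L2_def norm_mult power_mult_distrib)

lemma L2_diff:
  assumes "f \<in> L2" "g \<in> L2"
  shows "(\<lambda>x. f x - g x) \<in> L2"
  using L2_add[OF assms(1) L2_cmult[OF assms(2), of "-1"]] by simp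

lemma L2_mult_integrable_norm:
  assumes "f \<in> L2" "g \<in> L2"
  shows "integrable lborel (\<lambda>x. cmod (f x) * cmod (g x))"
proof (rule Bochner_Integration.integrable_bound)
  show "integrable lborel (\<lambda>x. (cmod (f x))^2 + (cmod (g x))^2)"
    using assms by (auto simp: L2_def)
  show "(\<lambda>x. cmod (f x) * cmod (g x)) \<in> borel_measurable lborel"
    using assms by (auto simp: L2_def)
  show "AE x in lborel. norm (cmod (f x) * cmod (g x)) \<le> norm ((cmod (f x))\<^sup>2 + (cmod (g x))\<^sup>2)"
  proof (rule AE_I2)
    fix x
    have "0 \<le> cmod (f x) * cmod (g x)" by simp
    moreover have "2 * (cmod (f x) * cmod (g x)) \<le> (cmod (f x))\<^sup>2 + (cmod (g x))\<^sup>2"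
      using sum_squares_bound[of "cmod (f x)" "cmod (g x)"] by (simp add: mult.assoc)
    ultimately show "norm (cmod (f x) * cmod (g x)) \<le> norm ((cmod (f x))\<^sup>2 + (cmod (g x))\<^sup>2)"
      unfolding real_norm_def by linarith
  qed
qed

lemma L2_mult_integrable:
  assumes "f \<in> L2" "g \<in> L2"
  shows "integrable lborel (\<lambda>x. f x * cnj (g x))"
proof (rule Bochner_Integration.integrable_bound[OF L2_mult_integrable_norm[OF assms]])
  have [measurable]: "f \<in> borel_measurable lborel" "g \<in> borel_measurable lborel"
    using assms by (auto simp: L2_def)
  have [measurable]: "cnj \<in> borel_measurable borel"
    by (intro borel_measurable_continuous_onI continuous_intros)
  show "(\<lambda>x. f x * cnj (g x)) \<in> borel_measurable lborel"
    by measurable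
qed (auto simp: norm_mult)

lemma L2_norm_nonneg [simp]: "0 \<le> L2_norm f"
  by (simp add: L2_norm_def)

lemma L2_norm_sq: "(L2_norm f)\<^sup>2 = (\<integral>x. (cmod (f x))^2 \<partial>lborel)"
  by (simp add: L2_norm_def)

lemma L2_inner_self: "L2_inner f f = of_real ((L2_norm f)\<^sup>2)"
  unfolding L2_norm_sq L2_inner_def by (subst integral_complex_of_real[symmetric]) (simp only: complex_norm_square)

lemma L2_inner_cnj: "L2_inner g f = cnj (L2_inner f g)"
  unfolding L2_inner_def by (subst Bochner_Integration.integral_cnj[symmetric]) (simp add: mult.commute)

lemma L2_inner_diff_left:
  assumes "f \<in> L2" "g \<in> L2" "h \<in> L2"
  shows "L2_inner (\<lambda>x. f x - g x) h = L2_inner f h - L2_inner g h"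
  unfolding L2_inner_def left_diff_distrib
  by (intro Bochner_Integration.integral_diff L2_mult_integrable assms)

lemma L2_inner_add_left:
  assumes "f \<in> L2" "g \<in> L2" "h \<in> L2"
  shows "L2_inner (\<lambda>x. f x + g x) h = L2_inner f h + L2_inner g h"
  unfolding L2_inner_def distrib_right
  by (intro Bochner_Integration.integral_add L2_mult_integrable assms)

lemma L2_inner_diff_right:
  assumes "f \<in> L2" "g \<in> L2" "h \<in> L2"
  shows "L2_inner h (\<lambda>x. f x - g x) = L2_inner h f - L2_inner h g"
  using L2_inner_diff_left[OF assms] by (metis L2_inner_cnj complex_cnj_diff)

lemma L2_inner_add_right:
  assumes "f \<in> L2" "g \<in> L2" "h \<in> L2"
  shows "L2_inner h (\<lambda>x. f x + g x) = L2_inner h f + L2_inner h g"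
  using L2_inner_add_left[OF assms] by (metis L2_inner_cnj complex_cnj_add)

lemma L2_inner_cmult_left: "L2_inner (\<lambda>x. c * f x) g = c * L2_inner f g"
  unfolding L2_inner_def by (simp add: mult.assoc)

text \<open>This is the discriminant argument for a quadratic in \<open>s\<close> that is never
  negative. For \<open>A > 0\<close> it is evaluated at its minimiser \<open>X / A\<close>; for
  \<open>A = 0\<close> it is linear, and a large \<open>s\<close> rules out
  \<open>X > 0\<close>.\<close>

lemma quadratic_nonneg_imp_square_le:
  fixes A B X :: real
  assumes "\<And>s. 0 \<le> s\<^sup>2 * A - 2 * s * X + B" "0 \<le> A" "0 \<le> X"
  shows "X \<le> sqrt A * sqrt B"
proof (cases "A = 0")
  case True
  have "X = 0"
  proof (rule ccontr)
    assume "X \<noteq> 0"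
    hence "2 * ((\<bar>B\<bar> + 1) / X) * X = 2 * (\<bar>B\<bar> + 1)" by simp
    thus False using assms(1)[of "(\<bar>B\<bar> + 1) / X"] True by simp
  qed
  thus ?thesis using True by simp
next
  case False
  hence "A > 0" using assms by simp
  have "0 \<le> (X/A)\<^sup>2 * A - 2 * (X/A) * X + B" by (rule assms(1))
  also have "\<dots> = B - X\<^sup>2 / A"
    using \<open>A > 0\<close> by (simp add: field_simps power2_eq_square)
  finally have "X\<^sup>2 \<le> A * B" using \<open>A > 0\<close> by (simp add: field_simps)
  hence "sqrt (X\<^sup>2) \<le> sqrt (A * B)" by (rule real_sqrt_le_mono)
  thus ?thesis using assms by (simp add: real_sqrt_mult)
qed

lemma L2_cauchy_schwarz:
  assumes "f \<in> L2" "g \<in> L2"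
  shows "cmod (L2_inner f g) \<le> L2_norm f * L2_norm g"
proof -
  let ?X = "\<integral>x. cmod (f x) * cmod (g x) \<partial>lborel"
  note i = L2_mult_integrable_norm[OF assms] L2_integrable_sq[OF assms(1)] L2_integrable_sq[OF assms(2)]
  have "cmod (L2_inner f g) \<le> (\<integral>x. cmod (f x * cnj (g x)) \<partial>lborel)"
    unfolding L2_inner_def by (rule integral_norm_bound)
  also have "\<dots> = ?X" by (simp add: norm_mult)
  \<comment> \<open>The quadratic in question is the integral of the square of
    \<open>s * |f| - |g|\<close>; passing to moduli beforehand makes the mixed term real.\<close>
  also have "\<dots> \<le> L2_norm f * L2_norm g"
    unfolding L2_norm_def
  proof (rule quadratic_nonneg_imp_square_le)
    fix s :: real
    have "0 \<le> (\<integral>x. (s * cmod (f x) - cmod (g x))\<^sup>2 \<partial>lborel)" by simp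
    also have "\<dots> = (\<integral>x. s\<^sup>2 * (cmod (f x))\<^sup>2 - 2 * s * (cmod (f x) * cmod (g x)) + (cmod (g x))\<^sup>2 \<partial>lborel)"
      by (rule Bochner_Integration.integral_cong) (auto simp: power2_eq_square algebra_simps)
    also have "\<dots> = s\<^sup>2 * (\<integral>x. (cmod (f x))\<^sup>2 \<partial>lborel) - 2 * s * ?X + (\<integral>x. (cmod (g x))\<^sup>2 \<partial>lborel)"
      using i by simp
    finally show "0 \<le> \<dots>" .
  qed auto
  finally show ?thesis .
qed

lemma L2_norm_sq_add:
  assumes "f \<in> L2" "g \<in> L2"
  shows "(L2_norm (\<lambda>x. f x + g x))\<^sup>2 = (L2_norm f)\<^sup>2 + 2 * Re (L2_inner f g) + (L2_norm g)\<^sup>2"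
proof -
  have "complex_of_real ((L2_norm (\<lambda>x. f x + g x))\<^sup>2) =
      L2_inner f f + (L2_inner f g + cnj (L2_inner f g)) + L2_inner g g"
    unfolding L2_inner_self[symmetric]
    using assms by (simp add: L2_inner_add_left L2_inner_add_right L2_add L2_inner_cnj[symmetric])
  also have "\<dots> = of_real ((L2_norm f)\<^sup>2 + 2 * Re (L2_inner f g) + (L2_norm g)\<^sup>2)"
    by (simp add: L2_inner_self complex_add_cnj)
  finally show ?thesis using of_real_eq_iff by blast
qed

lemma L2_norm_triangle:
  assumes "f \<in> L2" "g \<in> L2"
  shows "L2_norm (\<lambda>x. f x + g x) \<le> L2_norm f + L2_norm g"
proof (rule power2_le_imp_le)
  have "Re (L2_inner f g) \<le> L2_norm f * L2_norm g"
    using L2_cauchy_schwarz[OF assms] complex_Re_le_cmod order_trans by blast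
  thus "(L2_norm (\<lambda>x. f x + g x))\<^sup>2 \<le> (L2_norm f + L2_norm g)\<^sup>2"
    by (simp add: L2_norm_sq_add[OF assms] power2_sum)
qed auto

lemma L2_norm_cmult: "L2_norm (\<lambda>x. c * f x) = cmod c * L2_norm f"
  by (simp add: L2_norm_def norm_mult power_mult_distrib real_sqrt_mult)

lemma L2_norm_minus_commute: "L2_norm (\<lambda>x. f x - g x) = L2_norm (\<lambda>x. g x - f x)"
  by (simp add: L2_norm_def norm_minus_commute)

lemma L2_norm_triangle_diff:
  assumes "f \<in> L2" "g \<in> L2" "h \<in> L2"
  shows "L2_norm (\<lambda>x. f x - h x) \<le> L2_norm (\<lambda>x. f x - g x) + L2_norm (\<lambda>x. g x - h x)"
  using L2_norm_triangle[OF L2_diff[OF assms(1,2)] L2_diff[OF assms(2,3)]] by simp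

lemma L2_norm_le_add_diff:
  assumes "f \<in> L2" "g \<in> L2"
  shows "L2_norm f \<le> L2_norm g + L2_norm (\<lambda>x. f x - g x)"
  using L2_norm_triangle[OF assms(2) L2_diff[OF assms]] by simp

lemma L2_tendsto_inner_left:
  assumes "\<And>n. f n \<in> L2" "g \<in> L2" "h \<in> L2" "((\<lambda>n. L2_norm (\<lambda>x. f n x - g x)) \<longlongrightarrow> 0) F"
  shows "((\<lambda>n. L2_inner (f n) h) \<longlongrightarrow> L2_inner g h) F"
proof (rule Lim_null[THEN iffD2], rule Lim_null_comparison)
  show "((\<lambda>n. L2_norm (\<lambda>x. f n x - g x) * L2_norm h) \<longlongrightarrow> 0) F"
    using assms(4) by (rule tendsto_mult_left_zero)
  show "\<forall>\<^sub>F n in F. norm (L2_inner (f n) h - L2_inner g h) \<le> L2_norm (\<lambda>x. f n x - g x) * L2_norm h"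
    using L2_cauchy_schwarz[OF L2_diff[OF assms(1,2)] assms(3)]
    by (intro always_eventually) (simp add: L2_inner_diff_left assms)
qed

lemma L2_tendsto_inner_right:
  assumes "\<And>n. f n \<in> L2" "g \<in> L2" "h \<in> L2" "((\<lambda>n. L2_norm (\<lambda>x. f n x - g x)) \<longlongrightarrow> 0) F"
  shows "((\<lambda>n. L2_inner h (f n)) \<longlongrightarrow> L2_inner h g) F"
  using tendsto_cnj[OF L2_tendsto_inner_left[OF assms]] by (simp add: L2_inner_cnj[symmetric])

lemma L2_dominated_convergence:
  assumes "\<And>n. f n \<in> borel_measurable lborel" "integrable lborel w"
    and "\<And>x. (\<lambda>n. f n x) \<longlonglongrightarrow> 0" "\<And>n x. (cmod (f n x))\<^sup>2 \<le> w x"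
  shows "(\<lambda>n. L2_norm (f n)) \<longlonglongrightarrow> 0"
proof -
  have "(\<lambda>n. \<integral>x. (cmod (f n x))^2 \<partial>lborel) \<longlonglongrightarrow> (\<integral>x. 0 \<partial>(lborel :: complex measure))"
  proof (rule integral_dominated_convergence[where w = w])
    show "AE x in lborel. (\<lambda>i. (cmod (f i x))\<^sup>2) \<longlonglongrightarrow> 0"
    proof (rule AE_I2)
      fix x
      show "(\<lambda>i. (cmod (f i x))\<^sup>2) \<longlonglongrightarrow> 0"
        using tendsto_power[OF tendsto_norm_zero[OF assms(3)[of x]], of 2] by simp
    qed
  qed (use assms in auto)
  from tendsto_real_sqrt[OF this] show ?thesis by (simp add: L2_norm_def)
qed

lemma L2_norm_zero_imp_AE:
  assumes "f \<in> L2" "L2_norm f = 0"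
  shows "AE x in lborel. f x = 0"
proof -
  have "(\<integral>x. (cmod (f x))^2 \<partial>lborel) = 0"
    using assms(2) by (simp flip: L2_norm_sq)
  thus ?thesis
    using integral_nonneg_eq_0_iff_AE[OF L2_integrable_sq[OF assms(1)]] by simp
qed

text \<open>With \<open>d' = - w\<close> in the sense of \<open>L2\<close>.\<close>
lemma L2_norm_sq_has_derivative:
  assumes L: "\<And>s. s > 0 \<Longrightarrow> d s \<in> L2" and "w \<in> L2" "t > 0"
    and lim: "((\<lambda>h. L2_norm (\<lambda>x. (d (t + h) x - d t x) / of_real h + w x)) \<longlongrightarrow> 0) (at 0)"
  shows "((\<lambda>s. (L2_norm (d s))\<^sup>2) has_real_derivative - 2 * Re (L2_inner w (d t))) (at t)"
  unfolding DERIV_def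
proof -
  define e where "e h = (\<lambda>x. (d (t + h) x - d t x) / of_real h + w x)" for h
  have ev: "\<forall>\<^sub>F h in at 0. h > - t \<and> h \<noteq> 0"
    using \<open>t > 0\<close> unfolding eventually_at by (intro exI[of _ t]) (auto simp: dist_real_def)
  \<comment> \<open>By definition of \<open>e\<close>,
    \<open>d (t + h) = d t + h * (e h - w)\<close>. Expanding the square and dividing by
    \<open>h\<close> leaves a last term with a factor \<open>h\<close> and a mixed term in which
    \<open>e h\<close> tends to \<open>0\<close>.\<close>
  have key: "((L2_norm (d (t + h)))\<^sup>2 - (L2_norm (d t))\<^sup>2) / h =
      2 * Re (L2_inner (e h) (d t)) - 2 * Re (L2_inner w (d t)) + h * (L2_norm (\<lambda>x. e h x - w x))\<^sup>2
      \<and> e h \<in> L2" if h: "h > -t" "h \<noteq> 0" for h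
  proof -
    have e2: "e h \<in> L2"
      using L2_add[OF L2_cmult[OF L2_diff[OF L L], of "t+h" t "1 / of_real h"] \<open>w \<in> L2\<close>] h \<open>t > 0\<close>
      by (simp add: e_def)
    have ew: "(\<lambda>x. e h x - w x) \<in> L2" using L2_diff[OF e2 \<open>w \<in> L2\<close>] .
    have "d (t + h) = (\<lambda>x. of_real h * (e h x - w x) + d t x)"
      using h by (auto simp: e_def fun_eq_iff)
    hence "(L2_norm (d (t + h)))\<^sup>2 = (L2_norm (\<lambda>x. of_real h * (e h x - w x)))\<^sup>2
        + 2 * Re (L2_inner (\<lambda>x. of_real h * (e h x - w x)) (d t)) + (L2_norm (d t))\<^sup>2"
      using L2_norm_sq_add[OF L2_cmult[OF ew, of "of_real h"] L[OF \<open>t>0\<close>]] by simp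
    also have "L2_inner (\<lambda>x. of_real h * (e h x - w x)) (d t) = of_real h * (L2_inner (e h) (d t) - L2_inner w (d t))"
      unfolding L2_inner_cmult_left using L2_inner_diff_left[OF e2 \<open>w \<in> L2\<close> L[OF \<open>t>0\<close>]] by simp
    also have "(L2_norm (\<lambda>x. of_real h * (e h x - w x)))\<^sup>2 = h\<^sup>2 * (L2_norm (\<lambda>x. e h x - w x))\<^sup>2"
      unfolding L2_norm_cmult by (simp add: power_mult_distrib)
    finally show ?thesis using h e2 by (simp add: field_simps power2_eq_square)
  qed
  have e0: "((\<lambda>h. L2_norm (e h)) \<longlongrightarrow> 0) (at 0)" using lim by (simp add: e_def)
  have 1: "((\<lambda>h. Re (L2_inner (e h) (d t))) \<longlongrightarrow> 0) (at 0)"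
  proof (rule Lim_null_comparison)
    show "((\<lambda>h. L2_norm (e h) * L2_norm (d t)) \<longlongrightarrow> 0) (at 0)"
      using e0 by (rule tendsto_mult_left_zero)
    show "\<forall>\<^sub>F h in at 0. norm (Re (L2_inner (e h) (d t))) \<le> L2_norm (e h) * L2_norm (d t)"
      using ev by eventually_elim
       (use key L[OF \<open>t>0\<close>] in \<open>auto intro!: order_trans[OF abs_Re_le_cmod L2_cauchy_schwarz]\<close>)
  qed
  have 2: "((\<lambda>h. h * (L2_norm (\<lambda>x. e h x - w x))\<^sup>2) \<longlongrightarrow> 0) (at 0)"
  proof (rule Lim_null_comparison)
    have "((\<lambda>h. \<bar>h\<bar> * (L2_norm (e h) + L2_norm w)\<^sup>2) \<longlongrightarrow> \<bar>0\<bar> * (0 + L2_norm w)\<^sup>2) (at 0)"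
      by (intro tendsto_intros e0)
    thus "((\<lambda>h. \<bar>h\<bar> * (L2_norm (e h) + L2_norm w)\<^sup>2) \<longlongrightarrow> 0) (at 0)" by simp
    show "\<forall>\<^sub>F h in at 0. norm (h * (L2_norm (\<lambda>x. e h x - w x))\<^sup>2) \<le> \<bar>h\<bar> * (L2_norm (e h) + L2_norm w)\<^sup>2"
      using ev
    proof eventually_elim
      fix h assume h: "h > -t \<and> h \<noteq> 0"
      have "L2_norm (\<lambda>x. e h x + (-1) * w x) \<le> L2_norm (e h) + L2_norm (\<lambda>x. (-1) * w x)"
        using key h \<open>w \<in> L2\<close> by (intro L2_norm_triangle L2_cmult) auto
      hence "L2_norm (\<lambda>x. e h x - w x) \<le> L2_norm (e h) + L2_norm w"
        unfolding L2_norm_cmult by simp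
      hence "(L2_norm (\<lambda>x. e h x - w x))\<^sup>2 \<le> (L2_norm (e h) + L2_norm w)\<^sup>2"
        by (intro power_mono) auto
      thus "norm (h * (L2_norm (\<lambda>x. e h x - w x))\<^sup>2) \<le> \<bar>h\<bar> * (L2_norm (e h) + L2_norm w)\<^sup>2"
        by (simp add: abs_mult mult_left_mono)
    qed
  qed
  have "((\<lambda>h. 2 * Re (L2_inner (e h) (d t)) - 2 * Re (L2_inner w (d t)) + h * (L2_norm (\<lambda>x. e h x - w x))\<^sup>2) \<longlongrightarrow>
      2 * 0 - 2 * Re (L2_inner w (d t)) + 0) (at 0)"
    by (intro tendsto_intros 1 2)
  thus "((\<lambda>h. ((L2_norm (d (t + h)))\<^sup>2 - (L2_norm (d t))\<^sup>2) / h) \<longlongrightarrow> - 2 * Re (L2_inner w (d t))) (at 0)"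
    by (rule tendsto_eq_rhs[OF Lim_transform_eventually]) (use ev in eventually_elim, use key in auto)
qed

section \<open>Radial integrals\<close>

text \<open>The image of Lebesgue measure under \<open>x -> |x|^2\<close> has constant density
  \<open>pi\<close> on the half-line, because the disc \<open>|x|^2 <= a\<close> has area
  \<open>pi * a\<close>. Both measures are compared on the half-lines \<open>{..a}\<close>, which
  generate the Borel sets. This stands in for polar coordinates.\<close>

lemma nn_integral_radial:
  assumes [measurable]: "F \<in> borel_measurable borel"
  shows "(\<integral>\<^sup>+x. F ((cmod x)\<^sup>2) \<partial>lborel) = ennreal pi * (\<integral>\<^sup>+s. F s * indicator {0..} s \<partial>lborel)"
proof -
  let ?M = "distr lborel borel (\<lambda>x. (cmod x)\<^sup>2)"
  let ?N = "density lborel (\<lambda>s. ennreal pi * indicator {0..} s) :: real measure"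
  have A: "emeasure ?M {..a} = (if a < 0 then 0 else ennreal (pi * a))" for a
  proof -
    have "(\<lambda>x. (cmod x)\<^sup>2) -` {..a} = (if a < 0 then {} else cball 0 (sqrt a))"
      by (auto simp: not_less real_le_rsqrt intro!: sqrt_ge_absD dest: order_trans[OF zero_le_power2])
    moreover have "emeasure lborel (cball (0::complex) (sqrt a)) = ennreal (pi * a)" if "a \<ge> 0"
      using that emeasure_cball[of "sqrt a" "0::complex"] by (simp add: unit_ball_vol_numeral)
    ultimately show ?thesis by (simp add: emeasure_distr)
  qed
  have B: "emeasure ?N {..a} = (if a < 0 then 0 else ennreal (pi * a))" for a
  proof -
    have "emeasure ?N {..a} = (\<integral>\<^sup>+s. ennreal pi * indicator {0..a} s \<partial>lborel)"
      by (subst emeasure_density) (auto intro!: nn_integral_cong simp: indicator_def)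
    also have "\<dots> = ennreal pi * emeasure lborel {0..a}"
      by (subst nn_integral_cmult_indicator) auto
    also have "\<dots> = (if a < 0 then 0 else ennreal (pi * a))"
      by (auto simp: ennreal_mult)
    finally show ?thesis .
  qed
  have "?M = ?N"
  proof (rule measure_eqI_generator_eq[where \<Omega> = UNIV and E = "range (\<lambda>a. {..a::real})" and A = "\<lambda>n. {..real n}"])
    show "Int_stable (range (\<lambda>a. {..a::real}))"
      by (auto simp: Int_stable_def)
    show "sets ?M = sigma_sets UNIV (range (\<lambda>a. {..a::real}))"
      "sets ?N = sigma_sets UNIV (range (\<lambda>a. {..a::real}))"
      by (simp_all add: borel_eq_atMost)
    show "(\<Union>i. {..real i}) = UNIV"
      using real_arch_simple by auto
  qed (auto simp: A B)
  have "(\<integral>\<^sup>+x. F ((cmod x)\<^sup>2) \<partial>lborel) = (\<integral>\<^sup>+s. F s \<partial>?M)"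
    by (subst nn_integral_distr) auto
  also have "\<dots> = (\<integral>\<^sup>+s. F s \<partial>?N)" by (simp only: \<open>?M = ?N\<close>)
  also have "\<dots> = (\<integral>\<^sup>+s. ennreal pi * (F s * indicator {0..} s) \<partial>lborel)"
    by (subst nn_integral_density) (auto intro!: nn_integral_cong simp: mult_ac)
  also have "\<dots> = ennreal pi * (\<integral>\<^sup>+s. F s * indicator {0..} s \<partial>lborel)"
    by (rule nn_integral_cmult) auto
  finally show ?thesis .
qed

text \<open>In the variable \<open>|x|^2\<close> the integrand becomes
  \<open>t powr (s/2) * exp (- B * t)\<close>, a rescaled Gamma integral. The condition
  \<open>s > -2\<close> is integrability at the origin of the plane.\<close>

lemma has_bochner_integral_gaussian_moment:
  fixes B s :: real
  assumes "B > 0" "s > -2"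
  shows "has_bochner_integral lborel (\<lambda>x::complex. cmod x powr s * exp (- B * (cmod x)\<^sup>2))
           (pi * Gamma (s/2 + 1) / B powr (s/2 + 1))"
proof (rule has_bochner_integral_nn_integral)
  let ?p = "s/2 + 1"
  have p: "?p > 0" using assms by simp
  define f where "f t = ennreal (indicator {0..} t * t powr (?p - 1) / exp t)" for t :: real
  let ?I = "\<integral>\<^sup>+t. ennreal (t powr (s/2) * exp (- B * t)) * indicator {0..} t \<partial>lborel"
  have "ennreal (Gamma ?p) = (\<integral>\<^sup>+t. f t \<partial>lborel)"
    unfolding f_def by (rule Gamma_conv_nn_integral_real[OF p])
  also have "\<dots> = \<bar>B\<bar> * (\<integral>\<^sup>+t. f (0 + B * t) \<partial>lborel)"
    by (rule nn_integral_real_affine) (use assms in \<open>auto simp: f_def\<close>)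
  also have "(\<integral>\<^sup>+t. f (0 + B * t) \<partial>lborel) =
      (\<integral>\<^sup>+t. ennreal (B powr (s/2)) * (ennreal (t powr (s/2) * exp (- B * t)) * indicator {0..} t) \<partial>lborel)"
  proof (rule nn_integral_cong)
    fix t :: real
    show "f (0 + B * t) = ennreal (B powr (s/2)) * (ennreal (t powr (s/2) * exp (- B * t)) * indicator {0..} t)"
      using assms unfolding f_def
      by (auto simp: indicator_def powr_mult zero_le_mult_iff exp_minus field_simps ennreal_mult[symmetric])
  qed
  also have "\<dots> = ennreal (B powr (s/2)) * ?I"
    by (rule nn_integral_cmult) auto
  finally have G: "ennreal (Gamma ?p) = ennreal (B powr ?p) * ?I"
    using assms by (simp add: powr_add ennreal_mult' mult_ac)
  have "?I = ennreal (1 / B powr ?p) * (ennreal (B powr ?p) * ?I)"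
    using assms by (subst mult.assoc[symmetric], subst ennreal_mult[symmetric]) auto
  also have "\<dots> = ennreal (Gamma ?p / B powr ?p)"
    unfolding G[symmetric] using Gamma_real_pos[OF p] by (subst ennreal_mult[symmetric]) auto
  finally have I: "?I = ennreal (Gamma ?p / B powr ?p)" .
  have "(\<integral>\<^sup>+x. ennreal (cmod x powr s * exp (- B * (cmod x)\<^sup>2)) \<partial>lborel) =
      (\<integral>\<^sup>+x. ennreal (((cmod x)\<^sup>2) powr (s/2) * exp (- B * (cmod x)\<^sup>2)) \<partial>lborel)"
    by (rule nn_integral_cong) (simp add: powr_powr flip: powr_numeral)
  also have "\<dots> = ennreal pi * ?I"
    by (rule nn_integral_radial[where F = "\<lambda>t. ennreal (t powr (s/2) * exp (- B * t))"]) auto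
  also have "\<dots> = ennreal (pi * Gamma ?p / B powr ?p)"
    unfolding I using Gamma_real_pos[OF p] by (subst ennreal_mult[symmetric]) auto
  finally show "(\<integral>\<^sup>+x. ennreal (cmod x powr s * exp (- B * (cmod x)\<^sup>2)) \<partial>lborel) =
      ennreal (pi * Gamma ?p / B powr ?p)" .
  show "0 \<le> pi * Gamma ?p / B powr ?p"
    using Gamma_real_pos[OF p] by simp
qed auto

lemma integrable_gaussian_moment:
  "B > 0 \<Longrightarrow> s > -2 \<Longrightarrow> integrable lborel (\<lambda>x::complex. cmod x powr s * exp (- B * (cmod x)\<^sup>2))"
  using has_bochner_integral_gaussian_moment integrable.simps by blast

text \<open>The point is that the growth in \<open>N\<close> is only linear: a logarithmic cutoff at
  scale \<open>N\<close> has squared gradient of size \<open>1 / (N * |x|)^2\<close>, hence energy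
  of order \<open>1 / N\<close>.\<close>

lemma has_bochner_integral_inverse_square_annulus:
  fixes N :: real
  assumes "N \<ge> 0"
  shows "has_bochner_integral lborel (\<lambda>x::complex. indicator {exp (-2*N)..exp (2*N)} ((cmod x)\<^sup>2) / (cmod x)\<^sup>2) (4 * pi * N)"
proof (rule has_bochner_integral_nn_integral)
  have "(\<integral>\<^sup>+x. ennreal (indicator {exp (-2*N)..exp (2*N)} ((cmod x)\<^sup>2) / (cmod x)\<^sup>2) \<partial>lborel) =
     ennreal pi * (\<integral>\<^sup>+s. ennreal (indicator {exp (-2*N)..exp (2*N)} s / s) * indicator {0..} s \<partial>lborel)"
    by (rule nn_integral_radial[where F = "\<lambda>s. ennreal (indicator {exp (-2*N)..exp (2*N)} s / s)"]) auto
  also have "(\<integral>\<^sup>+s. ennreal (indicator {exp (-2*N)..exp (2*N)} s / s) * indicator {0..} s \<partial>lborel)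
     = (\<integral>\<^sup>+s. ennreal (1 / s) * indicator {exp (-2*N)..exp (2*N)} s \<partial>lborel)"
  proof (rule nn_integral_cong)
    fix s :: real
    have "s \<ge> 0" if "exp (-2*N) \<le> s" using that exp_gt_zero[of "-2*N"] by linarith
    thus "ennreal (indicator {exp (-2*N)..exp (2*N)} s / s) * indicator {0..} s = ennreal (1 / s) * indicator {exp (-2*N)..exp (2*N)} s"
      by (auto simp: indicator_def)
  qed
  also have "\<dots> = ennreal (ln (exp (2*N)) - ln (exp (-2*N)))"
  proof (rule nn_integral_FTC_Icc)
    fix x assume "x \<in> {exp (-2*N)..exp (2*N)}"
    hence "exp (-2*N) \<le> x" by simp
    hence "x > 0" using exp_gt_zero[of "-2*N"] by (rule less_le_trans[rotated])
    thus "(ln has_real_derivative 1 / x) (at x)" "0 \<le> 1 / x"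
      by (auto intro!: derivative_eq_intros)
  qed (use assms in auto)
  also have "ennreal pi * \<dots> = ennreal (4 * pi * N)"
    using assms by (subst ennreal_mult[symmetric]) auto
  finally show "(\<integral>\<^sup>+x. ennreal (indicator {exp (-2*N)..exp (2*N)} ((cmod x)\<^sup>2) / (cmod x)\<^sup>2) \<partial>lborel) = ennreal (4 * pi * N)" .
qed (use assms in \<open>auto simp: indicator_def\<close>)

section \<open>Smooth functions in logarithmic polar coordinates\<close>

text \<open>\<open>Ck n\<close> is \<open>n\<close>-fold differentiability, with no condition at
  \<open>n = 0\<close>; smoothness is \<open>Ck n\<close> for all \<open>n\<close>. Recursion on the
  derivative turns the closure properties into inductions.\<close>

primrec Ck :: "nat \<Rightarrow> (real \<Rightarrow> complex) \<Rightarrow> bool" where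
  "Ck 0 g \<longleftrightarrow> True"
| "Ck (Suc n) g \<longleftrightarrow> (\<exists>g'. (\<forall>\<tau>. (g has_vector_derivative g' \<tau>) (at \<tau>)) \<and> Ck n g')"

lemma Ck_SucI: "(\<And>\<tau>. (g has_vector_derivative g' \<tau>) (at \<tau>)) \<Longrightarrow> Ck n g' \<Longrightarrow> Ck (Suc n) g"
  by auto

lemma Ck_Suc_imp: "Ck (Suc n) g \<Longrightarrow> Ck n g"
proof (induction n arbitrary: g)
  case (Suc n)
  then obtain g' where "\<forall>\<tau>. (g has_vector_derivative g' \<tau>) (at \<tau>)" "Ck (Suc n) g'"
    unfolding Ck.simps(2)[of "Suc n"] by blast
  with Suc.IH show ?case by auto
qed simp

lemma Ck_const: "Ck n (\<lambda>\<tau>. c)"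
proof (induction n arbitrary: c)
  case (Suc n)
  show ?case by (rule Ck_SucI[OF _ Suc]) (rule has_vector_derivative_const)
qed simp

lemma Ck_add: "Ck n f \<Longrightarrow> Ck n g \<Longrightarrow> Ck n (\<lambda>\<tau>. f \<tau> + g \<tau>)"
proof (induction n arbitrary: f g)
  case (Suc n)
  then obtain f' g' where fg: "\<And>\<tau>. (f has_vector_derivative f' \<tau>) (at \<tau>)" "Ck n f'"
     "\<And>\<tau>. (g has_vector_derivative g' \<tau>) (at \<tau>)" "Ck n g'" by auto
  show ?case
    by (rule Ck_SucI[OF _ Suc.IH[OF fg(2,4)]]) (intro has_vector_derivative_add fg)
qed simp

lemma Ck_mult: "Ck n f \<Longrightarrow> Ck n g \<Longrightarrow> Ck n (\<lambda>\<tau>. f \<tau> * g \<tau>)"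
proof (induction n arbitrary: f g)
  case (Suc n)
  then obtain f' g' where fg: "\<And>\<tau>. (f has_vector_derivative f' \<tau>) (at \<tau>)" "Ck n f'"
     "\<And>\<tau>. (g has_vector_derivative g' \<tau>) (at \<tau>)" "Ck n g'" by auto
  have "Ck n (\<lambda>\<tau>. f \<tau> * g' \<tau> + f' \<tau> * g \<tau>)"
    using Suc.prems[THEN Ck_Suc_imp] fg by (intro Ck_add Suc.IH)
  thus ?case
    by (rule Ck_SucI[rotated]) (intro has_vector_derivative_mult fg)
qed simp

lemma Ck_exp: "Ck n (\<lambda>\<tau>. of_real (exp (c * \<tau>)))"
proof (induction n)
  case (Suc n)
  show ?case
    by (rule Ck_SucI[OF _ Ck_mult[OF Ck_const[of _ "of_real c"] Suc]])
      (auto intro!: derivative_eq_intros has_vector_derivative_of_real simp flip: of_real_mult has_real_derivative_iff_has_vector_derivative)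
qed simp

text \<open>With \<open>\<tau> = ln r\<close> this is the radial profile
  \<open>r powr c * exp (- b * r^2)\<close>. Its derivative is the function itself times a factor
  already known to be smooth, so the induction closes.\<close>

lemma Ck_exp_exp: "Ck n (\<lambda>\<tau>. of_real (exp (c * \<tau> - b * exp (2 * \<tau>))))"
proof (induction n)
  case (Suc n)
  have *: "Ck n (\<lambda>\<tau>. of_real c + of_real (-2 * b) * of_real (exp (2 * \<tau>)))"
    by (intro Ck_add Ck_mult Ck_const Ck_exp)
  show ?case
    by (rule Ck_SucI[OF _ Ck_mult[OF * Suc]])
      (auto intro!: derivative_eq_intros has_vector_derivative_of_real simp flip: of_real_mult of_real_add of_real_minus has_real_derivative_iff_has_vector_derivative simp: algebra_simps)
qed simp

section \<open>Flat functions and compactly supported bumps\<close>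

definition flat :: "nat \<Rightarrow> real \<Rightarrow> real" where
  "flat k x = (if x > 0 then exp (- 1 / x) / x ^ k else 0)"

lemma flat_nonneg: "0 \<le> flat k x"
  by (simp add: flat_def)

text \<open>A single term, of index \<open>k + j\<close>, of the exponential series of
  \<open>1 / x\<close> is at most \<open>exp (1 / x)\<close>. Hence \<open>flat k\<close> vanishes
  to every order \<open>j\<close> at \<open>0\<close>.\<close>

lemma flat_le: "flat k x \<le> fact (k + j) * \<bar>x\<bar> ^ j"
proof (cases "x > 0")
  case True
  have "(1/x) ^ (k+j) / fact (k+j) \<le> exp (1/x)"
  proof -
    have "(1/x) ^ (k+j) / fact (k+j) = (\<Sum>i\<in>{k+j}. (1/x) ^ i / fact i)" by simp
    also have "\<dots> \<le> (\<Sum>i. (1/x) ^ i / fact i)"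
      using True summable_exp[of "1/x"]
      by (intro sum_le_suminf) (auto simp: field_simps)
    also have "\<dots> = exp (1/x)" by (simp add: exp_def scaleR_conv_of_real field_simps)
    finally show ?thesis .
  qed
  hence "exp (- 1 / x) / x ^ k \<le> fact (k+j) * x ^ j"
    using True by (simp add: exp_minus field_simps power_add)
  thus ?thesis using True by (simp add: flat_def)
qed (simp add: flat_def)

text \<open>The index \<open>k\<close> makes the family closed under differentiation, so that
  smoothness can be proved by induction for all \<open>k\<close> at once.\<close>

lemma flat_has_derivative:
  "(flat k has_real_derivative flat (k+2) x - real k * flat (k+1) x) (at x)"
proof -
  consider "x > 0" | "x < 0" | "x = 0" by linarith
  thus ?thesis
  proof cases
    case 1
    have "((\<lambda>x. exp (- 1 / x) / x ^ k) has_real_derivative flat (k+2) x - real k * flat (k+1) x) (at x)"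
      using 1 by (auto intro!: derivative_eq_intros simp: flat_def field_simps power2_eq_square power_add)
        (cases k; simp add: field_simps)
    moreover have "\<forall>\<^sub>F y in nhds x. flat k y = exp (- 1 / y) / y ^ k"
      using eventually_nhds_in_open[of "{0<..}" x] 1 by (auto elim!: eventually_mono simp: flat_def)
    ultimately show ?thesis by (subst DERIV_cong_ev[OF refl _ refl]) auto
  next
    case 2
    have "\<forall>\<^sub>F y in nhds x. flat k y = 0"
      using eventually_nhds_in_open[of "{..<0}" x] 2 by (auto elim!: eventually_mono simp: flat_def)
    hence "(flat k has_real_derivative 0) (at x)" by (subst DERIV_cong_ev[OF refl _ refl]) auto
    thus ?thesis using 2 by (simp add: flat_def)
  next
    case 3
    have "((\<lambda>h. (flat k (0 + h) - flat k 0) / h) \<longlongrightarrow> 0) (at 0)"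
    proof (rule Lim_null_comparison)
      have "((\<lambda>h. fact (k+2) * \<bar>h\<bar>) \<longlongrightarrow> fact (k+2) * \<bar>0::real\<bar>) (at 0)" by (intro tendsto_intros)
      thus "((\<lambda>h::real. fact (k+2) * \<bar>h\<bar>) \<longlongrightarrow> 0) (at 0)" by simp
      show "\<forall>\<^sub>F h in at 0. norm ((flat k (0 + h) - flat k 0) / h) \<le> fact (k+2) * \<bar>h\<bar>"
      proof (rule eventually_mono[OF eventually_neq_at_within[of 0]])
        fix h :: real assume "h \<noteq> 0"
        \<comment> \<open>Order \<open>j = 2\<close>: one factor \<open>|h|\<close> is cancelled by
          the difference quotient, the other one tends to \<open>0\<close>.\<close>
        have "flat k h \<le> fact (k+2) * \<bar>h\<bar> ^ 2" by (rule flat_le)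
        thus "norm ((flat k (0 + h) - flat k 0) / h) \<le> fact (k+2) * \<bar>h\<bar>"
          using \<open>h \<noteq> 0\<close> flat_nonneg[of k h]
          by (simp add: flat_def[of _ 0] divide_le_eq power2_eq_square abs_mult_self_eq mult.assoc del: fact_Suc)
      qed
    qed
    thus ?thesis using 3 by (simp add: DERIV_def flat_def[of _ 0])
  qed
qed

text \<open>The factor \<open>exp 1\<close> normalises the value at \<open>0\<close> to
  \<open>1\<close>. The function vanishes for \<open>|c * \<tau>| >= 1\<close>, so
  \<open>c = 1 / N\<close> cuts off at \<open>|\<tau>| = N\<close> with a slope of order
  \<open>1 / N\<close>.\<close>

definition bump :: "real \<Rightarrow> real \<Rightarrow> real" where
  "bump c \<tau> = exp 1 * flat 0 (1 - (c * \<tau>)\<^sup>2)"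

definition bump' :: "real \<Rightarrow> real \<Rightarrow> real" where
  "bump' c \<tau> = exp 1 * flat 2 (1 - (c * \<tau>)\<^sup>2) * (- 2 * c\<^sup>2 * \<tau>)"

lemma bump_has_derivative: "(bump c has_real_derivative bump' c \<tau>) (at \<tau>)"
  unfolding bump_def bump'_def
  by (rule derivative_eq_intros DERIV_chain2[OF flat_has_derivative] refl)+ (simp add: power2_eq_square numeral_2_eq_2)

lemma Ck_flat: "Ck n (\<lambda>\<tau>. of_real (flat k (1 - (c * \<tau>)\<^sup>2)))"
proof (induction n arbitrary: k)
  case (Suc n)
  have id: "Ck n (\<lambda>\<tau>. of_real \<tau>)" 
  proof (cases n)
    case (Suc k)
    have "(complex_of_real has_vector_derivative 1) (at \<tau>)" for \<tau>
      using has_vector_derivative_of_real[OF DERIV_ident] by simp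
    thus ?thesis unfolding Suc by (rule Ck_SucI[OF _ Ck_const])
  qed simp
  have *: "Ck n (\<lambda>\<tau>. (of_real (flat (k+2) (1 - (c * \<tau>)\<^sup>2)) + of_real (- real k) * of_real (flat (k+1) (1 - (c * \<tau>)\<^sup>2)))
       * (of_real (- 2 * c\<^sup>2) * of_real \<tau>))"
    by (intro Ck_add Ck_mult Ck_const Suc id)
  show ?case
  proof (rule Ck_SucI[OF _ *])
    fix \<tau> :: real
    have "((\<lambda>\<tau>. 1 - (c * \<tau>)\<^sup>2) has_real_derivative - 2 * c\<^sup>2 * \<tau>) (at \<tau>)"
      by (auto intro!: derivative_eq_intros simp: power2_eq_square)
    have "((\<lambda>\<tau>. complex_of_real (flat k (1 - (c * \<tau>)\<^sup>2))) has_vector_derivative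
       of_real ((flat (k+2) (1 - (c * \<tau>)\<^sup>2) - real k * flat (k+1) (1 - (c * \<tau>)\<^sup>2)) * (- 2 * c\<^sup>2 * \<tau>))) (at \<tau>)"
      by (rule has_vector_derivative_of_real[OF DERIV_chain2[OF flat_has_derivative \<open>(_ has_real_derivative _) _\<close>]])
    thus "((\<lambda>\<tau>. complex_of_real (flat k (1 - (c * \<tau>)\<^sup>2))) has_vector_derivative
       (of_real (flat (k+2) (1 - (c * \<tau>)\<^sup>2)) + of_real (- real k) * of_real (flat (k+1) (1 - (c * \<tau>)\<^sup>2)))
       * (of_real (- 2 * c\<^sup>2) * of_real \<tau>)) (at \<tau>)"
      by (simp add: algebra_simps)
  qed
qed simp

lemma Ck_bump: "Ck n (\<lambda>\<tau>. of_real (bump c \<tau>))"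
  unfolding bump_def of_real_mult by (intro Ck_mult Ck_const Ck_flat)

lemma bump_eq_0: "\<bar>c * \<tau>\<bar> \<ge> 1 \<Longrightarrow> bump c \<tau> = 0"
  and bump'_eq_0: "\<bar>c * \<tau>\<bar> \<ge> 1 \<Longrightarrow> bump' c \<tau> = 0"
  using abs_square_less_1[of "c * \<tau>"] by (auto simp: bump_def bump'_def flat_def)

lemma bump_nonneg: "0 \<le> bump c \<tau>"
  by (simp add: bump_def flat_nonneg)

lemma bump_le_1: "bump c \<tau> \<le> 1"
proof (cases "1 - (c * \<tau>)\<^sup>2 > 0")
  case True
  define s where "s = 1 - (c * \<tau>)\<^sup>2"
  have s: "0 < s" "s \<le> 1" using True by (auto simp: s_def)
  have "bump c \<tau> = exp (1 - 1 / s)"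
    using s unfolding bump_def s_def[symmetric] by (simp add: flat_def exp_diff exp_minus divide_inverse)
  also have "\<dots> \<le> 1" using s by simp
  finally show ?thesis .
qed (simp add: bump_def flat_def)

lemma abs_bump'_le: "\<bar>bump' c \<tau>\<bar> \<le> 4 * exp 1 * \<bar>c\<bar>"
proof (cases "\<bar>c * \<tau>\<bar> \<ge> 1")
  case False
  \<comment> \<open>Vanishing order \<open>j = 0\<close> in \<open>flat_le\<close> gives the bound
    \<open>fact 2 = 2\<close>; the inner derivative contributes
    \<open>2 * |c| * |c * \<tau>|\<close>, which explains the constant \<open>4\<close>.\<close>
  have "flat 2 (1 - (c * \<tau>)\<^sup>2) \<le> 2"
    using flat_le[of 2 "1 - (c * \<tau>)\<^sup>2" 0] by (simp add: fact_2)
  moreover have "\<bar>c * \<tau>\<bar> \<le> 1" using False by simp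
  ultimately have "flat 2 (1 - (c * \<tau>)\<^sup>2) * \<bar>c * \<tau>\<bar> \<le> 2 * 1"
    by (intro mult_mono) auto
  hence "exp 1 * 2 * \<bar>c\<bar> * (flat 2 (1 - (c * \<tau>)\<^sup>2) * \<bar>c * \<tau>\<bar>) \<le> exp 1 * 2 * \<bar>c\<bar> * (2 * 1)"
    by (intro mult_left_mono) auto
  thus ?thesis
    using flat_nonneg[of 2 "1 - (c * \<tau>)\<^sup>2"]
    by (simp add: bump'_def abs_mult power2_eq_square mult_ac)
qed (simp add: bump'_eq_0)

lemma bump_tendsto_1: "(\<lambda>n. bump (1 / real (Suc n)) \<tau>) \<longlonglongrightarrow> 1"
proof -
  have "isCont (flat 0) (1 - (0 * \<tau>)\<^sup>2)" using flat_has_derivative DERIV_isCont by blast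
  moreover have "(\<lambda>n. 1 - (1 / real (Suc n) * \<tau>)\<^sup>2) \<longlonglongrightarrow> 1 - (0 * \<tau>)\<^sup>2"
    using LIMSEQ_inverse_real_of_nat by (intro tendsto_intros) (simp add: inverse_eq_divide)
  ultimately have "(\<lambda>n. flat 0 (1 - (1 / real (Suc n) * \<tau>)\<^sup>2)) \<longlonglongrightarrow> flat 0 (1 - (0 * \<tau>)\<^sup>2)"
    by (rule isCont_tendsto_compose)
  hence "(\<lambda>n. exp 1 * flat 0 (1 - (1 / real (Suc n) * \<tau>)\<^sup>2)) \<longlonglongrightarrow> exp 1 * flat 0 (1 - (0 * \<tau>)\<^sup>2)"
    by (intro tendsto_intros)
  thus ?thesis by (simp add: bump_def flat_def exp_minus)
qed

lemma bump_measurable [measurable]: "bump c \<in> borel_measurable borel"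
  using bump_has_derivative DERIV_isCont
  by (intro borel_measurable_continuous_onI continuous_at_imp_continuous_on) blast

lemma bump'_measurable [measurable]: "bump' c \<in> borel_measurable borel"
proof (rule borel_measurable_continuous_onI)
  have fc: "continuous_on UNIV (flat 2)"
    using flat_has_derivative DERIV_isCont by (intro continuous_at_imp_continuous_on) blast
  show "continuous_on UNIV (bump' c)"
    unfolding bump'_def by (intro continuous_intros continuous_on_compose2[OF fc]) auto
qed

text \<open>The value \<open>0\<close> at the origin makes the junk value \<open>ln 0\<close> in log-polar expressions harmless.\<close>
definition ang :: "int \<Rightarrow> complex \<Rightarrow> complex" where
  "ang m x = (if x = 0 then 0 else sgn x powi m)"

lemma norm_ang: "x \<noteq> 0 \<Longrightarrow> cmod (ang m x) = 1"
  by (simp add: ang_def norm_power_int norm_sgn)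

lemma norm_ang_le: "cmod (ang m x) \<le> 1"
  by (simp add: ang_def norm_power_int norm_sgn)

lemma ang_mult: "ang m x * ang k x = ang (m + k) x"
  by (auto simp: ang_def power_int_add sgn_zero_iff)

lemma cnj_ang: "cnj (ang m x) = ang (- m) x"
proof (cases "x = 0")
  case False
  have "sgn x * cnj (sgn x) = 1"
    using False by (simp add: complex_norm_square[symmetric] norm_sgn)
  hence "cnj (sgn x) = inverse (sgn x)"
    using False by (simp add: field_simps sgn_zero_iff)
  thus ?thesis using False by (simp add: ang_def power_int_minus power_int_inverse)
qed (simp add: ang_def)

lemma continuous_on_ang: "continuous_on (- {0}) (ang m)"
proof -
  have "continuous_on (- {0}) (\<lambda>x::complex. sgn x powi m)"
    by (intro continuous_intros continuous_on_sgn) (auto simp: sgn_zero_iff)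
  thus ?thesis by (rule continuous_on_eq) (auto simp: ang_def)
qed

lemma ang_measurable [measurable]: "ang m \<in> borel_measurable borel"
proof -
  have "(\<lambda>x. indicator (- {0}) x *\<^sub>R ang m x) \<in> borel_measurable borel"
    by (rule borel_measurable_continuous_on_indicator[OF _ continuous_on_ang]) auto
  thus ?thesis by (rule measurable_cong[THEN iffD1, rotated]) (auto simp: ang_def)
qed

section \<open>Derivatives of angular characters and separated functions\<close>

lemma has_derivative_ln_cmod:
  assumes "x \<noteq> 0"
  shows "((\<lambda>x. ln (cmod x)) has_derivative (\<lambda>v. Re (v / x))) (at x)"
proof -
  have "((\<lambda>x. ln (cmod x)) has_derivative (\<lambda>v. (v \<bullet> sgn x) / cmod x)) (at x)"
    using assms by (auto intro!: derivative_eq_intros has_derivative_norm simp: divide_inverse)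
  moreover have "(v \<bullet> sgn x) / cmod x = Re (v / x)" for v
    using assms by (simp add: inner_complex_def sgn_div_norm Re_divide' cmod_power2[symmetric] field_simps power2_eq_square)
  ultimately show ?thesis by simp
qed

text \<open>Writing \<open>sgn x = x * exp (- ln |x|)\<close>, the logarithmic derivative is
  \<open>v / x - Re (v / x)\<close>, so only the imaginary part survives.\<close>

lemma has_derivative_sgn_complex:
  fixes x :: complex
  assumes "x \<noteq> 0"
  shows "(sgn has_derivative (\<lambda>v. \<i> * of_real (Im (v / x)) * sgn x)) (at x)"
proof -
  have "((\<lambda>x. x * of_real (exp (- ln (cmod x)))) has_derivative 
     (\<lambda>v. x * of_real (exp (- ln (cmod x)) * - Re (v / x)) + v * of_real (exp (- ln (cmod x))))) (at x)"
    using assms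
    by (intro has_derivative_mult has_derivative_ident has_derivative_of_real)
       (rule has_derivative_eq_rhs[OF DERIV_exp[THEN DERIV_compose_FDERIV, OF has_derivative_minus[OF has_derivative_ln_cmod]]], auto simp: mult.commute)
  moreover have "x * of_real (exp (- ln (cmod x)) * - Re (v / x)) + v * of_real (exp (- ln (cmod x))) =
      \<i> * of_real (Im (v / x)) * sgn x" for v
  proof -
    have "x * of_real (exp (- ln (cmod x)) * - Re (v / x)) + v * of_real (exp (- ln (cmod x)))
       = (v / x - of_real (Re (v / x))) * sgn x"
      using assms by (simp add: exp_minus sgn_div_norm scaleR_conv_of_real field_simps)
    also have "v / x - of_real (Re (v / x)) = \<i> * of_real (Im (v / x))"
      by (metis add_diff_cancel_left' complex_eq)
    finally show ?thesis .
  qed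
  ultimately have "((\<lambda>x. x * of_real (exp (- ln (cmod x)))) has_derivative (\<lambda>v. \<i> * of_real (Im (v / x)) * sgn x)) (at x)"
    by simp
  thus ?thesis
    by (rule has_derivative_transform_within_open[of _ _ _ _ "- {0}"])
      (use assms in \<open>auto simp: exp_minus sgn_div_norm scaleR_conv_of_real field_simps\<close>)
qed

lemma has_derivative_ang:
  assumes "x \<noteq> 0"
  shows "(ang m has_derivative (\<lambda>v. \<i> * of_real (of_int m * Im (v / x)) * ang m x)) (at x)"
proof -
  have "((\<lambda>x. sgn x powi m) has_derivative (\<lambda>v. (\<i> * of_real (Im (v / x)) * sgn x) * (of_int m * sgn x powi (m - 1)))) (at x)"
    by (rule has_derivative_power_int[OF _ has_derivative_sgn_complex]) (use assms in \<open>auto simp: sgn_zero_iff\<close>)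
  moreover have "(\<i> * of_real (Im (v / x)) * sgn x) * (of_int m * sgn x powi (m - 1)) = \<i> * of_real (of_int m * Im (v / x)) * ang m x" for v
    using assms by (simp add: ang_def power_int_diff sgn_zero_iff)
  ultimately have "((\<lambda>x. sgn x powi m) has_derivative (\<lambda>v. \<i> * of_real (of_int m * Im (v / x)) * ang m x)) (at x)" by simp
  thus ?thesis
    by (rule has_derivative_transform_within_open[of _ _ _ _ "- {0}"]) (use assms in \<open>auto simp: ang_def\<close>)
qed

text \<open>A separated function in logarithmic polar coordinates. Taking \<open>ln r\<close>
  instead of \<open>r\<close> as variable turns the operator \<open>r d/dr\<close> into plain
  differentiation of \<open>g\<close>.\<close>

definition lpol :: "(real \<Rightarrow> complex) \<Rightarrow> int \<Rightarrow> complex \<Rightarrow> complex" where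
  "lpol g m x = g (ln (cmod x)) * ang m x"

lemma has_derivative_lpol:
  assumes "x \<noteq> 0" "(g has_vector_derivative g') (at (ln (cmod x)))"
  shows "(lpol g m has_derivative (\<lambda>v. (of_real (Re (v / x)) * g' + \<i> * of_real (of_int m * Im (v / x)) * g (ln (cmod x))) * ang m x)) (at x)"
proof -
  have "((\<lambda>x. g (ln (cmod x))) has_derivative (\<lambda>v. Re (v / x) *\<^sub>R g')) (at x)"
    using has_derivative_compose[OF has_derivative_ln_cmod[OF assms(1)] assms(2)[unfolded has_vector_derivative_def]]
    by (simp add: o_def)
  from has_derivative_mult[OF this has_derivative_ang[OF assms(1)]]
  show ?thesis unfolding lpol_def
    by (rule has_derivative_eq_rhs) (auto simp: fun_eq_iff scaleR_conv_of_real algebra_simps)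
qed

text \<open>This and the next identity split a derivative into its parts along \<open>1 / x\<close>
  and \<open>1 / cnj x\<close>. The former lowers the angular index by one, the latter raises it by
  one.\<close>

lemma Re_div_conv: "complex_of_real (Re (v / x)) = (v / x + cnj v / cnj x) / 2"
  by (metis complex_add_cnj complex_cnj_divide nonzero_mult_div_cancel_left of_real_mult of_real_numeral zero_neq_numeral)

lemma Im_div_conv: "\<i> * complex_of_real (Im (v / x)) = (v / x - cnj v / cnj x) / 2"
  using complex_diff_cnj[of "v / x"] by simp

lemma inverse_conv_ang: "x \<noteq> 0 \<Longrightarrow> inverse x = of_real (exp (- ln (cmod x))) * ang (-1) x"
  by (simp add: ang_def exp_minus sgn_div_norm scaleR_conv_of_real power_int_minus field_simps)

lemma inverse_cnj_conv_ang: "x \<noteq> 0 \<Longrightarrow> inverse (cnj x) = of_real (exp (- ln (cmod x))) * ang 1 x"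
  using arg_cong[OF inverse_conv_ang[of x], of cnj] by (simp add: cnj_ang)

section \<open>Support away from the origin and construction of test functions\<close>

definition cs_smooth :: "(real \<Rightarrow> complex) \<Rightarrow> bool" where
  "cs_smooth g \<longleftrightarrow> (\<forall>n. Ck n g) \<and> (\<exists>R. \<forall>\<tau>. \<bar>\<tau>\<bar> > R \<longrightarrow> g \<tau> = 0)"

lemma cs_smooth_bump: "cs_smooth (\<lambda>\<tau>. of_real (bump (1 / real (Suc n)) \<tau>))"
  unfolding cs_smooth_def
proof (intro conjI allI exI[of _ "real (Suc n)"] impI)
  fix \<tau> assume "real (Suc n) < \<bar>\<tau>\<bar>"
  hence "\<bar>1 / real (Suc n) * \<tau>\<bar> \<ge> 1" by (simp add: abs_mult field_simps)
  thus "complex_of_real (bump (1 / real (Suc n)) \<tau>) = 0" by (simp only: bump_eq_0 of_real_0)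
qed (rule Ck_bump)

lemma cs_smooth_deriv:
  assumes "cs_smooth g"
  obtains g' where "\<And>\<tau>. (g has_vector_derivative g' \<tau>) (at \<tau>)" "cs_smooth g'"
proof -
  obtain g' where g': "\<And>\<tau>. (g has_vector_derivative g' \<tau>) (at \<tau>)"
    using assms unfolding cs_smooth_def by (metis Ck.simps(2))
  \<comment> \<open>Each order \<open>n\<close> supplies its own derivative of \<open>g\<close>;
    uniqueness of derivatives identifies all of them with \<open>g'\<close>.\<close>
  have "Ck n g'" for n
  proof -
    obtain h where h: "\<And>\<tau>. (g has_vector_derivative h \<tau>) (at \<tau>)" "Ck n h"
      using assms unfolding cs_smooth_def by (metis Ck.simps(2))
    have "h = g'" using h(1) g' vector_derivative_unique_at by blast
    thus ?thesis using h by simp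
  qed
  moreover from assms obtain R where R: "\<And>\<tau>. \<bar>\<tau>\<bar> > R \<Longrightarrow> g \<tau> = 0"
    by (auto simp: cs_smooth_def)
  have "g' \<tau> = 0" if "\<bar>\<tau>\<bar> > R" for \<tau>
  proof -
    have o: "open {\<tau>::real. \<bar>\<tau>\<bar> > R}"
      by (intro open_Collect_less continuous_intros)
    have "((\<lambda>\<tau>. 0) has_vector_derivative g' \<tau>) (at \<tau>)"
      by (rule has_vector_derivative_transform_within_open[OF g'[of \<tau>] o]) (use that R in auto)
    thus ?thesis using vector_derivative_unique_at has_vector_derivative_const by blast
  qed
  ultimately show ?thesis using that g' unfolding cs_smooth_def by blast
qed

lemma cs_smooth_mult:
  assumes "cs_smooth g" "\<And>n. Ck n h"
  shows "cs_smooth (\<lambda>\<tau>. g \<tau> * h \<tau>)" "cs_smooth (\<lambda>\<tau>. h \<tau> * g \<tau>)"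
  using assms unfolding cs_smooth_def by (metis Ck_mult mult_zero_left mult_zero_right)+

lemma cs_smooth_add:
  assumes "cs_smooth g" "cs_smooth h"
  shows "cs_smooth (\<lambda>\<tau>. g \<tau> + h \<tau>)"
proof -
  obtain R S where "\<And>\<tau>. \<bar>\<tau>\<bar> > R \<Longrightarrow> g \<tau> = 0" "\<And>\<tau>. \<bar>\<tau>\<bar> > S \<Longrightarrow> h \<tau> = 0"
    using assms by (auto simp: cs_smooth_def)
  hence "\<forall>\<tau>. \<bar>\<tau>\<bar> > max R S \<longrightarrow> g \<tau> + h \<tau> = 0" by simp
  thus ?thesis using assms unfolding cs_smooth_def by (blast intro: Ck_add)
qed

text \<open>Support in a closed annulus. In particular the function is zero on a disc around the
  origin, which settles continuity and differentiability at the singular point.\<close>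

definition supp0 :: "(complex \<Rightarrow> complex) \<Rightarrow> bool" where
  "supp0 F \<longleftrightarrow> (\<exists>\<delta>>0. \<exists>R. \<forall>x. F x \<noteq> 0 \<longrightarrow> \<delta> \<le> cmod x \<and> cmod x \<le> R)"

lemma supp0I: "\<delta> > 0 \<Longrightarrow> (\<And>x. F x \<noteq> 0 \<Longrightarrow> \<delta> \<le> cmod x \<and> cmod x \<le> R) \<Longrightarrow> supp0 F"
  by (auto simp: supp0_def)

lemma supp0_add:
  assumes "supp0 f" "supp0 g"
  shows "supp0 (\<lambda>x. f x + g x)"
proof -
  obtain d1 R1 d2 R2 where d: "d1 > 0" "d2 > 0" and
    1: "\<And>x. f x \<noteq> 0 \<Longrightarrow> d1 \<le> cmod x \<and> cmod x \<le> R1" and 2: "\<And>x. g x \<noteq> 0 \<Longrightarrow> d2 \<le> cmod x \<and> cmod x \<le> R2"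
    using assms unfolding supp0_def by metis
  show ?thesis
  proof (rule supp0I[of "min d1 d2" _ "max R1 R2"])
    fix x assume "f x + g x \<noteq> 0"
    hence "f x \<noteq> 0 \<or> g x \<noteq> 0" by auto
    thus "min d1 d2 \<le> cmod x \<and> cmod x \<le> max R1 R2" using 1[of x] 2[of x] by auto
  qed (use d in auto)
qed

lemma supp0_subset: "supp0 f \<Longrightarrow> (\<And>x. f x = 0 \<Longrightarrow> g x = 0) \<Longrightarrow> supp0 g"
  unfolding supp0_def by metis

lemma supp0_lpol:
  assumes "\<And>\<tau>. \<bar>\<tau>\<bar> > R \<Longrightarrow> g \<tau> = 0"
  shows "supp0 (lpol g m)"
proof (rule supp0I[of "exp (- R)" _ "exp R"])
  fix x assume "lpol g m x \<noteq> 0"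
  hence x: "x \<noteq> 0" "g (ln (cmod x)) \<noteq> 0" by (auto simp: lpol_def ang_def split: if_splits)
  hence "\<bar>ln (cmod x)\<bar> \<le> R" using assms not_less by blast
  hence "-R \<le> ln (cmod x)" "ln (cmod x) \<le> R" by linarith+
  thus "exp (- R) \<le> cmod x \<and> cmod x \<le> exp R"
    using x by (metis exp_le_cancel_iff exp_ln zero_less_norm_iff)
qed auto

text \<open>Sums are included because a Cartesian derivative of one separated function is a sum of
  two. The set is then closed under \<open>pd\<close>, which gives smoothness in the sense of
  iterated directional derivatives.\<close>

inductive_set lpol_sums :: "(complex \<Rightarrow> complex) set" where
  lpol: "cs_smooth g \<Longrightarrow> lpol g m \<in> lpol_sums"
| add: "f \<in> lpol_sums \<Longrightarrow> h \<in> lpol_sums \<Longrightarrow> (\<lambda>x. f x + h x) \<in> lpol_sums"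

lemma lpol_sums_supp0: "f \<in> lpol_sums \<Longrightarrow> supp0 f"
  by (induction rule: lpol_sums.induct) (auto intro: supp0_add supp0_lpol simp: cs_smooth_def)

lemma supp0_has_derivative_0:
  assumes "supp0 f"
  shows "(f has_derivative (\<lambda>v. 0)) (at 0)"
proof -
  obtain d R where "d > 0" and d: "\<And>x. f x \<noteq> 0 \<Longrightarrow> d \<le> cmod x \<and> cmod x \<le> R"
    using assms unfolding supp0_def by blast
  show ?thesis
  proof (rule has_derivative_transform_within_open[OF has_derivative_const[of 0], of "ball 0 d"])
    fix x :: complex assume "x \<in> ball 0 d"
    thus "0 = f x" using d[of x] by (cases "f x = 0") auto
  qed (use \<open>d > 0\<close> in auto)
qed

text \<open>In Wirtinger form the derivative in direction \<open>v\<close> consists of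
  \<open>v / 2 * (g' + m * g) * exp (- \<tau>)\<close> at angular index \<open>m - 1\<close> and
  \<open>cnj v / 2 * (g' - m * g) * exp (- \<tau>)\<close> at index \<open>m + 1\<close>.\<close>

lemma lpol_sums_pd: "f \<in> lpol_sums \<Longrightarrow> (\<forall>x. f differentiable (at x)) \<and> pd v f \<in> lpol_sums"
proof (induction rule: lpol_sums.induct)
  case (lpol g m)
  obtain g' where g': "\<And>\<tau>. (g has_vector_derivative g' \<tau>) (at \<tau>)" "cs_smooth g'"
    using cs_smooth_deriv[OF lpol] by blast
  let ?g1 = "\<lambda>\<tau>. (v / 2) * ((g' \<tau> + of_int m * g \<tau>) * of_real (exp (-1 * \<tau>)))"
  let ?g2 = "\<lambda>\<tau>. (cnj v / 2) * ((g' \<tau> + of_int (- m) * g \<tau>) * of_real (exp (-1 * \<tau>)))"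
  have cs: "cs_smooth ?g1" "cs_smooth ?g2"
    by (intro cs_smooth_mult(2) cs_smooth_mult(1) cs_smooth_add Ck_const Ck_exp g' lpol)+
  have d0: "(lpol g m has_derivative (\<lambda>v. 0)) (at 0)"
    by (rule supp0_has_derivative_0[OF lpol_sums_supp0[OF lpol_sums.lpol[OF lpol]]])
  have "pd v (lpol g m) x = lpol ?g1 (m - 1) x + lpol ?g2 (m + 1) x" for x
  proof (cases "x = 0")
    case True
    show ?thesis using frechet_derivative_at[OF d0, symmetric] True by (simp add: pd_def lpol_def ang_def)
  next
    case False
    let ?t = "ln (cmod x)"
    have iv: "v / x = v * (of_real (exp (- ?t)) * ang (-1) x)" "cnj v / cnj x = cnj v * (of_real (exp (- ?t)) * ang 1 x)"
      using False inverse_conv_ang[of x] inverse_cnj_conv_ang[of x] by (simp_all add: divide_inverse)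
    have "pd v (lpol g m) x = (of_real (Re (v / x)) * g' ?t + (\<i> * of_real (Im (v / x))) * of_int m * g ?t) * ang m x"
      unfolding pd_def frechet_derivative_at[OF has_derivative_lpol[OF False g'(1)], symmetric] by (simp add: mult_ac)
    also have "\<dots> = ((v / x) / 2 * (g' ?t + of_int m * g ?t) + (cnj v / cnj x) / 2 * (g' ?t - of_int m * g ?t)) * ang m x"
    proof -
      have "((a + b) / 2 * p + (a - b) / 2 * M * q) * r = (a / 2 * (p + M * q) + b / 2 * (p - M * q)) * r"
        for a b p q M r :: complex by (simp add: field_simps)
      thus ?thesis unfolding Re_div_conv Im_div_conv .
    qed
    also have "\<dots> = (v / 2) * ((g' ?t + of_int m * g ?t) * of_real (exp (-?t))) * (ang (-1) x * ang m x)
        + (cnj v / 2) * ((g' ?t - of_int m * g ?t) * of_real (exp (-?t))) * (ang 1 x * ang m x)"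
    proof -
      have "((v * (e * a)) / 2 * p + (w * (e * b)) / 2 * q) * r = (v / 2) * (p * e) * (a * r) + (w / 2) * (q * e) * (b * r)"
        for v w e a b p q r :: complex by (simp add: field_simps)
      thus ?thesis unfolding iv .
    qed
    also have "\<dots> = lpol ?g1 (m - 1) x + lpol ?g2 (m + 1) x"
      unfolding ang_mult by (simp add: lpol_def add.commute)
    finally show ?thesis .
  qed
  hence "pd v (lpol g m) = (\<lambda>x. lpol ?g1 (m - 1) x + lpol ?g2 (m + 1) x)" by blast
  moreover have "\<dots> \<in> lpol_sums" by (intro lpol_sums.intros cs)
  moreover have "lpol g m differentiable (at x)" for x
    using d0 has_derivative_lpol[OF _ g'(1), of x] by (cases "x = 0") (auto simp: differentiable_def)
  ultimately show ?case by simp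
next
  case (add f h)
  have "((\<lambda>x. f x + h x) has_derivative (\<lambda>v. frechet_derivative f (at x) v + frechet_derivative h (at x) v)) (at x)" for x
    using add by (intro has_derivative_add) (auto simp flip: frechet_derivative_works)
  from frechet_derivative_at[OF this, symmetric]
  have "pd v (\<lambda>x. f x + h x) = (\<lambda>x. pd v f x + pd v h x)" by (simp add: pd_def)
  thus ?case using add by (auto intro!: lpol_sums.add)
qed

lemma lpol_sums_foldr_pd: "f \<in> lpol_sums \<Longrightarrow> foldr pd ds f \<in> lpol_sums"
  by (induction ds) (use lpol_sums_pd in auto)

lemma lpol_sums_test_fun:
  assumes "f \<in> lpol_sums"
  shows "test_fun f"
proof -
  obtain d R where "d > 0" and d: "\<And>x. f x \<noteq> 0 \<Longrightarrow> d \<le> cmod x \<and> cmod x \<le> R"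
    using lpol_sums_supp0[OF assms] unfolding supp0_def by blast
  have "{x. f x \<noteq> 0} \<subseteq> cball 0 R - ball 0 d" using d by (fastforce simp: not_less[symmetric])
  moreover have "closed (cball 0 R - ball (0::complex) d)" by auto
  ultimately have c: "closure {x. f x \<noteq> 0} \<subseteq> cball 0 R - ball 0 d" by (rule closure_minimal)
  hence "bounded (closure {x. f x \<noteq> 0})" by (meson Diff_subset bounded_cball bounded_subset)
  hence "compact (closure {x. f x \<noteq> 0})" by (simp add: compact_eq_bounded_closed)
  moreover have "0 \<notin> closure {x. f x \<noteq> 0}" using c \<open>d > 0\<close> by auto
  ultimately show ?thesis
    using lpol_sums_pd[OF lpol_sums_foldr_pd[OF assms]] unfolding test_fun_def smooth_fun_def by blast
qed

section \<open>Integration by parts away from the origin\<close>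

text \<open>The derivative is carried along as an explicit function, so that closed formulas can be
  inserted. Nothing is demanded at the origin, where \<open>r powr nu\<close> times an angular
  character need not be differentiable.\<close>

definition C1_off_0 :: "(complex \<Rightarrow> complex) \<Rightarrow> (complex \<Rightarrow> complex \<Rightarrow> complex) \<Rightarrow> bool" where
  "C1_off_0 F F' \<longleftrightarrow> (\<forall>x. x \<noteq> 0 \<longrightarrow> (F has_derivative F' x) (at x)) \<and> (\<forall>v. continuous_on (- {0}) (\<lambda>x. F' x v))"

lemma C1oI:
  assumes "\<And>x. x \<noteq> 0 \<Longrightarrow> (F has_derivative F' x) (at x)" "\<And>v. continuous_on (- {0}) (\<lambda>x. F' x v)"
  shows "C1_off_0 F F'"
  using assms by (auto simp: C1_off_0_def)

lemma C1_off_0_has_derivative: "C1_off_0 F F' \<Longrightarrow> x \<noteq> 0 \<Longrightarrow> (F has_derivative F' x) (at x)"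
  by (simp add: C1_off_0_def)

lemma C1_off_0_continuous_deriv: "C1_off_0 F F' \<Longrightarrow> continuous_on (- {0}) (\<lambda>x. F' x v)"
  by (simp add: C1_off_0_def)

lemma C1_off_0_continuous: "C1_off_0 F F' \<Longrightarrow> continuous_on (- {0}) F"
  by (intro continuous_at_imp_continuous_on ballI has_derivative_continuous[OF C1_off_0_has_derivative]) auto

lemma C1_off_0_linear: "C1_off_0 F F' \<Longrightarrow> x \<noteq> 0 \<Longrightarrow> linear (F' x)"
  using C1_off_0_has_derivative has_derivative_linear by blast

lemma C1_off_0_deriv_scaleR: "C1_off_0 F F' \<Longrightarrow> x \<noteq> 0 \<Longrightarrow> F' x (of_real c * v) = of_real c * F' x v"
  using linear_scale[OF C1_off_0_linear] by (metis scaleR_conv_of_real)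

lemma C1_off_0_deriv_expand:
  assumes "C1_off_0 F F'" "x \<noteq> 0"
  shows "F' x v = of_real (Re v) * F' x 1 + of_real (Im v) * F' x \<i>"
proof -
  have "F' x v = F' x (Re v *\<^sub>R 1 + Im v *\<^sub>R \<i>)"
    by (metis complex_eq mult.commute mult.right_neutral scaleR_conv_of_real)
  also have "\<dots> = Re v *\<^sub>R F' x 1 + Im v *\<^sub>R F' x \<i>"
    by (simp only: linear_add[OF C1_off_0_linear[OF assms]] linear_scale[OF C1_off_0_linear[OF assms]])
  finally show ?thesis by (simp add: scaleR_conv_of_real)
qed

lemma C1_off_0_mult:
  assumes "C1_off_0 F F'" "C1_off_0 G G'"
  shows "C1_off_0 (\<lambda>x. F x * G x) (\<lambda>x v. F x * G' x v + F' x v * G x)"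
  using C1_off_0_continuous[OF assms(1)] C1_off_0_continuous[OF assms(2)] assms
  by (auto simp: C1_off_0_def intro!: has_derivative_mult continuous_intros)

lemma C1_off_0_add:
  assumes "C1_off_0 F F'" "C1_off_0 G G'"
  shows "C1_off_0 (\<lambda>x. F x + G x) (\<lambda>x v. F' x v + G' x v)"
  using assms by (auto simp: C1_off_0_def intro!: has_derivative_add continuous_intros)

lemma C1_off_0_cmult:
  assumes "C1_off_0 F F'"
  shows "C1_off_0 (\<lambda>x. c * F x) (\<lambda>x v. c * F' x v)"
  using assms by (auto simp: C1_off_0_def intro!: has_derivative_mult_right continuous_intros)

lemma C1_off_0_cnj:
  assumes "C1_off_0 F F'"
  shows "C1_off_0 (\<lambda>x. cnj (F x)) (\<lambda>x v. cnj (F' x v))"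
  using assms by (auto simp: C1_off_0_def intro!: bounded_linear.has_derivative[OF bounded_linear_cnj] continuous_intros)

lemma C1_off_0_linear_map:
  assumes "bounded_linear L"
  shows "C1_off_0 L (\<lambda>x v. L v)"
  using assms by (auto simp: C1_off_0_def intro!: bounded_linear_imp_has_derivative continuous_intros)

lemma C1_off_0_lpol:
  assumes "\<And>\<tau>. (g has_vector_derivative g' \<tau>) (at \<tau>)" "continuous_on UNIV g'"
  shows "C1_off_0 (lpol g m) (\<lambda>x v. (of_real (Re (v / x)) * g' (ln (cmod x)) + \<i> * of_real (of_int m * Im (v / x)) * g (ln (cmod x))) * ang m x)"
proof (rule C1oI)
  fix v
  have g: "continuous_on UNIV g"
    using assms(1) has_vector_derivative_continuous by (metis continuous_at_imp_continuous_on)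
  have l: "continuous_on (- {0}) (\<lambda>x::complex. ln (cmod x))"
    by (intro continuous_intros) auto
  have c: "continuous_on (- {0}) (\<lambda>x::complex. g (ln (cmod x)))" "continuous_on (- {0}) (\<lambda>x::complex. g' (ln (cmod x)))"
    using continuous_on_compose2[OF g l] continuous_on_compose2[OF assms(2) l] by auto
  show "continuous_on (- {0}) (\<lambda>x. (of_real (Re (v / x)) * g' (ln (cmod x)) + \<i> * of_real (of_int m * Im (v / x)) * g (ln (cmod x))) * ang m x)"
    by (intro continuous_intros continuous_on_ang c) auto
qed (rule has_derivative_lpol[OF _ assms(1)])

lemma supp0_continuous_UNIV:
  assumes "supp0 F" "continuous_on (- {0}) F"
  shows "continuous_on UNIV F"
proof -
  have "isCont F x" for x
  proof (cases "x = 0")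
    case True
    thus ?thesis using supp0_has_derivative_0[OF assms(1)] has_derivative_continuous by blast
  next
    case False
    thus ?thesis using assms(2) continuous_on_eq_continuous_at[of "- {0}" F] by auto
  qed
  thus ?thesis by (simp add: continuous_at_imp_continuous_on)
qed

lemma supp0_bounded:
  assumes "supp0 F" "continuous_on (- {0}) F"
  obtains M where "\<And>x. cmod (F x) \<le> M" "M \<ge> 0"
proof -
  obtain d R where "d > 0" and d: "\<And>x. F x \<noteq> 0 \<Longrightarrow> d \<le> cmod x \<and> cmod x \<le> R"
    using assms unfolding supp0_def by blast
  have "compact (F ` cball 0 R)"
    by (rule compact_continuous_image[OF continuous_on_subset[OF supp0_continuous_UNIV[OF assms]]]) auto
  hence "bounded (F ` cball 0 R)" by (rule compact_imp_bounded)
  then obtain M where "M > 0" and M': "\<forall>y\<in>F ` cball 0 R. norm y \<le> M"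
    unfolding bounded_pos by (elim exE conjE)
  hence M: "M > 0" "\<And>x. x \<in> cball 0 R \<Longrightarrow> cmod (F x) \<le> M" by simp_all
  show ?thesis
  proof (rule that[of M])
    fix x show "cmod (F x) \<le> M"
      using M d[of x] by (cases "F x = 0") auto
  qed (use M in auto)
qed

lemma supp0_integrable:
  assumes "supp0 F" "continuous_on (- {0}) F"
  shows "integrable lborel F"
proof -
  obtain d R where "d > 0" and d: "\<And>x. F x \<noteq> 0 \<Longrightarrow> d \<le> cmod x \<and> cmod x \<le> R"
    using assms unfolding supp0_def by blast
  have "integrable lborel (\<lambda>x. indicator (cball 0 R) x *\<^sub>R F x)"
    by (rule borel_integrable_compact[OF _ continuous_on_subset[OF supp0_continuous_UNIV[OF assms]]]) auto
  also have "(\<lambda>x. indicator (cball 0 R) x *\<^sub>R F x) = F"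
    using d by (auto simp: indicator_def fun_eq_iff)
  finally show ?thesis .
qed

lemma supp0_deriv:
  assumes "supp0 F" "C1_off_0 F F'"
  obtains d R where "d > 0" "\<And>x. F x \<noteq> 0 \<Longrightarrow> d \<le> cmod x \<and> cmod x \<le> R"
    "\<And>x v. x \<noteq> 0 \<Longrightarrow> F' x v \<noteq> 0 \<Longrightarrow> d \<le> cmod x \<and> cmod x \<le> R"
proof -
  obtain d R where "d > 0" and d: "\<And>x. F x \<noteq> 0 \<Longrightarrow> d \<le> cmod x \<and> cmod x \<le> R"
    using assms unfolding supp0_def by blast
  have "F' x v = 0" if "x \<noteq> 0" "cmod x < d \<or> cmod x > R" for x v
  proof -
    let ?S = "ball 0 d \<union> - cball (0::complex) R"
    have "((\<lambda>x. 0) has_derivative F' x) (at x)"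
      by (rule has_derivative_transform_within_open[OF C1_off_0_has_derivative[OF assms(2) that(1)], of ?S])
        (use that d not_le in \<open>auto simp: not_le[symmetric]\<close>)
    hence "F' x = (\<lambda>v. 0)" by (rule has_derivative_unique) (rule has_derivative_const)
    thus ?thesis by simp
  qed
  hence "d \<le> cmod x \<and> cmod x \<le> R" if "x \<noteq> 0" "F' x v \<noteq> 0" for x v
    using that not_le by blast
  thus ?thesis using that[OF \<open>d > 0\<close> d] by blast
qed

text \<open>\<open>C1_off_0\<close> leaves \<open>F' 0\<close> arbitrary, hence the explicit value
  \<open>0\<close> at the origin.\<close>

lemma supp0_deriv_field:
  assumes "supp0 F" "C1_off_0 F F'"
  shows "supp0 (\<lambda>x. if x = 0 then 0 else F' x (X x))"
proof (rule supp0_deriv[OF assms])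
  fix d R assume "d > 0" and d: "\<And>x v. x \<noteq> 0 \<Longrightarrow> F' x v \<noteq> 0 \<Longrightarrow> d \<le> cmod x \<and> cmod x \<le> R"
  show ?thesis by (rule supp0I[OF \<open>d > 0\<close>, of _ R], rule d) (auto split: if_splits)
qed

lemma continuous_on_if_0:
  "continuous_on (- {0::complex}) F \<Longrightarrow> continuous_on (- {0}) (\<lambda>x. if x = 0 then 0 else F x)"
  by (rule continuous_on_eq[of _ F]) auto

text \<open>By translation invariance every difference quotient of \<open>F\<close> has integral
  zero, and the quotients converge to the derivative under a common bound.\<close>

lemma integral_pd_zero:
  assumes "supp0 F" "C1_off_0 F F'"
  shows "integrable lborel (\<lambda>x. if x = 0 then 0 else F' x v)"
    "(\<integral>x. (if x = 0 then 0 else F' x v) \<partial>lborel) = 0"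
proof -
  let ?D = "\<lambda>x. if x = 0 then 0 else F' x v"
  have D0: "supp0 ?D" by (rule supp0_deriv_field[OF assms])
  have Dc: "continuous_on (- {0}) ?D" by (intro continuous_on_if_0 C1_off_0_continuous_deriv[OF assms(2)])
  show "integrable lborel ?D" by (rule supp0_integrable[OF D0 Dc])
  obtain M where M: "\<And>x. cmod (?D x) \<le> M" "M \<ge> 0" using supp0_bounded[OF D0 Dc] by blast
  obtain d R where "d > 0" and d: "\<And>x. F x \<noteq> 0 \<Longrightarrow> d \<le> cmod x \<and> cmod x \<le> R"
    using assms unfolding supp0_def by blast
  have Fi: "integrable lborel F" by (rule supp0_integrable[OF assms(1) C1_off_0_continuous[OF assms(2)]])
  have der: "(F has_derivative (\<lambda>w. if x = 0 then 0 else F' x w)) (at x)" for x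
    using supp0_has_derivative_0[OF assms(1)] C1_off_0_has_derivative[OF assms(2)] by (cases "x = 0") auto
  have der1: "((\<lambda>s::real. F (x + of_real s * v)) has_derivative (\<lambda>h. of_real h * ?D (x + of_real s * v))) (at s)" for x s
  proof -
    have 1: "((\<lambda>s::real. x + of_real s * v) has_derivative (\<lambda>h. of_real h * v)) (at s)"
      by (auto intro!: derivative_eq_intros)
    have "((\<lambda>s::real. F (x + of_real s * v)) has_derivative
        (\<lambda>h. (if x + of_real s * v = 0 then 0 else F' (x + of_real s * v) (of_real h * v)))) (at s)"
      using has_derivative_compose[OF 1 der] by (simp add: o_def)
    moreover have "(if y = 0 then 0 else F' y (of_real h * v)) = of_real h * ?D y" for y and h :: real
      using C1_off_0_deriv_scaleR[OF assms(2), of y h v] by auto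
    ultimately show ?thesis by simp
  qed
  define h where "h n = inverse (real (Suc n))" for n
  have h: "h n > 0" "h n \<le> 1" for n by (auto simp: h_def inverse_le_1_iff)
  have h0: "h \<longlonglongrightarrow> 0" unfolding h_def by (rule LIMSEQ_inverse_real_of_nat)
  define q where "q n x = (F (x + of_real (h n) * v) - F x) / of_real (h n)" for n x
  have trans: "integrable lborel (\<lambda>x. F (x + c))" "(\<integral>x. F (x + c) \<partial>lborel) = (\<integral>x. F x \<partial>lborel)" for c
  proof -
    have "integrable (distr lborel borel ((+) c)) F"
      using Fi by (simp add: lborel_distr_plus)
    thus "integrable lborel (\<lambda>x. F (x + c))"
      by (subst (asm) integrable_distr_eq) (use Fi in \<open>auto simp: add.commute\<close>)
    have "(\<integral>x. F x \<partial>lborel) = (\<integral>x. F x \<partial>distr lborel borel ((+) c))"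
      by (simp add: lborel_distr_plus)
    also have "\<dots> = (\<integral>x. F (c + x) \<partial>lborel)"
      by (subst integral_distr) (use Fi in auto)
    finally show "(\<integral>x. F (x + c) \<partial>lborel) = (\<integral>x. F x \<partial>lborel)" by (simp add: add.commute)
  qed
  have q0: "(\<integral>x. q n x \<partial>lborel) = 0" for n
    unfolding q_def using trans[of "of_real (h n) * v"] Fi by simp
  have "(\<lambda>n. \<integral>x. q n x \<partial>lborel) \<longlonglongrightarrow> (\<integral>x. ?D x \<partial>lborel)"
  \<comment> \<open>The steps satisfy \<open>h n <= 1\<close>, so the translated function vanishes
    outside the ball whose radius is enlarged by \<open>|v|\<close>. Inside, the mean value
    inequality bounds the quotient by the supremum \<open>M\<close> of the derivative.\<close>
  proof (rule integral_dominated_convergence[where w = "\<lambda>x. M * indicator (cball 0 (R + cmod v)) x"])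
    show "?D \<in> borel_measurable lborel" using \<open>integrable lborel ?D\<close> by auto
    show "q n \<in> borel_measurable lborel" for n
      unfolding q_def using trans(1) Fi by (intro borel_measurable_divide borel_measurable_diff) auto
    show "integrable lborel (\<lambda>x. M * indicator (cball 0 (R + cmod v)) x)"
      by (intro integrable_mult_right integrable_real_indicator) (use emeasure_bounded_finite[of "cball 0 (R + cmod v)"] in \<open>auto simp: top.not_eq_extremum\<close>)
    show "AE x in lborel. (\<lambda>n. q n x) \<longlonglongrightarrow> ?D x"
    proof (rule AE_I2)
      fix x
      have "((\<lambda>s. norm (F (x + of_real s * v) - F (x + of_real 0 * v) - of_real (s - 0) * ?D (x + of_real 0 * v)) / norm (s - 0)) \<longlongrightarrow> 0) (at 0)"
        using der1[of x 0] unfolding has_derivative_iff_norm by blast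
      hence "((\<lambda>s::real. norm ((F (x + of_real s * v) - F x) / of_real s - ?D x)) \<longlongrightarrow> 0) (at 0)"
      proof (rule Lim_transform_eventually)
        show "\<forall>\<^sub>F s in at 0. norm (F (x + of_real s * v) - F (x + of_real 0 * v) - of_real (s - 0) * ?D (x + of_real 0 * v)) / norm (s - 0)
          = norm ((F (x + of_real s * v) - F x) / of_real s - ?D x)"
        proof (rule eventually_mono[OF eventually_neq_at_within[of 0]])
          fix s :: real assume "s \<noteq> 0"
          hence "(F (x + of_real s * v) - F x) / of_real s - ?D x = (F (x + of_real s * v) - F x - of_real s * ?D x) / of_real s"
            by (simp add: diff_divide_distrib)
          thus "norm (F (x + of_real s * v) - F (x + of_real 0 * v) - of_real (s - 0) * ?D (x + of_real 0 * v)) / norm (s - 0)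
            = norm ((F (x + of_real s * v) - F x) / of_real s - ?D x)"
            by (simp only: norm_divide norm_of_real real_norm_def of_real_0 mult_zero_left add_0_right diff_0_right)
        qed
      qed
      hence "((\<lambda>s::real. (F (x + of_real s * v) - F x) / of_real s) \<longlongrightarrow> ?D x) (at 0)"
        by (rule Lim_null[THEN iffD2, OF tendsto_norm_zero_iff[THEN iffD1]])
      moreover have "filterlim h (at 0) sequentially"
        using h0 h(1) by (auto simp: filterlim_at less_imp_neq[THEN not_sym])
      ultimately show "(\<lambda>n. q n x) \<longlonglongrightarrow> ?D x"
        unfolding q_def by (rule filterlim_compose)
    qed
    fix n
    show "AE x in lborel. norm (q n x) \<le> M * indicator (cball 0 (R + cmod v)) x"
    proof (rule AE_I2)
      fix x
      show "norm (q n x) \<le> M * indicator (cball 0 (R + cmod v)) x"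
      proof (cases "x \<in> cball 0 (R + cmod v)")
        case True
        have "\<exists>s\<in>{0<..<h n}. norm (F (x + of_real (h n) * v) - F (x + of_real 0 * v)) \<le> norm (of_real (h n - 0) * ?D (x + of_real s * v))"
        proof (rule mvt_general[OF h(1)])
          show "continuous_on {0..h n} (\<lambda>s. F (x + of_real s * v))"
            by (intro continuous_at_imp_continuous_on ballI has_derivative_continuous[OF der1])
        qed (rule der1)
        then obtain s where "norm (F (x + of_real (h n) * v) - F x) \<le> norm (of_real (h n) * ?D (x + of_real s * v))"
          by auto
        also have "\<dots> \<le> h n * M"
          using h[of n] M(1)[of "x + of_real s * v"] unfolding norm_mult by (intro mult_mono) auto
        finally show ?thesis using True h[of n] by (simp add: q_def norm_divide field_simps)
      next
        case False
        have "cmod x > R + cmod v" using False by auto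
        moreover have "cmod (of_real (h n) * v) \<le> cmod v"
          using h[of n] by (simp add: norm_mult mult_left_le_one_le)
        moreover have "cmod x \<le> cmod (x + of_real (h n) * v) + cmod (of_real (h n) * v)"
          using norm_triangle_ineq4[of "x + of_real (h n) * v" "of_real (h n) * v"] by simp
        ultimately have "cmod (x + of_real (h n) * v) > R" "cmod x > R"
          using norm_ge_zero[of v] by linarith+
        hence "F (x + of_real (h n) * v) = 0" "F x = 0"
          using d[of x] d[of "x + of_real (h n) * v"] by fastforce+
        thus ?thesis using False by (simp add: q_def)
      qed
    qed
  qed
  hence "(\<lambda>n. 0) \<longlonglongrightarrow> (\<integral>x. ?D x \<partial>lborel)" by (simp add: q0)
  thus "(\<integral>x. ?D x \<partial>lborel) = 0" by (rule LIMSEQ_unique[OF _ tendsto_const])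
qed

lemma C1_off_0_inverse_cnj: "C1_off_0 (\<lambda>x. c / cnj x) (\<lambda>x v. - c * cnj v / (cnj x)\<^sup>2)"
proof (rule C1oI)
  fix x :: complex assume "x \<noteq> 0"
  have "(cnj has_derivative cnj) (at x)"
    by (rule bounded_linear_imp_has_derivative[OF bounded_linear_cnj])
  from has_derivative_divide'[OF has_derivative_const[of c] this]
  show "((\<lambda>x. c / cnj x) has_derivative (\<lambda>v. - c * cnj v / (cnj x)\<^sup>2)) (at x)"
    using \<open>x \<noteq> 0\<close> by (simp add: power2_eq_square)
qed (auto intro!: continuous_intros)

lemma C1_off_0_of_real_linear:
  assumes "C1_off_0 F F'" "bounded_linear (L :: complex \<Rightarrow> real)"
  shows "C1_off_0 (\<lambda>x. of_real (L (F x))) (\<lambda>x v. of_real (L (F' x v)))"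
  using assms by (auto simp: C1_off_0_def intro!: has_derivative_of_real bounded_linear.has_derivative[OF assms(2)]
     continuous_on_of_real bounded_linear.continuous_on[OF assms(2)])

text \<open>The fields \<open>x / |x|\<^sup>2\<close> and \<open>\<i> x / |x|\<^sup>2\<close> are divergence free away from the origin.\<close>
lemma integral_radial_angular_zero:
  assumes "supp0 F" "C1_off_0 F F'"
  shows "integrable lborel (\<lambda>x. F' x (c * x) / of_real ((cmod x)\<^sup>2))"
    "(\<integral>x. F' x (c * x) / of_real ((cmod x)\<^sup>2) \<partial>lborel) = 0"
proof -
  \<comment> \<open>\<open>c / cnj x\<close> is the field \<open>c * x / |x|^2\<close>. The product
    of \<open>F\<close> with its two Cartesian components has compact support off the origin, so
    \<open>integral_pd_zero\<close> applies to each component.\<close>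
  let ?X = "\<lambda>x. c / cnj x" and ?X' = "\<lambda>x v. - c * cnj v / (cnj x)\<^sup>2"
  note X = C1_off_0_inverse_cnj[of c]
  note G1 = C1_off_0_mult[OF assms(2) C1_off_0_of_real_linear[OF X bounded_linear_Re]]
  note G2 = C1_off_0_mult[OF assms(2) C1_off_0_of_real_linear[OF X bounded_linear_Im]]
  have s1: "supp0 (\<lambda>x. F x * of_real (Re (?X x)))" and s2: "supp0 (\<lambda>x. F x * of_real (Im (?X x)))"
    by (rule supp0_subset[OF assms(1)]; simp)+
  let ?A = "\<lambda>x. (if x = 0 then 0 else F x * of_real (Re (?X' x 1)) + F' x 1 * of_real (Re (?X x)))"
  let ?B = "\<lambda>x. (if x = 0 then 0 else F x * of_real (Im (?X' x \<i>)) + F' x \<i> * of_real (Im (?X x)))"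
  have eq: "F' x (c * x) / of_real ((cmod x)\<^sup>2) = ?A x + ?B x" for x
  proof (cases "x = 0")
    case True
    thus ?thesis by simp
  next
    case False
    have "F' x (c * x) / of_real ((cmod x)\<^sup>2) = F' x (of_real (1 / (cmod x)\<^sup>2) * (c * x))"
      by (simp only: C1_off_0_deriv_scaleR[OF assms(2) False]) simp
    also have "of_real (1 / (cmod x)\<^sup>2) * (c * x) = c / cnj x"
      using False by (simp only: of_real_divide of_real_1 complex_norm_square) (simp add: field_simps)
    also have "F' x (c / cnj x) = of_real (Re (c / cnj x)) * F' x 1 + of_real (Im (c / cnj x)) * F' x \<i>"
      by (rule C1_off_0_deriv_expand[OF assms(2) False])
    also have "\<dots> = ?A x + ?B x"
    proof -
      \<comment> \<open>The divergence of a planar field is twice the real part of its derivative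
        with respect to \<open>x\<close> as a Wirtinger variable; it vanishes because the field
        depends on \<open>cnj x\<close> alone.\<close>
      have "Re (?X' x 1) + Im (?X' x \<i>) = 0"
      proof -
        have "?X' x \<i> = \<i> * (c / (cnj x)\<^sup>2)" "?X' x 1 = - (c / (cnj x)\<^sup>2)" by simp_all
        thus ?thesis by (simp only: times_complex.sel uminus_complex.sel imaginary_unit.sel mult_zero_left mult_1 add_0 add.left_inverse)
      qed
      hence "F x * of_real (Re (?X' x 1)) + F x * of_real (Im (?X' x \<i>)) = 0"
        by (metis distrib_left mult_zero_right of_real_0 of_real_add)
      thus ?thesis using False by (auto simp: algebra_simps)
    qed
    finally show ?thesis .
  qed
  note I1 = integral_pd_zero[OF s1 G1, of 1] and I2 = integral_pd_zero[OF s2 G2, of \<i>]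
  show "integrable lborel (\<lambda>x. F' x (c * x) / of_real ((cmod x)\<^sup>2))"
    unfolding eq by (rule Bochner_Integration.integrable_add[OF I1(1) I2(1)])
  show "(\<integral>x. F' x (c * x) / of_real ((cmod x)\<^sup>2) \<partial>lborel) = 0"
    unfolding eq by (subst Bochner_Integration.integral_add[OF I1(1) I2(1)]) (simp only: I1(2) I2(2) add_0)
qed

section \<open>The form and its operator\<close>

lemma test_fun_supp0:
  assumes "test_fun \<phi>"
  shows "supp0 \<phi>"
proof -
  let ?S = "closure {x. \<phi> x \<noteq> 0}"
  have "bounded ?S" using assms compact_imp_bounded by (auto simp: test_fun_def)
  then obtain R where R: "\<And>x. x \<in> ?S \<Longrightarrow> cmod x \<le> R" unfolding bounded_iff by metis
  have "open (- ?S)" "0 \<in> - ?S" using assms by (auto simp: test_fun_def)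
  then obtain d where d: "d > 0" "ball 0 d \<subseteq> - ?S" using open_contains_ball by blast
  show ?thesis
  proof (rule supp0I[OF d(1), of _ R])
    fix x assume "\<phi> x \<noteq> 0"
    hence x: "x \<in> ?S" by (intro subsetD[OF closure_subset]) simp
    hence "x \<notin> ball 0 d" using d by blast
    thus "d \<le> cmod x \<and> cmod x \<le> R" using R[OF x] by auto
  qed
qed

lemma test_fun_C1_off_0_foldr:
  assumes "test_fun \<phi>"
  shows "C1_off_0 (foldr pd ds \<phi>) (\<lambda>x v. pd v (foldr pd ds \<phi>) x)"
proof (rule C1oI)
  have d: "(foldr pd ds \<phi>) differentiable (at x)" for ds x
    using assms by (auto simp: test_fun_def smooth_fun_def)
  show "(foldr pd ds \<phi> has_derivative (\<lambda>v. pd v (foldr pd ds \<phi>) x)) (at x)" for x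
    using d[of ds x] unfolding pd_def by (rule frechet_derivative_works[THEN iffD1])
  show "continuous_on (- {0}) (\<lambda>x. pd v (foldr pd ds \<phi>) x)" for v
    using d[of "v # ds"] by (intro continuous_at_imp_continuous_on ballI differentiable_imp_continuous_within) simp
qed

lemma test_fun_C1_off_0: "test_fun \<phi> \<Longrightarrow> C1_off_0 \<phi> (\<lambda>x v. frechet_derivative \<phi> (at x) v)"
  using test_fun_C1_off_0_foldr[of \<phi> "[]"] by (simp add: pd_def)

lemma test_fun_has_derivative: "test_fun \<phi> \<Longrightarrow> (\<phi> has_derivative frechet_derivative \<phi> (at x)) (at x)"
  using frechet_derivative_works[of \<phi> "at x"] by (auto simp: test_fun_def smooth_fun_def dest: spec[of _ "[]"])

lemma test_fun_continuous: "test_fun \<phi> \<Longrightarrow> continuous_on (- {0}) \<phi>"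
  by (rule C1_off_0_continuous[OF test_fun_C1_off_0])

text \<open>The operator \<open>r d/dr\<close>. Without the division by \<open>|x|\<close> that
  occurs in \<open>dr\<close>, the form becomes an integral against the weight
  \<open>1 / |x|^2\<close>, which is invariant under dilations and rotations.\<close>

definition euler :: "(complex \<Rightarrow> complex) \<Rightarrow> complex \<Rightarrow> complex" where
  "euler \<phi> x = frechet_derivative \<phi> (at x) x"

definition ang_deriv :: "real \<Rightarrow> (complex \<Rightarrow> complex) \<Rightarrow> complex \<Rightarrow> complex" where
  "ang_deriv \<alpha> \<phi> x = - \<i> * dth \<phi> x + of_real \<alpha> * \<phi> x"

text \<open>The direction \<open>c * x\<close> moves with the point. It is expanded in the fixed
  directions \<open>1\<close> and \<open>\<i>\<close>, along which iterated derivatives of a test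
  function are again differentiable.\<close>

lemma test_fun_frechet_C1_off_0:
  assumes "test_fun \<phi>"
  obtains A' where "C1_off_0 (\<lambda>x. frechet_derivative \<phi> (at x) (c * x)) A'"
proof -
  have lin: "bounded_linear (\<lambda>x. complex_of_real (Re (c * x)))" "bounded_linear (\<lambda>x. complex_of_real (Im (c * x)))"
    by (intro bounded_linear_compose[OF bounded_linear_of_real] bounded_linear_compose[OF bounded_linear_Re]
        bounded_linear_compose[OF bounded_linear_Im] bounded_linear_mult_right)+
  have "C1_off_0 (pd v \<phi>) (\<lambda>x w. pd w (pd v \<phi>) x)" for v
    using test_fun_C1_off_0_foldr[OF assms, of "[v]"] by simp
  from C1_off_0_add[OF C1_off_0_mult[OF C1_off_0_linear_map[OF lin(1)] this[of 1]] C1_off_0_mult[OF C1_off_0_linear_map[OF lin(2)] this[of \<i>]]]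
  obtain A' where A': "C1_off_0 (\<lambda>x. of_real (Re (c * x)) * pd 1 \<phi> x + of_real (Im (c * x)) * pd \<i> \<phi> x) A'" by blast
  have "C1_off_0 (\<lambda>x. frechet_derivative \<phi> (at x) (c * x)) A'"
  proof (rule C1oI)
    fix x :: complex assume "x \<noteq> 0"
    show "((\<lambda>x. frechet_derivative \<phi> (at x) (c * x)) has_derivative A' x) (at x)"
    proof (rule has_derivative_transform_within_open[OF C1_off_0_has_derivative[OF A' \<open>x \<noteq> 0\<close>], of "- {0}"])
      fix y :: complex assume "y \<in> - {0}"
      thus "of_real (Re (c * y)) * pd 1 \<phi> y + of_real (Im (c * y)) * pd \<i> \<phi> y = frechet_derivative \<phi> (at y) (c * y)"
        using C1_off_0_deriv_expand[OF test_fun_C1_off_0[OF assms], of y "c * y"] by (simp add: pd_def)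
    qed (use \<open>x \<noteq> 0\<close> in auto)
  qed (rule C1_off_0_continuous_deriv[OF A'])
  thus ?thesis by (rule that)
qed

lemma supp0_test_frechet:
  assumes "test_fun \<phi>"
  shows "supp0 (\<lambda>x. frechet_derivative \<phi> (at x) (X x))"
proof -
  have "(\<lambda>x. frechet_derivative \<phi> (at x) (X x)) = (\<lambda>x. if x = 0 then 0 else frechet_derivative \<phi> (at x) (X x))"
    using frechet_derivative_at[OF supp0_has_derivative_0[OF test_fun_supp0[OF assms]], symmetric] by auto
  thus ?thesis using supp0_deriv_field[OF test_fun_supp0[OF assms] test_fun_C1_off_0[OF assms], of X] by metis
qed

lemma test_fun_euler_C1_off_0:
  assumes "test_fun \<phi>"
  obtains A' where "C1_off_0 (euler \<phi>) A'"
  using test_fun_frechet_C1_off_0[OF assms, of 1] unfolding euler_def[abs_def] by auto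

lemma test_fun_ang_deriv_C1_off_0:
  assumes "test_fun \<phi>"
  obtains B' where "C1_off_0 (ang_deriv \<alpha> \<phi>) B'"
proof -
  obtain D' where D': "C1_off_0 (dth \<phi>) D'"
    using test_fun_frechet_C1_off_0[OF assms, of \<i>] unfolding dth_def[abs_def] by auto
  show ?thesis
    by (rule that, unfold ang_deriv_def[abs_def])
      (rule C1_off_0_add[OF C1_off_0_cmult[OF D', of "- \<i>"] C1_off_0_cmult[OF test_fun_C1_off_0[OF assms], of "of_real \<alpha>"]])
qed

lemma supp0_euler: "test_fun \<phi> \<Longrightarrow> supp0 (euler \<phi>)"
  unfolding euler_def by (rule supp0_test_frechet)

lemma supp0_cmult: "supp0 f \<Longrightarrow> supp0 (\<lambda>x. c x * f x)"
  by (erule supp0_subset) simp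

lemma supp0_ang_deriv: "test_fun \<phi> \<Longrightarrow> supp0 (ang_deriv \<alpha> \<phi>)"
  unfolding ang_deriv_def dth_def
  by (intro supp0_add supp0_cmult supp0_test_frechet test_fun_supp0)

lemma supp0_L2:
  assumes "supp0 F" "continuous_on (- {0}) F"
  shows "F \<in> L2"
proof -
  have "supp0 (\<lambda>x. F x * cnj (F x))" by (rule supp0_subset[OF assms(1)]) simp
  moreover have "continuous_on (- {0}) (\<lambda>x. F x * cnj (F x))" using assms by (intro continuous_intros)
  ultimately have "integrable lborel (\<lambda>x. F x * cnj (F x))" by (rule supp0_integrable)
  hence "integrable lborel (\<lambda>x. complex_of_real ((cmod (F x))\<^sup>2))" by (simp only: complex_norm_square)
  hence "integrable lborel (\<lambda>x. (cmod (F x))\<^sup>2)" by (simp only: complex_of_real_integrable_eq)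
  thus ?thesis using supp0_integrable[OF assms] by (auto simp: L2_def)
qed

definition ang_grad :: "real \<Rightarrow> (complex \<Rightarrow> complex) \<Rightarrow> complex \<Rightarrow> complex" where
  "ang_grad \<alpha> \<phi> x = ang_deriv \<alpha> \<phi> x / of_real (cmod x)"

lemma dr_conv_euler: "test_fun \<phi> \<Longrightarrow> dr \<phi> x = euler \<phi> x / of_real (cmod x)"
  unfolding dr_def euler_def
  using linear_scale[OF has_derivative_linear[OF test_fun_has_derivative], of \<phi> x "inverse (cmod x)" x]
  by (simp add: scaleR_conv_of_real divide_inverse mult.commute)

lemma continuous_on_div_cmod:
  fixes F :: "complex \<Rightarrow> complex"
  shows "continuous_on (- {0}) F \<Longrightarrow> continuous_on (- {0}) (\<lambda>x. F x / of_real (cmod x))"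
  by (intro continuous_intros) auto

lemma test_fun_dr_L2:
  assumes "test_fun \<phi>"
  shows "dr \<phi> \<in> L2"
proof (rule test_fun_euler_C1_off_0[OF assms])
  fix A' assume A: "C1_off_0 (euler \<phi>) A'"
  have "(\<lambda>x. euler \<phi> x / of_real (cmod x)) \<in> L2"
    by (intro supp0_L2 continuous_on_div_cmod C1_off_0_continuous[OF A] supp0_subset[OF supp0_euler[OF assms]]) simp
  thus ?thesis by (simp add: dr_conv_euler[OF assms, abs_def])
qed

lemma test_fun_ang_grad_L2:
  assumes "test_fun \<phi>"
  shows "ang_grad \<alpha> \<phi> \<in> L2"
proof (rule test_fun_ang_deriv_C1_off_0[OF assms, of \<alpha>])
  fix A' assume A: "C1_off_0 (ang_deriv \<alpha> \<phi>) A'"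
  have "(\<lambda>x. ang_deriv \<alpha> \<phi> x / of_real (cmod x)) \<in> L2"
    by (intro supp0_L2 continuous_on_div_cmod C1_off_0_continuous[OF A] supp0_subset[OF supp0_ang_deriv[OF assms, of \<alpha>]]) simp
  thus ?thesis by (simp add: ang_grad_def[abs_def])
qed

lemma test_fun_L2: "test_fun \<phi> \<Longrightarrow> \<phi> \<in> L2"
  by (intro supp0_L2 test_fun_supp0 test_fun_continuous)

lemma AB_form0_inner:
  assumes "dr \<phi> \<in> L2" "ang_grad \<alpha> \<phi> \<in> L2" "dr \<psi> \<in> L2" "ang_grad \<alpha> \<psi> \<in> L2"
  shows "AB_form0 \<alpha> \<phi> \<psi> = L2_inner (dr \<phi>) (dr \<psi>) + L2_inner (ang_grad \<alpha> \<phi>) (ang_grad \<alpha> \<psi>)"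
proof -
  have "AB_form0 \<alpha> \<phi> \<psi> = (\<integral>x. dr \<phi> x * cnj (dr \<psi> x) + ang_grad \<alpha> \<phi> x * cnj (ang_grad \<alpha> \<psi> x) \<partial>lborel)"
    unfolding AB_form0_def ang_grad_def ang_deriv_def
    by (rule Bochner_Integration.integral_cong) (auto simp: power2_eq_square)
  also have "\<dots> = L2_inner (dr \<phi>) (dr \<psi>) + L2_inner (ang_grad \<alpha> \<phi>) (ang_grad \<alpha> \<psi>)"
    unfolding L2_inner_def by (intro Bochner_Integration.integral_add L2_mult_integrable assms)
  finally show ?thesis .
qed

lemma
  assumes "test_fun \<phi>" "test_fun \<psi>"
  shows dr_diff: "dr (\<lambda>x. \<phi> x - \<psi> x) = (\<lambda>x. dr \<phi> x - dr \<psi> x)"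
    and ang_grad_diff: "ang_grad \<alpha> (\<lambda>x. \<phi> x - \<psi> x) = (\<lambda>x. ang_grad \<alpha> \<phi> x - ang_grad \<alpha> \<psi> x)"
proof -
  have "((\<lambda>x. \<phi> x - \<psi> x) has_derivative (\<lambda>v. frechet_derivative \<phi> (at x) v - frechet_derivative \<psi> (at x) v)) (at x)" for x
    by (intro has_derivative_diff test_fun_has_derivative assms)
  note * = frechet_derivative_at[OF this, symmetric]
  show "dr (\<lambda>x. \<phi> x - \<psi> x) = (\<lambda>x. dr \<phi> x - dr \<psi> x)" by (simp add: dr_def * fun_eq_iff)
  show "ang_grad \<alpha> (\<lambda>x. \<phi> x - \<psi> x) = (\<lambda>x. ang_grad \<alpha> \<phi> x - ang_grad \<alpha> \<psi> x)"
    by (simp add: ang_grad_def ang_deriv_def dth_def * fun_eq_iff diff_divide_distrib[symmetric]) (simp add: algebra_simps)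
qed

lemma AB_form0_diff_self:
  assumes "test_fun \<phi>" "test_fun \<psi>"
  shows "AB_form0 \<alpha> (\<lambda>x. \<phi> x - \<psi> x) (\<lambda>x. \<phi> x - \<psi> x) =
    of_real ((L2_norm (\<lambda>x. dr \<phi> x - dr \<psi> x))\<^sup>2 + (L2_norm (\<lambda>x. ang_grad \<alpha> \<phi> x - ang_grad \<alpha> \<psi> x))\<^sup>2)"
  using assms
  by (subst AB_form0_inner) (simp_all add: dr_diff ang_grad_diff L2_inner_self L2_diff test_fun_dr_L2 test_fun_ang_grad_L2)

text \<open>For the weight \<open>1 / |x|^2\<close>, \<open>r d/dr\<close> is antisymmetric and
  \<open>- \<i> d/d\<theta> + \<alpha>\<close> is symmetric; the two sides differ by divergences
  covered by \<open>integral_radial_angular_zero\<close>. Only the products with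
  \<open>\<psi>\<close> need support off the origin, so the test function may stand in either slot:
  the lemma is used both ways.\<close>

lemma green:
  assumes \<psi>: "C1_off_0 \<psi> \<psi>'" and A: "C1_off_0 A A'" and B: "C1_off_0 B B'"
    and s: "supp0 (\<lambda>x. \<psi> x * cnj (A x))" "supp0 (\<lambda>x. \<psi> x * cnj (B x))"
    and i: "integrable lborel (\<lambda>x. \<psi> x * cnj ((- A' x x + (- \<i> * B' x (\<i> * x) + of_real \<alpha> * B x)) / of_real ((cmod x)\<^sup>2)))"
  shows "(\<integral>x. (\<psi>' x x * cnj (A x) + (- \<i> * \<psi>' x (\<i> * x) + of_real \<alpha> * \<psi> x) * cnj (B x)) / of_real ((cmod x)\<^sup>2) \<partial>lborel) =
     (\<integral>x. \<psi> x * cnj ((- A' x x + (- \<i> * B' x (\<i> * x) + of_real \<alpha> * B x)) / of_real ((cmod x)\<^sup>2)) \<partial>lborel)" (is "?L = ?R")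
proof -
  note 1 = integral_radial_angular_zero[OF s(1) C1_off_0_mult[OF \<psi> C1_off_0_cnj[OF A]], of 1, unfolded mult_1]
  note 2 = integral_radial_angular_zero[OF s(2) C1_off_0_mult[OF \<psi> C1_off_0_cnj[OF B]], of \<i>]
  have "?L = (\<integral>x. \<psi> x * cnj ((- A' x x + (- \<i> * B' x (\<i> * x) + of_real \<alpha> * B x)) / of_real ((cmod x)\<^sup>2))
       + ((\<psi> x * cnj (A' x x) + \<psi>' x x * cnj (A x)) / of_real ((cmod x)\<^sup>2)
       + (- \<i>) * ((\<psi> x * cnj (B' x (\<i> * x)) + \<psi>' x (\<i> * x) * cnj (B x)) / of_real ((cmod x)\<^sup>2))) \<partial>lborel)"
    by (rule Bochner_Integration.integral_cong) (auto simp: divide_inverse algebra_simps)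
  also have "\<dots> = ?R + ((\<integral>x. (\<psi> x * cnj (A' x x) + \<psi>' x x * cnj (A x)) / of_real ((cmod x)\<^sup>2) \<partial>lborel)
       + (\<integral>x. (- \<i>) * ((\<psi> x * cnj (B' x (\<i> * x)) + \<psi>' x (\<i> * x) * cnj (B x)) / of_real ((cmod x)\<^sup>2)) \<partial>lborel))"
    using i 1(1) integrable_mult_right[OF 2(1), of "- \<i>"]
    by (simp only: Bochner_Integration.integral_add Bochner_Integration.integrable_add)
  also have "\<dots> = ?R" unfolding 1(2) integral_mult_right_zero 2(2) by simp
  finally show ?thesis .
qed

lemma C1_off_0_deriv_field_continuous:
  assumes "C1_off_0 F F'"
  shows "continuous_on (- {0}) (\<lambda>x. F' x (c * x))"
proof -
  have "continuous_on (- {0}) (\<lambda>x. of_real (Re (c * x)) * F' x 1 + of_real (Im (c * x)) * F' x \<i>)"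
    by (intro continuous_intros C1_off_0_continuous_deriv[OF assms])
  thus ?thesis by (rule continuous_on_eq) (rule C1_off_0_deriv_expand[OF assms, symmetric], simp)
qed

text \<open>The function \<open>h\<close> plays the role of \<open>H\<^sub>\<alpha> \<phi>\<close>.\<close>
lemma test_fun_operator:
  assumes "test_fun \<phi>"
  shows "\<exists>h \<in> L2. \<forall>\<psi> \<psi>'. C1_off_0 \<psi> \<psi>' \<longrightarrow> (\<integral>x. (\<psi>' x x * cnj (euler \<phi> x) + (- \<i> * \<psi>' x (\<i> * x) + of_real \<alpha> * \<psi> x) * cnj (ang_deriv \<alpha> \<phi> x)) / of_real ((cmod x)\<^sup>2) \<partial>lborel)
        = L2_inner \<psi> h"
proof -
  obtain A' where A: "C1_off_0 (euler \<phi>) A'" by (rule test_fun_euler_C1_off_0[OF assms])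
  obtain B' where B: "C1_off_0 (ang_deriv \<alpha> \<phi>) B'" by (rule test_fun_ang_deriv_C1_off_0[OF assms])
  define h where "h x = (if x = 0 then 0 else (- A' x x + (- \<i> * B' x (\<i> * x) + of_real \<alpha> * ang_deriv \<alpha> \<phi> x)) / of_real ((cmod x)\<^sup>2))" for x
  \<comment> \<open>At the origin both sides are \<open>0\<close>, since division by zero yields
    zero.\<close>
  have h: "h x = (- A' x x + (- \<i> * B' x (\<i> * x) + of_real \<alpha> * ang_deriv \<alpha> \<phi> x)) / of_real ((cmod x)\<^sup>2)" for x
    by (simp add: h_def)
  have c: "continuous_on (- {0}) h"
    unfolding h
    by (intro continuous_intros C1_off_0_deriv_field_continuous[OF A, of 1, unfolded mult_1] C1_off_0_deriv_field_continuous[OF B] C1_off_0_continuous[OF B]) auto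
  have "supp0 (\<lambda>x. (-1) * (if x = 0 then 0 else A' x x) + ((- \<i>) * (if x = 0 then 0 else B' x (\<i> * x)) + of_real \<alpha> * ang_deriv \<alpha> \<phi> x))"
    by (intro supp0_add supp0_cmult supp0_ang_deriv assms
        supp0_deriv_field[OF supp0_euler[OF assms] A] supp0_deriv_field[OF supp0_ang_deriv[OF assms] B])
  hence s: "supp0 h"
    by (rule supp0_subset) (auto simp: h_def)
  show ?thesis
  proof (intro bexI[of _ h] allI impI)
    show "h \<in> L2" by (rule supp0_L2[OF s c])
    fix \<psi> \<psi>' assume \<psi>: "C1_off_0 \<psi> \<psi>'"
    have "integrable lborel (\<lambda>x. \<psi> x * cnj (h x))"
      using s by (intro supp0_integrable continuous_intros C1_off_0_continuous[OF \<psi>] c) (rule supp0_subset[OF s], simp)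
    thus "(\<integral>x. (\<psi>' x x * cnj (euler \<phi> x) + (- \<i> * \<psi>' x (\<i> * x) + of_real \<alpha> * \<psi> x) * cnj (ang_deriv \<alpha> \<phi> x)) / of_real ((cmod x)\<^sup>2) \<partial>lborel)
        = L2_inner \<psi> h"
      unfolding L2_inner_def h
      by (intro green[OF \<psi> A B]) (rule supp0_subset[OF supp0_euler[OF assms]] supp0_subset[OF supp0_ang_deriv[OF assms, of \<alpha>]], simp)+
  qed
qed

lemma AB_form0_test:
  assumes "test_fun \<phi>" "test_fun \<psi>"
  shows "AB_form0 \<alpha> \<psi> \<phi> = (\<integral>x. (euler \<psi> x * cnj (euler \<phi> x) + ang_deriv \<alpha> \<psi> x * cnj (ang_deriv \<alpha> \<phi> x)) / of_real ((cmod x)\<^sup>2) \<partial>lborel)"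
  unfolding AB_form0_def
  by (rule Bochner_Integration.integral_cong)
     (auto simp: dr_conv_euler assms ang_deriv_def power2_eq_square add_divide_distrib)

section \<open>Limits of the form along approximating sequences\<close>

definition dbl_Cauchy :: "(nat \<Rightarrow> nat \<Rightarrow> complex) \<Rightarrow> bool" where
  "dbl_Cauchy s \<longleftrightarrow> (\<forall>\<epsilon>>0. \<exists>N. \<forall>m\<ge>N. \<forall>n\<ge>N. \<forall>m'\<ge>N. \<forall>n'\<ge>N. cmod (s m n - s m' n') < \<epsilon>)"

lemma dbl_Cauchy_add:
  assumes "dbl_Cauchy s" "dbl_Cauchy u"
  shows "dbl_Cauchy (\<lambda>m n. s m n + u m n)"
  unfolding dbl_Cauchy_def
proof (intro allI impI)
  fix \<epsilon> :: real assume "\<epsilon> > 0"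
  hence "\<epsilon> / 2 > 0" by simp
  obtain N where N: "\<And>m n m' n'. m \<ge> N \<Longrightarrow> n \<ge> N \<Longrightarrow> m' \<ge> N \<Longrightarrow> n' \<ge> N \<Longrightarrow> cmod (s m n - s m' n') < \<epsilon> / 2"
    using assms(1) \<open>\<epsilon> / 2 > 0\<close> unfolding dbl_Cauchy_def by metis
  obtain K where K: "\<And>m n m' n'. m \<ge> K \<Longrightarrow> n \<ge> K \<Longrightarrow> m' \<ge> K \<Longrightarrow> n' \<ge> K \<Longrightarrow> cmod (u m n - u m' n') < \<epsilon> / 2"
    using assms(2) \<open>\<epsilon> / 2 > 0\<close> unfolding dbl_Cauchy_def by metis
  have "cmod (s m n + u m n - (s m' n' + u m' n')) < \<epsilon>"
    if "m \<ge> max N K" "n \<ge> max N K" "m' \<ge> max N K" "n' \<ge> max N K" for m n m' n'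
  proof -
    have "cmod (s m n + u m n - (s m' n' + u m' n')) \<le> cmod (s m n - s m' n') + cmod (u m n - u m' n')"
      by (metis add_diff_add norm_triangle_ineq)
    also have "\<dots> < \<epsilon> / 2 + \<epsilon> / 2" using that by (intro add_strict_mono N K) auto
    finally show ?thesis by simp
  qed
  thus "\<exists>N. \<forall>m\<ge>N. \<forall>n\<ge>N. \<forall>m'\<ge>N. \<forall>n'\<ge>N. cmod (s m n + u m n - (s m' n' + u m' n')) < \<epsilon>" by blast
qed

lemma dbl_Cauchy_convergent:
  assumes "dbl_Cauchy s"
  shows "convergent (\<lambda>n. s n n)"
proof (rule Cauchy_convergent, rule CauchyI)
  fix e :: real assume "e > 0"
  thus "\<exists>M. \<forall>m\<ge>M. \<forall>n\<ge>M. norm (s m m - s n n) < e"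
    using assms unfolding dbl_Cauchy_def by metis
qed

text \<open>\<open>AB_form\<close> is a diagonal limit, whereas the operator can be evaluated only
  with one index fixed. The joint Cauchy property keeps each limit \<open>l n\<close> uniformly
  close to the diagonal entry \<open>s n n\<close> for large \<open>n\<close>.\<close>

lemma dbl_Cauchy_iterated_limit:
  assumes "dbl_Cauchy s" "\<And>m. (\<lambda>n. s n m) \<longlonglongrightarrow> l m" "l \<longlonglongrightarrow> L"
  shows "(\<lambda>n. s n n) \<longlonglongrightarrow> L"
proof -
  have "(\<lambda>n. s n n - l n) \<longlonglongrightarrow> 0"
  proof (rule LIMSEQ_I)
    fix e :: real assume "e > 0"
    hence "e / 2 > 0" by simp
    obtain N where N: "\<And>m n m' n'. m \<ge> N \<Longrightarrow> n \<ge> N \<Longrightarrow> m' \<ge> N \<Longrightarrow> n' \<ge> N \<Longrightarrow> cmod (s m n - s m' n') < e / 2"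
      using assms(1) \<open>e / 2 > 0\<close> unfolding dbl_Cauchy_def by metis
    have "cmod (s n n - l n) \<le> e / 2" if "n \<ge> N" for n
    proof (rule tendsto_upperbound)
      show "(\<lambda>k. cmod (s n n - s k n)) \<longlonglongrightarrow> cmod (s n n - l n)" by (intro tendsto_intros assms(2))
      show "\<forall>\<^sub>F k in sequentially. cmod (s n n - s k n) \<le> e / 2"
        using eventually_ge_at_top[of N] by eventually_elim (use N that in \<open>auto intro: less_imp_le\<close>)
    qed auto
    moreover have "e / 2 < e" using \<open>e > 0\<close> by simp
    ultimately have "\<forall>n\<ge>N. norm (s n n - l n - 0) < e" unfolding diff_zero by (meson le_less_trans)
    thus "\<exists>no. \<forall>n\<ge>no. norm (s n n - l n - 0) < e" by blast
  qed
  from tendsto_add[OF this assms(3)] show ?thesis by simp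
qed

definition L2_Cauchy :: "(nat \<Rightarrow> complex \<Rightarrow> complex) \<Rightarrow> bool" where
  "L2_Cauchy a \<longleftrightarrow> (\<forall>n. a n \<in> L2) \<and> (\<forall>\<epsilon>>0. \<exists>N. \<forall>m\<ge>N. \<forall>n\<ge>N. L2_norm (\<lambda>x. a m x - a n x) < \<epsilon>)"

lemma L2_Cauchy_bounded:
  assumes "L2_Cauchy a"
  shows "\<exists>K N. K > 0 \<and> (\<forall>n\<ge>N. L2_norm (a n) \<le> K)"
proof -
  obtain N where N: "\<And>m n. m \<ge> N \<Longrightarrow> n \<ge> N \<Longrightarrow> L2_norm (\<lambda>x. a m x - a n x) < 1"
    using assms unfolding L2_Cauchy_def by (metis zero_less_one)
  show ?thesis
  proof (intro exI conjI allI impI)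
    show "L2_norm (a N) + 1 > 0" by (simp add: add_nonneg_pos)
    fix n assume "n \<ge> N"
    thus "L2_norm (a n) \<le> L2_norm (a N) + 1"
      using L2_norm_le_add_diff[of "a n" "a N"] N[of n N] assms by (force simp: L2_Cauchy_def)
  qed
qed

lemma L2_Cauchy_inner:
  assumes a: "L2_Cauchy a" and b: "L2_Cauchy b"
  shows "dbl_Cauchy (\<lambda>m n. L2_inner (a m) (b n))"
  unfolding dbl_Cauchy_def
proof (intro allI impI)
  fix \<epsilon> :: real assume "\<epsilon> > 0"
  have aL: "a n \<in> L2" and bL: "b n \<in> L2" for n using a b by (auto simp: L2_Cauchy_def)
  obtain K1 N1 where 1: "K1 > 0" "\<And>n. n \<ge> N1 \<Longrightarrow> L2_norm (a n) \<le> K1" using L2_Cauchy_bounded[OF a] by auto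
  obtain K2 N2 where 2: "K2 > 0" "\<And>n. n \<ge> N2 \<Longrightarrow> L2_norm (b n) \<le> K2" using L2_Cauchy_bounded[OF b] by auto
  have e1: "\<epsilon> / (2 * K2) > 0" and e2: "\<epsilon> / (2 * K1) > 0" using \<open>\<epsilon> > 0\<close> 1 2 by auto
  obtain N3 where 3: "\<And>m n. m \<ge> N3 \<Longrightarrow> n \<ge> N3 \<Longrightarrow> L2_norm (\<lambda>x. a m x - a n x) < \<epsilon> / (2 * K2)"
    using a e1 unfolding L2_Cauchy_def by metis
  obtain N4 where 4: "\<And>m n. m \<ge> N4 \<Longrightarrow> n \<ge> N4 \<Longrightarrow> L2_norm (\<lambda>x. b m x - b n x) < \<epsilon> / (2 * K1)"
    using b e2 unfolding L2_Cauchy_def by metis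
  let ?N = "max (max N1 N2) (max N3 N4)"
  have "cmod (L2_inner (a m) (b n) - L2_inner (a m') (b n')) < \<epsilon>"
    if "m \<ge> ?N" "n \<ge> ?N" "m' \<ge> ?N" "n' \<ge> ?N" for m n m' n'
  proof -
    have "L2_inner (a m) (b n) - L2_inner (a m') (b n') =
        L2_inner (\<lambda>x. a m x - a m' x) (b n) + L2_inner (a m') (\<lambda>x. b n x - b n' x)"
      by (simp add: L2_inner_diff_left L2_inner_diff_right aL bL)
    also have "cmod \<dots> \<le> L2_norm (\<lambda>x. a m x - a m' x) * L2_norm (b n) + L2_norm (a m') * L2_norm (\<lambda>x. b n x - b n' x)"
      by (intro order_trans[OF norm_triangle_ineq] add_mono L2_cauchy_schwarz L2_diff aL bL)
    also have "\<dots> \<le> L2_norm (\<lambda>x. a m x - a m' x) * K2 + K1 * L2_norm (\<lambda>x. b n x - b n' x)"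
      using that 1 2 by (intro add_mono mult_left_mono mult_right_mono) auto
    also have "\<dots> < \<epsilon> / (2 * K2) * K2 + K1 * (\<epsilon> / (2 * K1))"
      using that 1 2 by (intro add_strict_mono mult_strict_right_mono mult_strict_left_mono 3 4) auto
    also have "\<dots> = \<epsilon>" using 1 2 by simp
    finally show ?thesis .
  qed
  thus "\<exists>N. \<forall>m\<ge>N. \<forall>n\<ge>N. \<forall>m'\<ge>N. \<forall>n'\<ge>N. cmod (L2_inner (a m) (b n) - L2_inner (a m') (b n')) < \<epsilon>" by blast
qed

lemma approx_seq_test: "approx_seq \<alpha> u \<phi> \<Longrightarrow> test_fun (\<phi> n)"
  by (simp add: approx_seq_def)

text \<open>On a difference of test functions the form is a sum of two squared norms, so small
  energy controls the radial and the angular gradient separately.\<close>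

lemma approx_seq_Cauchy:
  assumes "approx_seq \<alpha> u \<phi>"
  shows "L2_Cauchy (\<lambda>n. dr (\<phi> n))" "L2_Cauchy (\<lambda>n. ang_grad \<alpha> (\<phi> n))"
proof -
  note t = approx_seq_test[OF assms]
  have "\<exists>N. \<forall>m\<ge>N. \<forall>n\<ge>N. L2_norm (\<lambda>x. dr (\<phi> m) x - dr (\<phi> n) x) < \<epsilon> \<and> L2_norm (\<lambda>x. ang_grad \<alpha> (\<phi> m) x - ang_grad \<alpha> (\<phi> n) x) < \<epsilon>"
    if "\<epsilon> > 0" for \<epsilon>
  proof -
    have "\<epsilon>\<^sup>2 > 0" using that by simp
    then obtain N where N: "\<And>m n. m \<ge> N \<Longrightarrow> n \<ge> N \<Longrightarrow> Re (AB_form0 \<alpha> (\<lambda>x. \<phi> m x - \<phi> n x) (\<lambda>x. \<phi> m x - \<phi> n x)) < \<epsilon>\<^sup>2"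
      using assms unfolding approx_seq_def by metis
    have "L2_norm (\<lambda>x. dr (\<phi> m) x - dr (\<phi> n) x) < \<epsilon> \<and> L2_norm (\<lambda>x. ang_grad \<alpha> (\<phi> m) x - ang_grad \<alpha> (\<phi> n) x) < \<epsilon>"
      if "m \<ge> N" "n \<ge> N" for m n
    proof -
      have *: "(L2_norm (\<lambda>x. dr (\<phi> m) x - dr (\<phi> n) x))\<^sup>2 + (L2_norm (\<lambda>x. ang_grad \<alpha> (\<phi> m) x - ang_grad \<alpha> (\<phi> n) x))\<^sup>2 < \<epsilon>\<^sup>2"
        using N[OF that] by (simp add: AB_form0_diff_self t)
      have "(L2_norm (\<lambda>x. dr (\<phi> m) x - dr (\<phi> n) x))\<^sup>2 < \<epsilon>\<^sup>2" "(L2_norm (\<lambda>x. ang_grad \<alpha> (\<phi> m) x - ang_grad \<alpha> (\<phi> n) x))\<^sup>2 < \<epsilon>\<^sup>2"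
        using * zero_le_power2[of "L2_norm (\<lambda>x. dr (\<phi> m) x - dr (\<phi> n) x)"]
          zero_le_power2[of "L2_norm (\<lambda>x. ang_grad \<alpha> (\<phi> m) x - ang_grad \<alpha> (\<phi> n) x)"] by linarith+
      thus ?thesis using \<open>\<epsilon> > 0\<close> by (auto intro: power2_less_imp_less)
    qed
    thus ?thesis by blast
  qed
  note * = this
  have "\<exists>N. \<forall>m\<ge>N. \<forall>n\<ge>N. L2_norm (\<lambda>x. dr (\<phi> m) x - dr (\<phi> n) x) < \<epsilon>" if "\<epsilon> > 0" for \<epsilon>
    using *[OF that] by (elim ex_forward) simp
  thus "L2_Cauchy (\<lambda>n. dr (\<phi> n))"
    unfolding L2_Cauchy_def using test_fun_dr_L2[OF t] by simp
  have "\<exists>N. \<forall>m\<ge>N. \<forall>n\<ge>N. L2_norm (\<lambda>x. ang_grad \<alpha> (\<phi> m) x - ang_grad \<alpha> (\<phi> n) x) < \<epsilon>" if "\<epsilon> > 0" for \<epsilon>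
    using *[OF that] by (elim ex_forward) simp
  thus "L2_Cauchy (\<lambda>n. ang_grad \<alpha> (\<phi> n))"
    unfolding L2_Cauchy_def using test_fun_ang_grad_L2[OF t] by simp
qed

lemma approx_seq_dbl_Cauchy:
  assumes "approx_seq \<alpha> u \<phi>" "approx_seq \<alpha> v \<psi>"
  shows "dbl_Cauchy (\<lambda>m n. AB_form0 \<alpha> (\<phi> m) (\<psi> n))"
proof -
  have "AB_form0 \<alpha> (\<phi> m) (\<psi> n) = L2_inner (dr (\<phi> m)) (dr (\<psi> n)) + L2_inner (ang_grad \<alpha> (\<phi> m)) (ang_grad \<alpha> (\<psi> n))" for m n
    by (intro AB_form0_inner test_fun_dr_L2 test_fun_ang_grad_L2 approx_seq_test[OF assms(1)] approx_seq_test[OF assms(2)])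
  thus ?thesis
    by (simp add: dbl_Cauchy_add L2_Cauchy_inner approx_seq_Cauchy[OF assms(1)] approx_seq_Cauchy[OF assms(2)])
qed

text \<open>Gives a name to the choice made inside \<open>AB_form\<close>; statements about form
  values are statements about these particular sequences.\<close>

definition apx :: "real \<Rightarrow> (complex \<Rightarrow> complex) \<Rightarrow> nat \<Rightarrow> complex \<Rightarrow> complex" where
  "apx \<alpha> u = (SOME \<phi>. approx_seq \<alpha> u \<phi>)"

lemma apx: "u \<in> form_dom \<alpha> \<Longrightarrow> approx_seq \<alpha> u (apx \<alpha> u)"
  unfolding apx_def form_dom_def by (auto intro: someI[where P = "approx_seq \<alpha> u"])

lemma AB_form_tendsto:
  assumes "u \<in> form_dom \<alpha>" "v \<in> form_dom \<alpha>"
  shows "(\<lambda>n. AB_form0 \<alpha> (apx \<alpha> u n) (apx \<alpha> v n)) \<longlonglongrightarrow> AB_form \<alpha> u v"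
  using dbl_Cauchy_convergent[OF approx_seq_dbl_Cauchy[OF apx[OF assms(1)] apx[OF assms(2)]]]
  unfolding AB_form_def apx_def[symmetric] by (simp add: convergent_LIMSEQ_iff)

text \<open>All four terms are limits along the same two approximating sequences, hence
  closability of the form is not needed here.\<close>
lemma AB_form_diff_nonneg:
  assumes "u \<in> form_dom \<alpha>" "v \<in> form_dom \<alpha>"
  shows "0 \<le> Re (AB_form \<alpha> u u - AB_form \<alpha> u v - AB_form \<alpha> v u + AB_form \<alpha> v v)"
proof (rule tendsto_lowerbound)
  let ?f = "apx \<alpha> u" and ?g = "apx \<alpha> v"
  show "(\<lambda>n. Re (AB_form0 \<alpha> (?f n) (?f n) - AB_form0 \<alpha> (?f n) (?g n) - AB_form0 \<alpha> (?g n) (?f n) + AB_form0 \<alpha> (?g n) (?g n)))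
    \<longlonglongrightarrow> Re (AB_form \<alpha> u u - AB_form \<alpha> u v - AB_form \<alpha> v u + AB_form \<alpha> v v)"
    by (intro tendsto_intros AB_form_tendsto assms)
  have "0 \<le> Re (AB_form0 \<alpha> (?f n) (?f n) - AB_form0 \<alpha> (?f n) (?g n) - AB_form0 \<alpha> (?g n) (?f n) + AB_form0 \<alpha> (?g n) (?g n))" for n
  proof -
    note t = approx_seq_test[OF apx[OF assms(1)], of n] approx_seq_test[OF apx[OF assms(2)], of n]
    note m = t[THEN test_fun_dr_L2] t[THEN test_fun_ang_grad_L2, of \<alpha>]
    have "0 \<le> Re (AB_form0 \<alpha> (\<lambda>x. ?f n x - ?g n x) (\<lambda>x. ?f n x - ?g n x))"
      by (simp add: AB_form0_diff_self t)
    also have "AB_form0 \<alpha> (\<lambda>x. ?f n x - ?g n x) (\<lambda>x. ?f n x - ?g n x) =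
       AB_form0 \<alpha> (?f n) (?f n) - AB_form0 \<alpha> (?f n) (?g n) - AB_form0 \<alpha> (?g n) (?f n) + AB_form0 \<alpha> (?g n) (?g n)"
      using m by (simp add: AB_form0_inner dr_diff ang_grad_diff t L2_diff L2_inner_diff_left L2_inner_diff_right)
    finally show ?thesis .
  qed
  thus "\<forall>\<^sub>F n in sequentially. 0 \<le> Re (AB_form0 \<alpha> (?f n) (?f n) - AB_form0 \<alpha> (?f n) (?g n) - AB_form0 \<alpha> (?g n) (?f n) + AB_form0 \<alpha> (?g n) (?g n))"
    by simp
qed simp

text \<open>The weak equation is assumed against test functions only. With an approximant of
  \<open>u\<close> fixed, \<open>test_fun_operator\<close> moves all derivatives onto it, so plain
  \<open>L2\<close> convergence of the approximants of \<open>v\<close> gives the first limit. The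
  second limit, over the approximants of \<open>u\<close>, is again \<open>L2\<close> convergence,
  and \<open>dbl_Cauchy_iterated_limit\<close> returns to the diagonal.\<close>

lemma AB_opI:
  assumes v: "v \<in> form_dom \<alpha>" and w: "w \<in> L2" and C1: "C1_off_0 v v'"
    and weak: "\<And>\<phi>. test_fun \<phi> \<Longrightarrow>
      (\<integral>x. (v' x x * cnj (euler \<phi> x) + (- \<i> * v' x (\<i> * x) + of_real \<alpha> * v x) * cnj (ang_deriv \<alpha> \<phi> x)) / of_real ((cmod x)\<^sup>2) \<partial>lborel)
        = L2_inner w \<phi>"
  shows "AB_op \<alpha> v w"
  unfolding AB_op_def
proof (intro conjI v w ballI)
  fix u assume u: "u \<in> form_dom \<alpha>"
  let ?f = "apx \<alpha> u" and ?g = "apx \<alpha> v"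
  have uL: "u \<in> L2" and vL: "v \<in> L2" using u v by (auto simp: form_dom_def)
  have tf: "test_fun (?f n)" and tg: "test_fun (?g n)" for n
    using approx_seq_test[OF apx[OF u]] approx_seq_test[OF apx[OF v]] by auto
  have "(\<lambda>n. AB_form0 \<alpha> (?g n) (?f n)) \<longlonglongrightarrow> L2_inner w u"
  proof (rule dbl_Cauchy_iterated_limit[where l = "\<lambda>m. L2_inner w (?f m)" and s = "\<lambda>m n. AB_form0 \<alpha> (?g m) (?f n)"])
    show "dbl_Cauchy (\<lambda>m n. AB_form0 \<alpha> (?g m) (?f n))" by (rule approx_seq_dbl_Cauchy[OF apx[OF v] apx[OF u]])
    show "(\<lambda>m. L2_inner w (?f m)) \<longlonglongrightarrow> L2_inner w u"
      using apx[OF u] by (intro L2_tendsto_inner_right w uL test_fun_L2 tf) (auto simp: approx_seq_def)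
    fix m
    obtain h where h: "h \<in> L2" "\<And>\<psi> \<psi>'. C1_off_0 \<psi> \<psi>' \<Longrightarrow> (\<integral>x. (\<psi>' x x * cnj (euler (?f m) x) + (- \<i> * \<psi>' x (\<i> * x) + of_real \<alpha> * \<psi> x) * cnj (ang_deriv \<alpha> (?f m) x)) / of_real ((cmod x)\<^sup>2) \<partial>lborel) = L2_inner \<psi> h"
      using test_fun_operator[OF tf[of m], of \<alpha>] by auto
    have "AB_form0 \<alpha> (?g n) (?f m) = L2_inner (?g n) h" for n
      unfolding AB_form0_test[OF tf tg] h(2)[OF test_fun_C1_off_0[OF tg], symmetric] by (simp add: euler_def ang_deriv_def dth_def)
    moreover have "(\<lambda>n. L2_inner (?g n) h) \<longlonglongrightarrow> L2_inner v h"
      using apx[OF v] by (intro L2_tendsto_inner_left h vL test_fun_L2 tg) (auto simp: approx_seq_def)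
    moreover have "L2_inner v h = L2_inner w (?f m)"
      using h(2)[OF C1] weak[OF tf] by simp
    ultimately show "(\<lambda>n. AB_form0 \<alpha> (?g n) (?f m)) \<longlonglongrightarrow> L2_inner w (?f m)" by simp
  qed
  thus "AB_form \<alpha> v u = L2_inner w u"
    using AB_form_tendsto[OF v u] LIMSEQ_unique by blast
qed

section \<open>Gaussian modes in the domain of the operator\<close>

definition nu :: "real \<Rightarrow> int \<Rightarrow> real" where
  "nu \<alpha> m = \<bar>of_int m + \<alpha>\<bar>"

lemma nu_nonneg [simp]: "0 \<le> nu \<alpha> m"
  by (simp add: nu_def)

definition gauss :: "real \<Rightarrow> real \<Rightarrow> int \<Rightarrow> complex \<Rightarrow> complex" where
  "gauss s b m x = of_real (cmod x powr s * exp (- b * (cmod x)\<^sup>2)) * ang m x"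

lemma gauss_measurable [measurable]: "gauss s b m \<in> borel_measurable borel"
  unfolding gauss_def by measurable

lemma norm_gauss_le: "cmod (gauss s b m x) \<le> cmod x powr s * exp (- b * (cmod x)\<^sup>2)"
  using norm_ang_le[of m x] by (simp add: gauss_def norm_mult mult_left_le)

lemma norm_gauss_sq_le: "(cmod (gauss s b m x))\<^sup>2 \<le> cmod x powr (2 * s) * exp (- (2 * b) * (cmod x)\<^sup>2)"
proof -
  have "(cmod (gauss s b m x))\<^sup>2 \<le> (cmod x powr s * exp (- b * (cmod x)\<^sup>2))\<^sup>2"
    by (intro power_mono norm_gauss_le) auto
  also have "\<dots> = cmod x powr (2 * s) * exp (- (2 * b) * (cmod x)\<^sup>2)"
    by (simp add: power_mult_distrib power2_eq_square[of "_ powr _"] exp_double[symmetric] mult_ac flip: powr_add mult_2)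
  finally show ?thesis .
qed

lemma gauss_L2: "b > 0 \<Longrightarrow> s > -1 \<Longrightarrow> gauss s b m \<in> L2"
  by (rule L2_bound[OF _ integrable_gaussian_moment[of "2 * b" "2 * s"] norm_gauss_sq_le]) auto

definition prof :: "real \<Rightarrow> int \<Rightarrow> real \<Rightarrow> real \<Rightarrow> real \<Rightarrow> real" where
  "prof \<alpha> m c b \<tau> = c * exp (nu \<alpha> m * \<tau> - b * exp (2 * \<tau>))"

definition gmode :: "real \<Rightarrow> int \<Rightarrow> real \<Rightarrow> real \<Rightarrow> complex \<Rightarrow> complex" where
  "gmode \<alpha> m c b = lpol (\<lambda>\<tau>. of_real (prof \<alpha> m c b \<tau>)) m"

lemma exp_2_ln: "x \<noteq> 0 \<Longrightarrow> exp (2 * ln (cmod x)) = (cmod x)\<^sup>2"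
  by (simp add: exp_double)

lemma prof_ln: "x \<noteq> 0 \<Longrightarrow> prof \<alpha> m c b (ln (cmod x)) = c * (cmod x powr nu \<alpha> m * exp (- b * (cmod x)\<^sup>2))"
  by (simp add: prof_def exp_2_ln exp_diff powr_def exp_minus divide_inverse)

lemma gmode_eq_gauss: "gmode \<alpha> m c b x = of_real c * gauss (nu \<alpha> m) b m x"
  by (cases "x = 0") (simp_all add: gmode_def lpol_def gauss_def ang_def prof_ln)

definition prof1 :: "real \<Rightarrow> int \<Rightarrow> real \<Rightarrow> real \<Rightarrow> real \<Rightarrow> real" where
  "prof1 \<alpha> m c b \<tau> = (nu \<alpha> m - 2 * b * exp (2 * \<tau>)) * prof \<alpha> m c b \<tau>"

definition prof2 :: "real \<Rightarrow> int \<Rightarrow> real \<Rightarrow> real \<Rightarrow> real \<Rightarrow> real" where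
  "prof2 \<alpha> m c b \<tau> = ((nu \<alpha> m - 2 * b * exp (2 * \<tau>))\<^sup>2 - 4 * b * exp (2 * \<tau>)) * prof \<alpha> m c b \<tau>"

lemma prof_deriv: "((\<lambda>\<tau>. complex_of_real (prof \<alpha> m c b \<tau>)) has_vector_derivative of_real (prof1 \<alpha> m c b \<tau>)) (at \<tau>)"
  unfolding prof_def prof1_def
  by (rule has_vector_derivative_of_real) (auto intro!: derivative_eq_intros simp: algebra_simps)

lemma prof1_deriv: "((\<lambda>\<tau>. complex_of_real (prof1 \<alpha> m c b \<tau>)) has_vector_derivative of_real (prof2 \<alpha> m c b \<tau>)) (at \<tau>)"
  unfolding prof_def prof1_def prof2_def
  by (rule has_vector_derivative_of_real) (auto intro!: derivative_eq_intros simp: algebra_simps power2_eq_square)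

lemma prof_cont: "continuous_on UNIV (\<lambda>\<tau>. complex_of_real (prof1 \<alpha> m c b \<tau>))"
    "continuous_on UNIV (\<lambda>\<tau>. complex_of_real (prof2 \<alpha> m c b \<tau>))"
  unfolding prof_def prof1_def prof2_def by (intro continuous_intros)+

text \<open>The function \<open>H v\<close> for the mode \<open>v = gmode \<alpha> m c b\<close>. It
  comes from \<open>nu^2 - ((nu - 2 * b * r^2)^2 - 4 * b * r^2) = (4 * b * (1 + nu) - 4 * b^2 * r^2)
  * r^2\<close>, divided by \<open>r^2\<close>.\<close>

definition gmode_op :: "real \<Rightarrow> int \<Rightarrow> real \<Rightarrow> real \<Rightarrow> complex \<Rightarrow> complex" where
  "gmode_op \<alpha> m c b x = of_real (4 * b * (1 + nu \<alpha> m) - 4 * b\<^sup>2 * (cmod x)\<^sup>2) * gmode \<alpha> m c b x"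

lemma gauss_shift: "of_real ((cmod x)\<^sup>2) * gauss s b m x = gauss (s + 2) b m x"
  by (cases "x = 0") (simp_all add: gauss_def ang_def powr_add powr_numeral mult_ac)

lemma gauss_shift1: "gauss s b m x / of_real (cmod x) = gauss (s - 1) b m x"
  by (cases "x = 0") (simp_all add: gauss_def ang_def powr_diff)

lemma gmode_op_eq: "gmode_op \<alpha> m c b x = of_real (4 * b * (1 + nu \<alpha> m) * c) * gauss (nu \<alpha> m) b m x - of_real (4 * b\<^sup>2 * c) * gauss (nu \<alpha> m + 2) b m x"
  unfolding gmode_op_def gmode_eq_gauss gauss_shift[symmetric] by (simp add: algebra_simps)

lemma gmode_L2: "b > 0 \<Longrightarrow> gmode \<alpha> m c b \<in> L2"
  unfolding gmode_eq_gauss[abs_def] by (intro L2_cmult gauss_L2) (auto intro: less_le_trans[OF _ nu_nonneg])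

lemma gmode_op_L2: "b > 0 \<Longrightarrow> gmode_op \<alpha> m c b \<in> L2"
  unfolding gmode_op_eq[abs_def]
  by (intro L2_cmult L2_diff gauss_L2) (auto intro: less_le_trans[OF _ nu_nonneg] add_pos_nonneg simp: add_nonneg_pos less_add_same_cancel2 intro!: less_le_trans[of "-1" 0 "nu \<alpha> m + 2"])

lemma gmode_C1_off_0: "C1_off_0 (gmode \<alpha> m c b) (\<lambda>x v. (of_real (Re (v / x)) * of_real (prof1 \<alpha> m c b (ln (cmod x))) + \<i> * of_real (of_int m * Im (v / x)) * of_real (prof \<alpha> m c b (ln (cmod x)))) * ang m x)"
  unfolding gmode_def by (rule C1_off_0_lpol[OF prof_deriv prof_cont(1)])

text \<open>Here \<open>green\<close> is used with the test function as \<open>\<psi>\<close>,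
  because the mode itself is not supported off the origin. The mode then sits in the conjugated
  slot, and the identity is conjugated at the end.\<close>

lemma gmode_weak:
  fixes \<alpha> b c :: real and m :: int
  assumes \<phi>: "test_fun \<phi>"
  defines "v' \<equiv> \<lambda>x v. (of_real (Re (v / x)) * of_real (prof1 \<alpha> m c b (ln (cmod x))) + \<i> * of_real (of_int m * Im (v / x)) * of_real (prof \<alpha> m c b (ln (cmod x)))) * ang m x"
  shows "(\<integral>x. (v' x x * cnj (euler \<phi> x) + (- \<i> * v' x (\<i> * x) + of_real \<alpha> * gmode \<alpha> m c b x) * cnj (ang_deriv \<alpha> \<phi> x)) / of_real ((cmod x)\<^sup>2) \<partial>lborel)
        = L2_inner (gmode_op \<alpha> m c b) \<phi>"
proof -
  let ?k = "complex_of_real (of_int m + \<alpha>)"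
  let ?v = "gmode \<alpha> m c b"
  define A where "A = lpol (\<lambda>\<tau>. of_real (prof1 \<alpha> m c b \<tau>)) m"
  define A' where "A' = (\<lambda>x v. (of_real (Re (v / x)) * of_real (prof2 \<alpha> m c b (ln (cmod x))) + \<i> * of_real (of_int m * Im (v / x)) * of_real (prof1 \<alpha> m c b (ln (cmod x)))) * ang m x)"
  have vC: "C1_off_0 ?v v'" unfolding v'_def by (rule gmode_C1_off_0)
  have AC: "C1_off_0 A A'" unfolding A_def A'_def by (rule C1_off_0_lpol[OF prof1_deriv prof_cont(2)])
  \<comment> \<open>On angular index \<open>m\<close> the operator
    \<open>- \<i> d/d\<theta> + \<alpha>\<close> is multiplication by \<open>m + \<alpha>\<close>,
    whose square is \<open>nu^2\<close>.\<close>
  have BC: "C1_off_0 (\<lambda>x. ?k * ?v x) (\<lambda>x w. ?k * v' x w)" by (rule C1_off_0_cmult[OF vC])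
  have vx: "v' x x = A x" "v' x (\<i> * x) = \<i> * of_int m * ?v x" for x
    by (cases "x = 0", simp_all add: v'_def A_def lpol_def gmode_def ang_def)+
  have Ax: "A' x x = lpol (\<lambda>\<tau>. of_real (prof2 \<alpha> m c b \<tau>)) m x" for x
    by (cases "x = 0", simp_all add: A'_def lpol_def ang_def)
  have H: "(- A' x x + (- \<i> * (?k * v' x (\<i> * x)) + of_real \<alpha> * (?k * ?v x))) / of_real ((cmod x)\<^sup>2) = gmode_op \<alpha> m c b x" for x
  proof (cases "x = 0")
    case True
    thus ?thesis by (simp add: gmode_op_def gmode_def lpol_def ang_def)
  next
    case False
    have "- A' x x + (- \<i> * (?k * v' x (\<i> * x)) + of_real \<alpha> * (?k * ?v x)) = (?k\<^sup>2 * ?v x - A' x x)"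
      unfolding vx by (simp add: algebra_simps power2_eq_square)
    also have "?k\<^sup>2 = of_real ((nu \<alpha> m)\<^sup>2)" by (simp add: nu_def)
    also have "of_real ((nu \<alpha> m)\<^sup>2) * ?v x - A' x x =
      of_real (((nu \<alpha> m)\<^sup>2 - ((nu \<alpha> m - 2 * b * (cmod x)\<^sup>2)\<^sup>2 - 4 * b * (cmod x)\<^sup>2))) * ?v x"
      unfolding Ax using False by (simp add: lpol_def gmode_def prof2_def exp_2_ln algebra_simps)
    also have "(nu \<alpha> m)\<^sup>2 - ((nu \<alpha> m - 2 * b * (cmod x)\<^sup>2)\<^sup>2 - 4 * b * (cmod x)\<^sup>2) =
        (4 * b * (1 + nu \<alpha> m) - 4 * b\<^sup>2 * (cmod x)\<^sup>2) * (cmod x)\<^sup>2"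
      by (simp add: power2_eq_square algebra_simps)
    finally show ?thesis using False by (simp add: gmode_op_def)
  qed
  have Hc: "continuous_on (- {0}) (gmode_op \<alpha> m c b)"
    unfolding gmode_op_def by (intro continuous_intros C1_off_0_continuous[OF vC])
  have "integrable lborel (\<lambda>x. \<phi> x * cnj (gmode_op \<alpha> m c b x))"
    by (intro supp0_integrable continuous_intros test_fun_continuous \<phi> Hc)
      (rule supp0_subset[OF test_fun_supp0[OF \<phi>]], simp)
  hence "(\<integral>x. (frechet_derivative \<phi> (at x) x * cnj (A x) + (- \<i> * frechet_derivative \<phi> (at x) (\<i> * x) + of_real \<alpha> * \<phi> x) * cnj (?k * ?v x)) / of_real ((cmod x)\<^sup>2) \<partial>lborel)
     = (\<integral>x. \<phi> x * cnj ((- A' x x + (- \<i> * (?k * v' x (\<i> * x)) + of_real \<alpha> * (?k * ?v x))) / of_real ((cmod x)\<^sup>2)) \<partial>lborel)"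
    by (intro green[OF test_fun_C1_off_0[OF \<phi>] AC BC]; (unfold H)?)
      (rule supp0_subset[OF test_fun_supp0[OF \<phi>]], simp, rule supp0_subset[OF test_fun_supp0[OF \<phi>]], simp)
  hence eq: "(\<integral>x. (euler \<phi> x * cnj (A x) + ang_deriv \<alpha> \<phi> x * cnj (?k * ?v x)) / of_real ((cmod x)\<^sup>2) \<partial>lborel) = L2_inner \<phi> (gmode_op \<alpha> m c b)"
    unfolding H by (simp add: L2_inner_def euler_def ang_deriv_def dth_def)
  have "(\<integral>x. (v' x x * cnj (euler \<phi> x) + (- \<i> * v' x (\<i> * x) + of_real \<alpha> * gmode \<alpha> m c b x) * cnj (ang_deriv \<alpha> \<phi> x)) / of_real ((cmod x)\<^sup>2) \<partial>lborel)
     = (\<integral>x. cnj ((euler \<phi> x * cnj (A x) + ang_deriv \<alpha> \<phi> x * cnj (?k * ?v x)) / of_real ((cmod x)\<^sup>2)) \<partial>lborel)"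
    unfolding vx by (rule Bochner_Integration.integral_cong) (simp_all add: algebra_simps)
  also have "\<dots> = cnj (L2_inner \<phi> (gmode_op \<alpha> m c b))"
    unfolding eq[symmetric] by (rule Bochner_Integration.integral_cnj)
  finally show ?thesis by (simp add: L2_inner_cnj[symmetric])
qed

text \<open>For \<open>nu > 0\<close> the exponent \<open>nu * \<tau> - b * exp (2 * \<tau>)\<close>
  is concave with its maximum at \<open>2 * \<tau> = ln (nu / (2 * b))\<close>. The bound follows
  from \<open>exp u >= 1 + u\<close> at the distance from this point.\<close>

lemma prof_bounded:
  assumes "b > 0"
  shows "\<exists>C. \<forall>\<tau>. \<bar>prof \<alpha> m c b \<tau>\<bar> \<le> C"
proof (cases "nu \<alpha> m = 0")
  case True
  have "\<bar>prof \<alpha> m c b \<tau>\<bar> \<le> \<bar>c\<bar> * 1" for \<tau>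
    unfolding prof_def abs_mult using True assms by (intro mult_left_mono) auto
  thus ?thesis by blast
next
  case False
  hence nu: "nu \<alpha> m > 0" using nu_nonneg[of \<alpha> m] by linarith
  let ?k = "ln (nu \<alpha> m / (2 * b))"
  have "nu \<alpha> m * \<tau> - b * exp (2 * \<tau>) \<le> nu \<alpha> m / 2 * (?k - 1)" for \<tau>
  proof -
    have "b * exp (2 * \<tau>) = nu \<alpha> m / 2 * exp (2 * \<tau> - ?k)"
      using nu assms by (simp add: exp_diff)
    also have "\<dots> \<ge> nu \<alpha> m / 2 * (1 + (2 * \<tau> - ?k))"
      using nu exp_ge_add_one_self by (intro mult_left_mono) auto
    finally show ?thesis by (simp add: algebra_simps)
  qed
  hence "\<bar>prof \<alpha> m c b \<tau>\<bar> \<le> \<bar>c\<bar> * exp (nu \<alpha> m / 2 * (?k - 1))" for \<tau>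
    unfolding prof_def abs_mult by (intro mult_left_mono) auto
  thus ?thesis by blast
qed

text \<open>The cutoff acts on \<open>ln |x|\<close>: if \<open>nu \<alpha> m = 0\<close>, cutting off at a scale \<open>\<epsilon>\<close> would cost an energy
  that does not tend to \<open>0\<close>.\<close>
definition cutoff :: "real \<Rightarrow> int \<Rightarrow> real \<Rightarrow> real \<Rightarrow> nat \<Rightarrow> complex \<Rightarrow> complex" where
  "cutoff \<alpha> m c b n = lpol (\<lambda>\<tau>. of_real (bump (1 / real (Suc n)) \<tau>) * of_real (prof \<alpha> m c b \<tau>)) m"

lemma cutoff_test_fun: "test_fun (cutoff \<alpha> m c b n)"
  unfolding cutoff_def
proof (intro lpol_sums_test_fun lpol_sums.lpol)
  have "Ck k (\<lambda>\<tau>. of_real (prof \<alpha> m c b \<tau>))" for k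
    unfolding prof_def of_real_mult by (intro Ck_mult Ck_const Ck_exp_exp)
  thus "cs_smooth (\<lambda>\<tau>. of_real (bump (1 / real (Suc n)) \<tau>) * of_real (prof \<alpha> m c b \<tau>))"
    by (rule cs_smooth_mult(1)[OF cs_smooth_bump])
qed

lemma cutoff_eq: "cutoff \<alpha> m c b n x = of_real (bump (1 / real (Suc n)) (ln (cmod x))) * gmode \<alpha> m c b x"
  by (simp add: cutoff_def gmode_def lpol_def)

definition gmode_dr :: "real \<Rightarrow> int \<Rightarrow> real \<Rightarrow> real \<Rightarrow> complex \<Rightarrow> complex" where
  "gmode_dr \<alpha> m c b x = of_real (nu \<alpha> m * c) * gauss (nu \<alpha> m - 1) b m x - of_real (2 * b * c) * gauss (nu \<alpha> m + 1) b m x"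

definition gmode_ang_grad :: "real \<Rightarrow> int \<Rightarrow> real \<Rightarrow> real \<Rightarrow> complex \<Rightarrow> complex" where
  "gmode_ang_grad \<alpha> m c b x = of_real ((of_int m + \<alpha>) * c) * gauss (nu \<alpha> m - 1) b m x"

text \<open>The power \<open>r powr (nu - 1)\<close> is square integrable at the origin only for
  \<open>nu > 0\<close>. For \<open>nu = 0\<close> its coefficient vanishes and only the term with
  \<open>r powr (nu + 1)\<close> remains.\<close>

lemma gmode_dr_L2:
  assumes "b > 0"
  shows "gmode_dr \<alpha> m c b \<in> L2"
proof (cases "nu \<alpha> m = 0")
  case True
  thus ?thesis unfolding gmode_dr_def[abs_def] using L2_cmult[OF gauss_L2[OF assms, of 1], of "- of_real (2 * b * c)"] by simp
next
  case False
  hence "nu \<alpha> m > 0" using nu_nonneg[of \<alpha> m] by linarith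
  thus ?thesis unfolding gmode_dr_def[abs_def] by (intro L2_diff L2_cmult gauss_L2 assms) auto
qed

lemma gmode_ang_grad_L2:
  assumes "b > 0"
  shows "gmode_ang_grad \<alpha> m c b \<in> L2"
proof (cases "nu \<alpha> m = 0")
  case True
  hence "of_int m + \<alpha> = 0" by (simp add: nu_def)
  thus ?thesis using L2_cmult[OF gauss_L2[OF assms, of 1], of 0] by (simp add: gmode_ang_grad_def[abs_def] del: of_real_mult of_real_add)
next
  case False
  hence "nu \<alpha> m > 0" using nu_nonneg[of \<alpha> m] by linarith
  thus ?thesis unfolding gmode_ang_grad_def[abs_def] by (intro L2_cmult gauss_L2 assms) auto
qed

lemma
  fixes n :: nat
  defines "B \<equiv> \<lambda>x. complex_of_real (bump (1 / real (Suc n)) (ln (cmod x)))"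
  shows dr_cutoff: "dr (cutoff \<alpha> m c b n) x = B x * gmode_dr \<alpha> m c b x + of_real (bump' (1 / real (Suc n)) (ln (cmod x))) * (gmode \<alpha> m c b x / of_real (cmod x))"
    and ang_grad_cutoff: "ang_grad \<alpha> (cutoff \<alpha> m c b n) x = B x * gmode_ang_grad \<alpha> m c b x"
proof -
  let ?e = "1 / real (Suc n)"
  let ?g = "\<lambda>\<tau>. complex_of_real (bump ?e \<tau>) * of_real (prof \<alpha> m c b \<tau>)"
  let ?g' = "\<lambda>\<tau>. complex_of_real (bump ?e \<tau>) * of_real (prof1 \<alpha> m c b \<tau>) + of_real (bump' ?e \<tau>) * of_real (prof \<alpha> m c b \<tau>)"
  have g': "(?g has_vector_derivative ?g' \<tau>) (at \<tau>)" for \<tau>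
    by (intro has_vector_derivative_mult prof_deriv has_vector_derivative_of_real bump_has_derivative)
  show "dr (cutoff \<alpha> m c b n) x = B x * gmode_dr \<alpha> m c b x + of_real (bump' ?e (ln (cmod x))) * (gmode \<alpha> m c b x / of_real (cmod x))"
  proof (cases "x = 0")
    case True
    thus ?thesis
      using linear_0[OF has_derivative_linear[OF test_fun_has_derivative[OF cutoff_test_fun[of \<alpha> m c b n], of 0]]]
      by (simp add: dr_def gmode_dr_def gauss_def gmode_def lpol_def ang_def)
  next
    case False
    have fr: "frechet_derivative (cutoff \<alpha> m c b n) (at x) = (\<lambda>v. (of_real (Re (v / x)) * ?g' (ln (cmod x)) + \<i> * of_real (of_int m * Im (v / x)) * ?g (ln (cmod x))) * ang m x)"
      unfolding cutoff_def by (rule frechet_derivative_at[OF has_derivative_lpol[OF False g'], symmetric])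
    have "dr (cutoff \<alpha> m c b n) x = ?g' (ln (cmod x)) * ang m x / of_real (cmod x)"
      unfolding dr_conv_euler[OF cutoff_test_fun] euler_def fr using False by simp
    also have "\<dots> = B x * (of_real (prof1 \<alpha> m c b (ln (cmod x))) * ang m x / of_real (cmod x)) +
        of_real (bump' ?e (ln (cmod x))) * (gmode \<alpha> m c b x / of_real (cmod x))"
      by (simp add: B_def gmode_def lpol_def algebra_simps add_divide_distrib)
    also have "of_real (prof1 \<alpha> m c b (ln (cmod x))) * ang m x / of_real (cmod x) = gmode_dr \<alpha> m c b x"
    proof -
      have "of_real (prof1 \<alpha> m c b (ln (cmod x))) * ang m x = of_real (nu \<alpha> m - 2 * b * (cmod x)\<^sup>2) * (of_real c * gauss (nu \<alpha> m) b m x)"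
        using False by (simp add: prof1_def prof_ln exp_2_ln gauss_def)
      also have "\<dots> = of_real (nu \<alpha> m * c) * gauss (nu \<alpha> m) b m x - of_real (2 * b * c) * (of_real ((cmod x)\<^sup>2) * gauss (nu \<alpha> m) b m x)"
        by (simp add: algebra_simps)
      finally show ?thesis
        unfolding gauss_shift gmode_dr_def
        using gauss_shift1[of "nu \<alpha> m" b m x] gauss_shift1[of "nu \<alpha> m + 2" b m x]
        by (simp add: diff_divide_distrib del: of_real_mult) (simp add: add.commute flip: times_divide_eq_right)
    qed
    finally show ?thesis .
  qed
  show "ang_grad \<alpha> (cutoff \<alpha> m c b n) x = B x * gmode_ang_grad \<alpha> m c b x"
  proof (cases "x = 0")
    case True
    thus ?thesis by (simp add: ang_grad_def gmode_ang_grad_def gauss_def ang_def)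
  next
    case False
    have fr: "frechet_derivative (cutoff \<alpha> m c b n) (at x) = (\<lambda>v. (of_real (Re (v / x)) * ?g' (ln (cmod x)) + \<i> * of_real (of_int m * Im (v / x)) * ?g (ln (cmod x))) * ang m x)"
      unfolding cutoff_def by (rule frechet_derivative_at[OF has_derivative_lpol[OF False g'], symmetric])
    have "dth (cutoff \<alpha> m c b n) x = \<i> * of_int m * cutoff \<alpha> m c b n x"
      unfolding dth_def fr using False by (simp add: cutoff_def lpol_def)
    hence "ang_deriv \<alpha> (cutoff \<alpha> m c b n) x = of_real (of_int m + \<alpha>) * (B x * (of_real c * gauss (nu \<alpha> m) b m x))"
      unfolding ang_deriv_def cutoff_eq gmode_eq_gauss B_def by (simp add: algebra_simps)
    thus ?thesis unfolding ang_grad_def gmode_ang_grad_def by (simp add: gauss_shift1[symmetric])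
  qed
qed

lemma L2_norm_bump_tendsto:
  assumes "f \<in> L2"
  shows "(\<lambda>n. L2_norm (\<lambda>x. of_real (bump (1 / real (Suc n)) (ln (cmod x))) * f x - f x)) \<longlonglongrightarrow> 0"
proof (rule L2_dominated_convergence)
  have [measurable]: "f \<in> borel_measurable lborel" by (rule L2_measurable[OF assms])
  show "(\<lambda>x. of_real (bump (1 / real (Suc n)) (ln (cmod x))) * f x - f x) \<in> borel_measurable lborel" for n
    by measurable
  show "integrable lborel (\<lambda>x. (cmod (f x))\<^sup>2)" by (rule L2_integrable_sq[OF assms])
  show "(\<lambda>n. of_real (bump (1 / real (Suc n)) (ln (cmod x))) * f x - f x) \<longlonglongrightarrow> 0" for x
  proof -
    have "(\<lambda>n. of_real (bump (1 / real (Suc n)) (ln (cmod x))) * f x - f x) \<longlonglongrightarrow> of_real 1 * f x - f x"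
      by (intro tendsto_intros bump_tendsto_1)
    thus ?thesis by simp
  qed
  show "(cmod (of_real (bump (1 / real (Suc n)) (ln (cmod x))) * f x - f x))\<^sup>2 \<le> (cmod (f x))\<^sup>2" for n x
  proof (rule power_mono)
    let ?B = "bump (1 / real (Suc n)) (ln (cmod x))"
    have "of_real ?B * f x - f x = of_real (?B - 1) * f x" by (simp add: algebra_simps)
    hence "cmod (of_real ?B * f x - f x) = \<bar>?B - 1\<bar> * cmod (f x)" by (metis norm_mult norm_of_real)
    also have "\<dots> \<le> 1 * cmod (f x)"
      using bump_nonneg[of "1 / real (Suc n)" "ln (cmod x)"] bump_le_1[of "1 / real (Suc n)" "ln (cmod x)"]
      by (intro mult_right_mono) auto
    finally show "cmod (of_real ?B * f x - f x) \<le> cmod (f x)" by simp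
  qed simp
qed

text \<open>Only boundedness of the profile enters. With \<open>N = Suc n\<close> the square of the
  integrand is at most a constant over \<open>N^2\<close> times \<open>1 / |x|^2\<close> on the
  annulus \<open>exp (- N) <= |x| <= exp N\<close>, where the latter has integral
  \<open>4 * pi * N\<close>. The square of the norm is thus of order \<open>1 / N\<close>.\<close>

lemma L2_norm_bump'_tendsto:
  assumes "b > 0"
  shows "(\<lambda>x. of_real (bump' (1 / real (Suc n)) (ln (cmod x))) * (gmode \<alpha> m c b x / of_real (cmod x))) \<in> L2"
    "(\<lambda>n. L2_norm (\<lambda>x. of_real (bump' (1 / real (Suc n)) (ln (cmod x))) * (gmode \<alpha> m c b x / of_real (cmod x)))) \<longlonglongrightarrow> 0"
proof -
  define F where "F n = (\<lambda>x. of_real (bump' (1 / real (Suc n)) (ln (cmod x))) * (gmode \<alpha> m c b x / of_real (cmod x)))" for n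
  define K where "K n = (\<lambda>x::complex. indicator {exp (-2*real (Suc n))..exp (2*real (Suc n))} ((cmod x)\<^sup>2) / (cmod x)\<^sup>2 :: real)" for n
  obtain C where C: "\<And>\<tau>. \<bar>prof \<alpha> m c b \<tau>\<bar> \<le> C" using prof_bounded[OF assms] by blast
  let ?D = "(4 * exp 1 * C)\<^sup>2"
  have bnd: "(cmod (F n x))\<^sup>2 \<le> (?D / (real (Suc n))\<^sup>2) * K n x" for n x
  proof (cases "x = 0 \<or> bump' (1 / real (Suc n)) (ln (cmod x)) = 0")
    case True
    thus ?thesis by (auto simp: F_def K_def)
  next
    case False
    hence x: "x \<noteq> 0" and "\<bar>1 / real (Suc n) * ln (cmod x)\<bar> < 1" using bump'_eq_0 not_le by blast+
    hence "\<bar>ln (cmod x)\<bar> < real (Suc n)" by (simp add: abs_mult field_simps)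
    hence "exp (-2*real (Suc n)) \<le> exp (2 * ln (cmod x))" "exp (2 * ln (cmod x)) \<le> exp (2*real (Suc n))" by simp_all
    hence K: "K n x = 1 / (cmod x)\<^sup>2" using x by (simp add: K_def exp_2_ln)
    have "cmod (F n x) = \<bar>bump' (1 / real (Suc n)) (ln (cmod x))\<bar> * (\<bar>prof \<alpha> m c b (ln (cmod x))\<bar> / cmod x)"
      using x by (simp add: F_def norm_mult norm_divide gmode_def lpol_def norm_ang)
    also have "\<dots> \<le> (4 * exp 1 * \<bar>1 / real (Suc n)\<bar>) * (C / cmod x)"
      by (intro mult_mono abs_bump'_le divide_right_mono C) auto
    finally have "(cmod (F n x))\<^sup>2 \<le> ((4 * exp 1 * \<bar>1 / real (Suc n)\<bar>) * (C / cmod x))\<^sup>2"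
      by (intro power_mono) auto
    also have "\<dots> = (?D / (real (Suc n))\<^sup>2) * K n x"
      unfolding K by (simp add: power_mult_distrib power_divide)
    finally show ?thesis .
  qed
  have Ki: "has_bochner_integral lborel (K n) (4 * pi * real (Suc n))" for n
    unfolding K_def by (rule has_bochner_integral_inverse_square_annulus) simp
  have Fm: "F n \<in> borel_measurable lborel" for n
    unfolding F_def gmode_eq_gauss by measurable
  have FL: "F n \<in> L2" for n
    by (rule L2_bound[OF Fm _ bnd]) (use Ki integrable.simps in \<open>blast intro: integrable_mult_right\<close>)
  thus "(\<lambda>x. of_real (bump' (1 / real (Suc n)) (ln (cmod x))) * (gmode \<alpha> m c b x / of_real (cmod x))) \<in> L2"
    by (simp add: F_def)
  have "L2_norm (F n) \<le> sqrt (?D * 4 * pi / real (Suc n))" for n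
  proof -
    have "(\<integral>x. (cmod (F n x))\<^sup>2 \<partial>lborel) \<le> (\<integral>x. (?D / (real (Suc n))\<^sup>2) * K n x \<partial>lborel)"
      using Ki[of n] by (intro integral_mono L2_integrable_sq FL bnd integrable_mult_right) (auto simp: integrable.simps)
    also have "\<dots> = (?D / (real (Suc n))\<^sup>2) * (4 * pi * real (Suc n))"
      using has_bochner_integral_integral_eq[OF Ki[of n]] by simp
    also have "\<dots> = ?D * 4 * pi / real (Suc n)" by (simp add: power2_eq_square del: of_nat_Suc)
    finally show ?thesis unfolding L2_norm_def by (rule real_sqrt_le_mono)
  qed
  moreover have "(\<lambda>n. sqrt (?D * 4 * pi / real (Suc n))) \<longlonglongrightarrow> 0"
  proof -
    have "(\<lambda>n. sqrt (?D * 4 * pi * inverse (real (Suc n)))) \<longlonglongrightarrow> sqrt (?D * 4 * pi * 0)"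
      by (intro tendsto_intros LIMSEQ_inverse_real_of_nat)
    thus ?thesis by (simp add: divide_inverse)
  qed
  ultimately show "(\<lambda>n. L2_norm (\<lambda>x. of_real (bump' (1 / real (Suc n)) (ln (cmod x))) * (gmode \<alpha> m c b x / of_real (cmod x)))) \<longlonglongrightarrow> 0"
    unfolding F_def[symmetric] by (intro Lim_null_comparison[of "\<lambda>n. L2_norm (F n)"]) auto
qed

text \<open>The gradients of the cutoff functions converge in \<open>L2\<close> to
  \<open>gmode_dr\<close> and \<open>gmode_ang_grad\<close>, hence are Cauchy sequences, which is
  what \<open>approx_seq\<close> asks for.\<close>

lemma gmode_form_dom:
  assumes "b > 0"
  shows "gmode \<alpha> m c b \<in> form_dom \<alpha>"
proof -
  let ?\<psi> = "cutoff \<alpha> m c b" and ?v = "gmode \<alpha> m c b"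
  note t = cutoff_test_fun[of \<alpha> m c b]
  define d where "d n = L2_norm (\<lambda>x. dr (?\<psi> n) x - gmode_dr \<alpha> m c b x)" for n
  define e where "e n = L2_norm (\<lambda>x. ang_grad \<alpha> (?\<psi> n) x - gmode_ang_grad \<alpha> m c b x)" for n
  have e0: "e \<longlonglongrightarrow> 0"
    unfolding e_def ang_grad_cutoff by (rule L2_norm_bump_tendsto[OF gmode_ang_grad_L2[OF assms]])
  have d0: "d \<longlonglongrightarrow> 0"
  proof -
    let ?T1 = "\<lambda>n x. of_real (bump (1 / real (Suc n)) (ln (cmod x))) * gmode_dr \<alpha> m c b x - gmode_dr \<alpha> m c b x"
    let ?T2 = "\<lambda>n x. of_real (bump' (1 / real (Suc n)) (ln (cmod x))) * (gmode \<alpha> m c b x / of_real (cmod x))"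
    have T2: "?T2 n \<in> L2" for n by (rule L2_norm_bump'_tendsto(1)[OF assms])
    have T: "dr (?\<psi> n) x - gmode_dr \<alpha> m c b x = ?T1 n x + ?T2 n x" for n x
      unfolding dr_cutoff by simp
    have T1: "?T1 n \<in> L2" for n
    proof -
      have "(\<lambda>x. (dr (?\<psi> n) x - gmode_dr \<alpha> m c b x) - ?T2 n x) \<in> L2"
        by (intro L2_diff test_fun_dr_L2 t gmode_dr_L2 assms T2)
      thus ?thesis by (simp add: T)
    qed
    have le: "d n \<le> L2_norm (?T1 n) + L2_norm (?T2 n)" for n
      unfolding d_def T by (rule L2_norm_triangle[OF T1 T2])
    have "(\<lambda>n. L2_norm (?T1 n) + L2_norm (?T2 n)) \<longlonglongrightarrow> 0 + 0"
      by (intro tendsto_add L2_norm_bump_tendsto gmode_dr_L2 L2_norm_bump'_tendsto(2) assms)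
    thus ?thesis
      using le by (intro Lim_null_comparison[of d]) (auto simp: d_def)
  qed
  have "approx_seq \<alpha> ?v ?\<psi>"
    unfolding approx_seq_def
  proof (intro conjI allI impI)
    show "test_fun (?\<psi> n)" for n by (rule t)
    show "(\<lambda>n. L2_norm (\<lambda>x. ?\<psi> n x - ?v x)) \<longlonglongrightarrow> 0"
      unfolding cutoff_eq by (rule L2_norm_bump_tendsto[OF gmode_L2[OF assms]])
    fix \<epsilon> :: real assume "\<epsilon> > 0"
    \<comment> \<open>Two triangle inequalities give \<open>2 * \<eta>\<close> for each gradient
      component, and the two squares add up to \<open>8 * \<eta>^2 = \<epsilon>\<close>.\<close>
    define \<eta> where "\<eta> = sqrt (\<epsilon> / 8)"
    have \<eta>: "\<eta> > 0" "8 * \<eta>\<^sup>2 = \<epsilon>" using \<open>\<epsilon> > 0\<close> by (auto simp: \<eta>_def)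
    have "\<forall>\<^sub>F n in sequentially. d n < \<eta>" "\<forall>\<^sub>F n in sequentially. e n < \<eta>"
      using order_tendstoD(2)[OF d0] order_tendstoD(2)[OF e0] \<eta> by auto
    hence "\<forall>\<^sub>F n in sequentially. d n < \<eta> \<and> e n < \<eta>" by (rule eventually_conj)
    then obtain N where N: "\<And>n. n \<ge> N \<Longrightarrow> d n < \<eta> \<and> e n < \<eta>"
      unfolding eventually_sequentially by blast
    have "Re (AB_form0 \<alpha> (\<lambda>x. ?\<psi> k x - ?\<psi> n x) (\<lambda>x. ?\<psi> k x - ?\<psi> n x)) < \<epsilon>" if "k \<ge> N" "n \<ge> N" for k n
    proof -
      have 1: "L2_norm (\<lambda>x. dr (?\<psi> k) x - dr (?\<psi> n) x) < 2 * \<eta>"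
        using L2_norm_triangle_diff[of "dr (?\<psi> k)" "gmode_dr \<alpha> m c b" "dr (?\<psi> n)"] test_fun_dr_L2[OF t] gmode_dr_L2[OF assms]
          N[OF that(1)] N[OF that(2)] L2_norm_minus_commute[of "gmode_dr \<alpha> m c b" "dr (?\<psi> n)"] by (simp add: d_def)
      have 2: "L2_norm (\<lambda>x. ang_grad \<alpha> (?\<psi> k) x - ang_grad \<alpha> (?\<psi> n) x) < 2 * \<eta>"
        using L2_norm_triangle_diff[of "ang_grad \<alpha> (?\<psi> k)" "gmode_ang_grad \<alpha> m c b" "ang_grad \<alpha> (?\<psi> n)"] test_fun_ang_grad_L2[OF t] gmode_ang_grad_L2[OF assms]
          N[OF that(1)] N[OF that(2)] L2_norm_minus_commute[of "gmode_ang_grad \<alpha> m c b" "ang_grad \<alpha> (?\<psi> n)"] by (simp add: e_def)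
      have "(L2_norm (\<lambda>x. dr (?\<psi> k) x - dr (?\<psi> n) x))\<^sup>2 + (L2_norm (\<lambda>x. ang_grad \<alpha> (?\<psi> k) x - ang_grad \<alpha> (?\<psi> n) x))\<^sup>2 < (2 * \<eta>)\<^sup>2 + (2 * \<eta>)\<^sup>2"
        by (intro add_strict_mono power_strict_mono 1 2) auto
      also have "\<dots> = \<epsilon>" using \<eta>(2) by (simp add: power2_eq_square)
      finally show ?thesis by (simp add: AB_form0_diff_self t)
    qed
    thus "\<exists>N. \<forall>m'\<ge>N. \<forall>n\<ge>N. Re (AB_form0 \<alpha> (\<lambda>x. ?\<psi> m' x - ?\<psi> n x) (\<lambda>x. ?\<psi> m' x - ?\<psi> n x)) < \<epsilon>" by blast
  qed
  thus ?thesis unfolding form_dom_def using gmode_L2[OF assms] by blast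
qed

lemma gmode_AB_op: "b > 0 \<Longrightarrow> AB_op \<alpha> (gmode \<alpha> m c b) (gmode_op \<alpha> m c b)"
  by (rule AB_opI[OF gmode_form_dom gmode_op_L2 gmode_C1_off_0 gmode_weak])

section \<open>Explicit solutions and uniqueness\<close>

text \<open>Inserting \<open>c(t) * r powr nu * exp (- b(t) * r^2)\<close> in the heat equation
  gives \<open>b' = - 4 * b^2\<close> and \<open>c' = - 4 * (1 + nu) * b * c\<close>. With
  \<open>b(0) = a\<close> and \<open>c(0) = 1\<close> the solution is \<open>b = a / hwidth\<close>
  and \<open>c = hwidth powr (- 1 - nu)\<close>.\<close>

definition hwidth :: "real \<Rightarrow> real \<Rightarrow> real" where
  "hwidth a t = 1 + 4 * a * t"

definition hmode :: "real \<Rightarrow> int \<Rightarrow> real \<Rightarrow> real \<Rightarrow> complex \<Rightarrow> complex" where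
  "hmode \<alpha> m a t = gmode \<alpha> m (hwidth a t powr (- 1 - nu \<alpha> m)) (a / hwidth a t)"

definition hmode_op :: "real \<Rightarrow> int \<Rightarrow> real \<Rightarrow> real \<Rightarrow> complex \<Rightarrow> complex" where
  "hmode_op \<alpha> m a t = gmode_op \<alpha> m (hwidth a t powr (- 1 - nu \<alpha> m)) (a / hwidth a t)"

lemma hwidth_ge1: "a > 0 \<Longrightarrow> t \<ge> 0 \<Longrightarrow> hwidth a t \<ge> 1"
  by (simp add: hwidth_def)

lemma hmode_0: "hmode \<alpha> m a 0 = gmode \<alpha> m 1 a"
  by (simp add: hmode_def hwidth_def)

definition hrad :: "real \<Rightarrow> real \<Rightarrow> real \<Rightarrow> real \<Rightarrow> real" where
  "hrad n a r t = hwidth a t powr (- 1 - n) * (r powr n * exp (- (a / hwidth a t) * r\<^sup>2))"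

definition hrad' :: "real \<Rightarrow> real \<Rightarrow> real \<Rightarrow> real \<Rightarrow> real" where
  "hrad' n a r t = (4 * (a / hwidth a t)\<^sup>2 * r\<^sup>2 - 4 * (a / hwidth a t) * (1 + n)) * hrad n a r t"

lemma hmode_eq: "hmode \<alpha> m a t x = of_real (hrad (nu \<alpha> m) a (cmod x) t) * ang m x"
  unfolding hmode_def gmode_eq_gauss gauss_def hrad_def by simp

lemma hmode_op_eq: "hmode_op \<alpha> m a t x = - of_real (hrad' (nu \<alpha> m) a (cmod x) t) * ang m x"
  unfolding hmode_op_def gmode_op_def hrad'_def hmode_def[symmetric] hmode_eq by (simp add: algebra_simps)

lemma hrad_deriv:
  assumes "a > 0" "t \<ge> 0"
  shows "(hrad n a r has_real_derivative hrad' n a r t) (at t)"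
proof -
  have D: "hwidth a t > 0" using hwidth_ge1[OF assms] by linarith
  have 1: "((\<lambda>t. hwidth a t) has_real_derivative 4 * a) (at t)"
    unfolding hwidth_def by (auto intro!: derivative_eq_intros)
  have 2: "((\<lambda>t. hwidth a t powr (- 1 - n)) has_real_derivative (- 1 - n) * hwidth a t powr (- 1 - n - 1) * (4 * a)) (at t)"
    using DERIV_chain2[OF has_real_derivative_powr[OF D, of "- 1 - n"] 1] by simp
  have 3: "((\<lambda>t. exp (- (a / hwidth a t) * r\<^sup>2)) has_real_derivative exp (- (a / hwidth a t) * r\<^sup>2) * (4 * a\<^sup>2 / (hwidth a t)\<^sup>2 * r\<^sup>2)) (at t)"
    by (rule derivative_eq_intros 1 refl | use D in \<open>simp add: power2_eq_square field_simps\<close>)+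
  have 4: "(hrad n a r has_real_derivative
      hwidth a t powr (- 1 - n) * (r powr n * (exp (- (a / hwidth a t) * r\<^sup>2) * (4 * a\<^sup>2 / (hwidth a t)\<^sup>2 * r\<^sup>2))) +
      ((- 1 - n) * hwidth a t powr (- 1 - n - 1) * (4 * a)) * (r powr n * exp (- (a / hwidth a t) * r\<^sup>2))) (at t)"
    unfolding hrad_def[abs_def]
    by (rule DERIV_cong[OF DERIV_mult[OF 2 DERIV_cmult[OF 3]]]) simp
  have 5: "hwidth a t powr (- 1 - n - 1) = hwidth a t powr (- 1 - n) / hwidth a t"
    using D powr_diff[of "hwidth a t" "- 1 - n" 1] by simp
  show ?thesis
    by (rule DERIV_cong[OF 4[unfolded 5]]) (simp add: hrad'_def hrad_def divide_inverse power_mult_distrib power_inverse algebra_simps)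
qed

text \<open>A majorant of the time derivative that is uniform on \<open>0 <= t <= T\<close>: the
  polynomial factor is taken at time \<open>0\<close>, where the rate \<open>a / hwidth a t\<close>
  is largest, the Gaussian at time \<open>T\<close>, where it is widest.\<close>

definition hmaj :: "real \<Rightarrow> real \<Rightarrow> real \<Rightarrow> real \<Rightarrow> real" where
  "hmaj n a T r = (4 * a\<^sup>2 * r\<^sup>2 + 4 * a * (1 + n)) * (r powr n * exp (- (a / hwidth a T) * r\<^sup>2))"

lemma hrad'_bound:
  assumes "a > 0" "0 \<le> t" "t \<le> T" "n \<ge> 0"
  shows "\<bar>hrad' n a r t\<bar> \<le> hmaj n a T r"
proof -
  have D: "hwidth a t \<ge> 1" using assms by (intro hwidth_ge1)
  have DT: "hwidth a t \<le> hwidth a T" using assms by (simp add: hwidth_def)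
  have b: "a / hwidth a t \<le> a" "0 \<le> a / hwidth a t" using D assms by (auto simp: field_simps)
  have "\<bar>4 * (a / hwidth a t)\<^sup>2 * r\<^sup>2 - 4 * (a / hwidth a t) * (1 + n)\<bar> \<le> \<bar>4 * (a / hwidth a t)\<^sup>2 * r\<^sup>2\<bar> + \<bar>4 * (a / hwidth a t) * (1 + n)\<bar>"
    by (rule abs_triangle_ineq4)
  also have "\<dots> = 4 * (a / hwidth a t)\<^sup>2 * r\<^sup>2 + 4 * (a / hwidth a t) * (1 + n)"
    using b(2) assms(4) by (simp only: abs_of_nonneg mult_nonneg_nonneg zero_le_power2 zero_le_numeral add_nonneg_nonneg zero_le_one)
  also have "\<dots> \<le> 4 * a\<^sup>2 * r\<^sup>2 + 4 * a * (1 + n)"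
    using b assms by (intro add_mono mult_right_mono mult_left_mono power_mono) auto
  finally have 1: "\<bar>4 * (a / hwidth a t)\<^sup>2 * r\<^sup>2 - 4 * (a / hwidth a t) * (1 + n)\<bar> \<le> 4 * a\<^sup>2 * r\<^sup>2 + 4 * a * (1 + n)" .
  have p: "hwidth a t powr (- 1 - n) \<le> 1"
    using D assms powr_mono[of "-1 - n" 0 "hwidth a t"] by simp
  have "a / hwidth a T \<le> a / hwidth a t" using D DT assms by (intro divide_left_mono) auto
  hence "exp (- (a / hwidth a t) * r\<^sup>2) \<le> exp (- (a / hwidth a T) * r\<^sup>2)"
    using mult_right_mono[of "a / hwidth a T" "a / hwidth a t" "r\<^sup>2"] by simp
  hence "hrad n a r t \<le> 1 * (r powr n * exp (- (a / hwidth a T) * r\<^sup>2))"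
    unfolding hrad_def using p by (intro mult_mono) auto
  moreover have "0 \<le> hrad n a r t" by (simp add: hrad_def)
  ultimately show ?thesis
    unfolding hrad'_def hmaj_def abs_mult using 1 assms by (intro mult_mono) auto
qed

lemma hrad_lipschitz:
  assumes "a > 0" "0 \<le> s" "s \<le> T" "0 \<le> t" "t \<le> T" "n \<ge> 0"
  shows "\<bar>hrad n a r s - hrad n a r t\<bar> \<le> hmaj n a T r * \<bar>s - t\<bar>"
proof -
  have "norm (hrad n a r s - hrad n a r t) \<le> hmaj n a T r * norm (s - t)"
  proof (rule field_differentiable_bound[of "{0..T}" "hrad n a r" "hrad' n a r"])
    fix z assume "z \<in> {0..T}"
    thus "(hrad n a r has_real_derivative hrad' n a r z) (at z within {0..T})" "norm (hrad' n a r z) \<le> hmaj n a T r"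
      using hrad_deriv[of a z n r] hrad'_bound[of a z T n r] assms by (auto intro: has_field_derivative_at_within)
  qed (use assms in auto)
  thus ?thesis by simp
qed

lemma hmaj_L2:
  assumes "a > 0" "T \<ge> 0" "n \<ge> 0"
  shows "integrable lborel (\<lambda>x::complex. (hmaj n a T (cmod x))\<^sup>2)"
proof -
  define b where "b = a / hwidth a T"
  have b: "b > 0" using assms hwidth_ge1[of a T] by (simp add: b_def)
  have "(\<lambda>x. of_real (4 * a\<^sup>2) * gauss (n + 2) b 0 x + of_real (4 * a * (1 + n)) * gauss n b 0 x) \<in> L2"
    using assms by (intro L2_add L2_cmult gauss_L2 b) auto
  hence i: "integrable lborel (\<lambda>x. (cmod (of_real (4 * a\<^sup>2) * gauss (n + 2) b 0 x + of_real (4 * a * (1 + n)) * gauss n b 0 x))\<^sup>2)"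
    by (rule L2_integrable_sq)
  have "(cmod (of_real (4 * a\<^sup>2) * gauss (n + 2) b 0 x + of_real (4 * a * (1 + n)) * gauss n b 0 x))\<^sup>2 = (hmaj n a T (cmod x))\<^sup>2" if "x \<noteq> 0" for x
  proof -
    have "of_real (4 * a\<^sup>2) * gauss (n + 2) b 0 x + of_real (4 * a * (1 + n)) * gauss n b 0 x = of_real (hmaj n a T (cmod x)) * ang 0 x"
      unfolding gauss_shift[symmetric] hmaj_def b_def[symmetric] by (simp add: gauss_def algebra_simps)
    thus ?thesis using norm_ang[OF that] by (simp add: norm_mult)
  qed
  note eq = this
  \<comment> \<open>The two functions may differ at the origin, because
    \<open>ang 0 0 = 0\<close>.\<close>
  have "AE x in lborel. (cmod (of_real (4 * a\<^sup>2) * gauss (n + 2) b 0 x + of_real (4 * a * (1 + n)) * gauss n b 0 x))\<^sup>2 = (hmaj n a T (cmod x))\<^sup>2"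
    using AE_lborel_singleton[of "0::complex"] by eventually_elim (rule eq)
  from integrable_cong_AE[OF _ _ this] i show ?thesis by (simp add: hmaj_def)
qed

lemma hmode_L2: "a > 0 \<Longrightarrow> t \<ge> 0 \<Longrightarrow> hmode \<alpha> m a t \<in> L2"
  unfolding hmode_def using hwidth_ge1[of a t] by (intro gmode_L2) auto

lemma hmode_op_L2: "a > 0 \<Longrightarrow> t \<ge> 0 \<Longrightarrow> hmode_op \<alpha> m a t \<in> L2"
  unfolding hmode_op_def using hwidth_ge1[of a t] by (intro gmode_op_L2) auto

lemma hmode_AB_op: "a > 0 \<Longrightarrow> t \<ge> 0 \<Longrightarrow> AB_op \<alpha> (hmode \<alpha> m a t) (hmode_op \<alpha> m a t)"
  unfolding hmode_def hmode_op_def using hwidth_ge1[of a t] by (intro gmode_AB_op) auto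

lemma hmode_tendsto_0:
  assumes "a > 0"
  shows "((\<lambda>t. L2_norm (\<lambda>x. hmode \<alpha> m a t x - hmode \<alpha> m a 0 x)) \<longlongrightarrow> 0) (at_right 0)"
proof (rule Lim_null_comparison)
  let ?K = "sqrt (\<integral>x. (hmaj (nu \<alpha> m) a 1 (cmod x))\<^sup>2 \<partial>lborel)"
  have "((\<lambda>t. t * ?K) \<longlongrightarrow> 0 * ?K) (at_right 0)" by (intro tendsto_intros)
  thus "((\<lambda>t. t * ?K) \<longlongrightarrow> 0) (at_right 0)" by simp
  have "\<forall>\<^sub>F t in at_right (0::real). t \<in> {0<..<1}" by (rule eventually_at_right_real) simp
  thus "\<forall>\<^sub>F t in at_right 0. norm (L2_norm (\<lambda>x. hmode \<alpha> m a t x - hmode \<alpha> m a 0 x)) \<le> t * ?K"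
  proof eventually_elim
    fix t :: real assume t: "t \<in> {0<..<1}"
    have "(\<integral>x. (cmod (hmode \<alpha> m a t x - hmode \<alpha> m a 0 x))\<^sup>2 \<partial>lborel) \<le> (\<integral>x. t\<^sup>2 * (hmaj (nu \<alpha> m) a 1 (cmod x))\<^sup>2 \<partial>lborel)"
    proof (rule integral_mono)
      show "integrable lborel (\<lambda>x. (cmod (hmode \<alpha> m a t x - hmode \<alpha> m a 0 x))\<^sup>2)"
        using t assms by (intro L2_integrable_sq L2_diff hmode_L2) auto
      show "integrable lborel (\<lambda>x::complex. t\<^sup>2 * (hmaj (nu \<alpha> m) a 1 (cmod x))\<^sup>2)"
        using assms by (intro integrable_mult_right hmaj_L2) auto
      fix x
      have "hmode \<alpha> m a t x - hmode \<alpha> m a 0 x = of_real (hrad (nu \<alpha> m) a (cmod x) t - hrad (nu \<alpha> m) a (cmod x) 0) * ang m x"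
        by (simp add: hmode_eq algebra_simps)
      hence "cmod (hmode \<alpha> m a t x - hmode \<alpha> m a 0 x) \<le> \<bar>hrad (nu \<alpha> m) a (cmod x) t - hrad (nu \<alpha> m) a (cmod x) 0\<bar>"
        using norm_ang_le[of m x] by (simp only: norm_mult norm_of_real mult_left_le abs_ge_zero)
      also have "\<dots> \<le> hmaj (nu \<alpha> m) a 1 (cmod x) * \<bar>t - 0\<bar>"
        using t assms by (intro hrad_lipschitz) auto
      finally have "(cmod (hmode \<alpha> m a t x - hmode \<alpha> m a 0 x))\<^sup>2 \<le> (hmaj (nu \<alpha> m) a 1 (cmod x) * \<bar>t - 0\<bar>)\<^sup>2"
        by (intro power_mono) auto
      thus "(cmod (hmode \<alpha> m a t x - hmode \<alpha> m a 0 x))\<^sup>2 \<le> t\<^sup>2 * (hmaj (nu \<alpha> m) a 1 (cmod x))\<^sup>2"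
        by (simp add: power_mult_distrib mult.commute)
    qed
    also have "\<dots> = t\<^sup>2 * (\<integral>x. (hmaj (nu \<alpha> m) a 1 (cmod x))\<^sup>2 \<partial>lborel)" by simp
    finally have "sqrt (\<integral>x. (cmod (hmode \<alpha> m a t x - hmode \<alpha> m a 0 x))\<^sup>2 \<partial>lborel) \<le> sqrt (t\<^sup>2 * (\<integral>x. (hmaj (nu \<alpha> m) a 1 (cmod x))\<^sup>2 \<partial>lborel))"
      by (rule real_sqrt_le_mono)
    thus "norm (L2_norm (\<lambda>x. hmode \<alpha> m a t x - hmode \<alpha> m a 0 x)) \<le> t * ?K"
      using t by (simp add: L2_norm_def real_sqrt_mult)
  qed
qed

text \<open>The limit is tested along sequences, where dominated convergence is available. The
  Lipschitz bound controls the difference quotient and \<open>hrad'_bound\<close> the derivative,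
  both by \<open>hmaj\<close> at the end time \<open>t + 1\<close>.\<close>

lemma hmode_deriv:
  assumes "a > 0" "t > 0"
  shows "((\<lambda>h. L2_norm (\<lambda>x. (hmode \<alpha> m a (t + h) x - hmode \<alpha> m a t x) / of_real h + hmode_op \<alpha> m a t x)) \<longlongrightarrow> 0) (at 0)"
  unfolding tendsto_at_iff_sequentially
proof (intro allI impI)
  fix X :: "nat \<Rightarrow> real"
  assume X: "\<forall>i. X i \<in> UNIV - {0}" "X \<longlonglongrightarrow> 0"
  let ?n = "nu \<alpha> m"
  let ?f = "\<lambda>h x. (hmode \<alpha> m a (t + h) x - hmode \<alpha> m a t x) / of_real h + hmode_op \<alpha> m a t x"
  have "\<forall>\<^sub>F i in sequentially. X i \<in> {- min t 1 <..< 1}"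
    using topological_tendstoD[OF X(2), of "{- min t 1 <..< 1}"] assms by simp
  hence "\<forall>\<^sub>F i in sequentially. X i > - t \<and> X i < 1"
    by eventually_elim auto
  \<comment> \<open>Dropping the first \<open>N\<close> terms keeps \<open>t + h\<close> between
    \<open>0\<close> and \<open>t + 1\<close>, where the bounds on \<open>hrad\<close> hold.\<close>
  then obtain N where N: "\<And>i. i \<ge> N \<Longrightarrow> X i > - t \<and> X i < 1"
    unfolding eventually_sequentially by blast
  have "(\<lambda>i. L2_norm (?f (X (i + N)))) \<longlonglongrightarrow> 0"
  proof (rule L2_dominated_convergence)
    show "?f (X (i + N)) \<in> borel_measurable lborel" for i
      unfolding hmode_eq hmode_op_eq hrad_def hrad'_def by measurable
    show "integrable lborel (\<lambda>x::complex. 4 * (hmaj ?n a (t + 1) (cmod x))\<^sup>2)"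
      using assms by (intro integrable_mult_right hmaj_L2) auto
    have eq: "?f h x = of_real ((hrad ?n a (cmod x) (t + h) - hrad ?n a (cmod x) t) / h - hrad' ?n a (cmod x) t) * ang m x" for h x
      by (simp add: hmode_eq hmode_op_eq algebra_simps diff_divide_distrib)
    show "(\<lambda>i. ?f (X (i + N)) x) \<longlonglongrightarrow> 0" for x
    proof -
      have "((\<lambda>h. (hrad ?n a (cmod x) (t + h) - hrad ?n a (cmod x) t) / h) \<longlongrightarrow> hrad' ?n a (cmod x) t) (at 0)"
        using hrad_deriv[of a t ?n "cmod x"] assms by (simp add: DERIV_def)
      moreover have "filterlim (\<lambda>i. X (i + N)) (at 0) sequentially"
        using X LIMSEQ_ignore_initial_segment[OF X(2), of N] by (auto simp: filterlim_at)
      ultimately have "(\<lambda>i. (hrad ?n a (cmod x) (t + X (i + N)) - hrad ?n a (cmod x) t) / X (i + N)) \<longlonglongrightarrow> hrad' ?n a (cmod x) t"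
        by (rule filterlim_compose)
      hence "(\<lambda>i. of_real ((hrad ?n a (cmod x) (t + X (i + N)) - hrad ?n a (cmod x) t) / X (i + N) - hrad' ?n a (cmod x) t) * ang m x)
         \<longlonglongrightarrow> of_real (hrad' ?n a (cmod x) t - hrad' ?n a (cmod x) t) * ang m x"
        by (intro tendsto_intros)
      thus ?thesis unfolding eq by simp
    qed
    fix i x
    let ?h = "X (i + N)" and ?k = "hmaj ?n a (t + 1) (cmod x)"
    have h: "?h > - t" "?h < 1" "?h \<noteq> 0" using N[of "i + N"] X(1) by auto
    have "\<bar>hrad ?n a (cmod x) (t + ?h) - hrad ?n a (cmod x) t\<bar> \<le> ?k * \<bar>t + ?h - t\<bar>"
      using h assms by (intro hrad_lipschitz) auto
    hence "\<bar>(hrad ?n a (cmod x) (t + ?h) - hrad ?n a (cmod x) t) / ?h\<bar> \<le> ?k"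
      using h by (simp add: field_simps)
    moreover have "\<bar>hrad' ?n a (cmod x) t\<bar> \<le> ?k" using assms by (intro hrad'_bound) auto
    ultimately have "\<bar>(hrad ?n a (cmod x) (t + ?h) - hrad ?n a (cmod x) t) / ?h - hrad' ?n a (cmod x) t\<bar> \<le> 2 * ?k"
      by linarith
    moreover have "cmod (?f ?h x) \<le> \<bar>(hrad ?n a (cmod x) (t + ?h) - hrad ?n a (cmod x) t) / ?h - hrad' ?n a (cmod x) t\<bar>"
      unfolding eq norm_mult norm_of_real using norm_ang_le[of m x] by (simp add: mult_left_le)
    ultimately have "cmod (?f ?h x) \<le> 2 * ?k" by linarith
    hence "(cmod (?f ?h x))\<^sup>2 \<le> (2 * ?k)\<^sup>2" by (intro power_mono) auto
    thus "(cmod (?f ?h x))\<^sup>2 \<le> 4 * ?k\<^sup>2" by (simp add: power_mult_distrib)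
  qed
  thus "((\<lambda>h. L2_norm (?f h)) \<circ> X) \<longlonglongrightarrow> 0" unfolding o_def by (rule LIMSEQ_offset)
qed

theorem heat_solution_gmode_unique:
  assumes "a > 0" and u: "heat_solution \<alpha> (gmode \<alpha> m 1 a) u" and "t > 0"
  shows "AE x in lborel. u t x = hmode \<alpha> m a t x"
proof -
  define d where "d s = (\<lambda>x. u s x - hmode \<alpha> m a s x)" for s
  have uL: "u s \<in> L2" if "s > 0" for s using u that by (auto simp: heat_solution_def)
  have VL: "hmode \<alpha> m a s \<in> L2" if "s \<ge> 0" for s using hmode_L2[OF assms(1) that] .
  have dL: "d s \<in> L2" if "s > 0" for s unfolding d_def using that by (intro L2_diff uL VL) auto
  have der: "\<exists>y. ((\<lambda>s. (L2_norm (d s))\<^sup>2) has_real_derivative y) (at s) \<and> y \<le> 0" if s: "s > 0" for s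
  proof -
    obtain w where w: "AB_op \<alpha> (u s) w"
      "((\<lambda>h. L2_norm (\<lambda>x. (u (s + h) x - u s x) / of_real h + w x)) \<longlongrightarrow> 0) (at 0)"
      using u s unfolding heat_solution_def by blast
    note V = hmode_AB_op[OF assms(1), of s \<alpha> m]
    let ?V = "hmode \<alpha> m a s" and ?W = "hmode_op \<alpha> m a s"
    have wL: "w \<in> L2" using w(1) by (simp add: AB_op_def)
    have WL: "?W \<in> L2" using hmode_op_L2[OF assms(1)] s by simp
    have "((\<lambda>h. L2_norm (\<lambda>x. (d (s + h) x - d s x) / of_real h + (w x - ?W x))) \<longlongrightarrow> 0) (at 0)"
    proof (rule Lim_null_comparison)
      let ?A = "\<lambda>h x. (u (s + h) x - u s x) / of_real h + w x"
      let ?B = "\<lambda>h x. (hmode \<alpha> m a (s + h) x - ?V x) / of_real h + ?W x"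
      have "((\<lambda>h. L2_norm (?A h) + L2_norm (?B h)) \<longlongrightarrow> 0 + 0) (at 0)"
        by (intro tendsto_add w(2) hmode_deriv assms(1) s)
      thus "((\<lambda>h. L2_norm (?A h) + L2_norm (?B h)) \<longlongrightarrow> 0) (at 0)" by simp
      have "\<forall>\<^sub>F h in at 0. h > - s"
        using s unfolding eventually_at by (intro exI[of _ s]) (auto simp: dist_real_def)
      thus "\<forall>\<^sub>F h in at 0. norm (L2_norm (\<lambda>x. (d (s + h) x - d s x) / of_real h + (w x - ?W x))) \<le> L2_norm (?A h) + L2_norm (?B h)"
      proof eventually_elim
        fix h assume h: "h > - s"
        have A: "?A h \<in> L2"
          using L2_add[OF L2_cmult[OF L2_diff[OF uL uL], of "s + h" s "1 / of_real h"] wL] h s by simp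
        have B: "?B h \<in> L2"
          using L2_add[OF L2_cmult[OF L2_diff[OF VL VL], of "s + h" s "1 / of_real h"] WL] h s by simp
        have "L2_norm (\<lambda>x. ?A h x + (-1) * ?B h x) \<le> L2_norm (?A h) + L2_norm (\<lambda>x. (-1) * ?B h x)"
          by (intro L2_norm_triangle A L2_cmult B)
        also have "L2_norm (\<lambda>x. (-1) * ?B h x) = L2_norm (?B h)"
          by (subst L2_norm_cmult) simp
        also have "(\<lambda>x. ?A h x + (-1) * ?B h x) = (\<lambda>x. (d (s + h) x - d s x) / of_real h + (w x - ?W x))"
          by (simp add: d_def fun_eq_iff diff_divide_distrib)
        finally show "norm (L2_norm (\<lambda>x. (d (s + h) x - d s x) / of_real h + (w x - ?W x))) \<le> L2_norm (?A h) + L2_norm (?B h)"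
          by simp
      qed
    qed
    from L2_norm_sq_has_derivative[OF dL L2_diff[OF wL WL] s this]
    have D: "((\<lambda>s. (L2_norm (d s))\<^sup>2) has_real_derivative - 2 * Re (L2_inner (\<lambda>x. w x - ?W x) (d s))) (at s)" by simp
    have fd: "u s \<in> form_dom \<alpha>" "?V \<in> form_dom \<alpha>" using w(1) V s by (auto simp: AB_op_def)
    \<comment> \<open>Each of the two operator equations is tested with both \<open>u s\<close> and
      the explicit mode. The four resulting form values combine to the expression bounded below in
      \<open>AB_form_diff_nonneg\<close>.\<close>
    have "L2_inner (\<lambda>x. w x - ?W x) (d s) = L2_inner w (u s) - L2_inner w ?V - L2_inner ?W (u s) + L2_inner ?W ?V"
      unfolding d_def using s by (simp add: L2_inner_diff_left L2_inner_diff_right L2_diff wL WL uL VL)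
    also have "\<dots> = AB_form \<alpha> (u s) (u s) - AB_form \<alpha> (u s) ?V - AB_form \<alpha> ?V (u s) + AB_form \<alpha> ?V ?V"
      using w(1) V s fd unfolding AB_op_def by simp
    finally have "0 \<le> Re (L2_inner (\<lambda>x. w x - ?W x) (d s))"
      using AB_form_diff_nonneg[OF fd] by simp
    thus ?thesis using D by (intro exI[of _ "- 2 * Re (L2_inner (\<lambda>x. w x - ?W x) (d s))"]) simp
  qed
  \<comment> \<open>The equation holds for positive times only, so the comparison starts at
    \<open>s > 0\<close>; the initial value enters through the limit from the right.\<close>
  have mono: "(L2_norm (d t))\<^sup>2 \<le> (L2_norm (d s))\<^sup>2" if "0 < s" "s \<le> t" for s
    by (rule DERIV_nonpos_imp_nonincreasing[OF that(2)]) (use der that in force)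
  have lim: "((\<lambda>s. L2_norm (d s)) \<longlongrightarrow> 0) (at_right 0)"
  proof (rule Lim_null_comparison)
    let ?f = "gmode \<alpha> m 1 a"
    have fL: "?f \<in> L2" by (rule gmode_L2[OF assms(1)])
    have "((\<lambda>s. L2_norm (\<lambda>x. u s x - ?f x) + L2_norm (\<lambda>x. hmode \<alpha> m a s x - hmode \<alpha> m a 0 x)) \<longlongrightarrow> 0 + 0) (at_right 0)"
      using u by (intro tendsto_add hmode_tendsto_0 assms(1)) (simp add: heat_solution_def)
    thus "((\<lambda>s. L2_norm (\<lambda>x. u s x - ?f x) + L2_norm (\<lambda>x. hmode \<alpha> m a s x - hmode \<alpha> m a 0 x)) \<longlongrightarrow> 0) (at_right 0)" by simp
    have "\<forall>\<^sub>F s in at_right (0::real). s \<in> {0<..<1}" by (rule eventually_at_right_real) simp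
    thus "\<forall>\<^sub>F s in at_right 0. norm (L2_norm (d s)) \<le> L2_norm (\<lambda>x. u s x - ?f x) + L2_norm (\<lambda>x. hmode \<alpha> m a s x - hmode \<alpha> m a 0 x)"
    proof eventually_elim
      fix s :: real assume "s \<in> {0<..<1}"
      thus "norm (L2_norm (d s)) \<le> L2_norm (\<lambda>x. u s x - ?f x) + L2_norm (\<lambda>x. hmode \<alpha> m a s x - hmode \<alpha> m a 0 x)"
        using L2_norm_triangle_diff[OF uL fL VL, of s s] L2_norm_minus_commute[of ?f "hmode \<alpha> m a s"]
        by (simp add: d_def hmode_0)
    qed
  qed
  have "(L2_norm (d t))\<^sup>2 \<le> 0\<^sup>2"
  proof (rule tendsto_lowerbound)
    show "((\<lambda>s. (L2_norm (d s))\<^sup>2) \<longlongrightarrow> 0\<^sup>2) (at_right 0)" by (intro tendsto_power lim)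
    have "\<forall>\<^sub>F s in at_right (0::real). s \<in> {0<..<t}" by (rule eventually_at_right_real) fact
    thus "\<forall>\<^sub>F s in at_right 0. (L2_norm (d t))\<^sup>2 \<le> (L2_norm (d s))\<^sup>2"
      by eventually_elim (use mono in auto)
  qed simp
  hence "L2_norm (d t) = 0" by simp
  from L2_norm_zero_imp_AE[OF dL[OF \<open>t > 0\<close>] this] show ?thesis
    by eventually_elim (simp add: d_def)
qed

section \<open>Totality of the Gaussian modes\<close>

lemma gmode_split: "gmode \<alpha> m 1 (1 + b) y = gmode \<alpha> m 1 1 y * of_real (exp (- b * (cmod y)\<^sup>2))"
  by (simp add: gmode_eq_gauss gauss_def algebra_simps exp_add[symmetric] flip: of_real_mult)

text \<open>The error is at most \<open>e\<close> times the integral of \<open>|h|\<close>.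
  Closeness is asked only where \<open>h\<close> is nonzero, so for compactly supported
  \<open>h\<close> an approximation on a compact set is enough.\<close>

lemma integral_zero_by_approximation:
  fixes h f :: "complex \<Rightarrow> complex"
  assumes h: "integrable lborel h" and hf: "integrable lborel (\<lambda>y. h y * f y)"
    and appr: "\<And>e. e > 0 \<Longrightarrow> \<exists>q. integrable lborel (\<lambda>y. h y * q y) \<and> (\<integral>y. h y * q y \<partial>lborel) = 0 \<and> (\<forall>y. h y \<noteq> 0 \<longrightarrow> cmod (f y - q y) \<le> e)"
  shows "(\<integral>y. h y * f y \<partial>lborel) = 0"
proof -
  let ?I = "\<integral>y. cmod (h y) \<partial>lborel"
  have I0: "?I \<ge> 0" by simp
  have le: "cmod (\<integral>y. h y * f y \<partial>lborel) \<le> e * ?I" if e: "e > 0" for e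
  proof -
    obtain q where q: "integrable lborel (\<lambda>y. h y * q y)" "(\<integral>y. h y * q y \<partial>lborel) = 0" "\<And>y. h y \<noteq> 0 \<Longrightarrow> cmod (f y - q y) \<le> e"
      using appr[OF e] by blast
    have "(\<integral>y. h y * f y \<partial>lborel) = (\<integral>y. h y * f y - h y * q y \<partial>lborel)"
      using q hf by simp
    also have "cmod \<dots> \<le> (\<integral>y. cmod (h y * f y - h y * q y) \<partial>lborel)" by (rule integral_norm_bound)
    also have "\<dots> \<le> (\<integral>y. e * cmod (h y) \<partial>lborel)"
    proof (rule integral_mono)
      show "integrable lborel (\<lambda>y. cmod (h y * f y - h y * q y))" using q hf by (intro integrable_norm Bochner_Integration.integrable_diff)
      show "integrable lborel (\<lambda>y. e * cmod (h y))" using h by auto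
      fix y
      have "cmod (h y * f y - h y * q y) = cmod (h y) * cmod (f y - q y)"
        by (simp add: norm_mult[symmetric] algebra_simps)
      also have "\<dots> \<le> cmod (h y) * e" using q(3)[of y] by (cases "h y = 0") (auto intro: mult_left_mono)
      finally show "cmod (h y * f y - h y * q y) \<le> e * cmod (h y)" by (simp add: mult.commute)
    qed
    finally show ?thesis by simp
  qed
  have "cmod (\<integral>y. h y * f y \<partial>lborel) \<le> 0"
  proof (rule field_le_epsilon)
    fix e :: real assume "e > 0"
    \<comment> \<open>The \<open>+ 1\<close> covers the case in which the integral of
      \<open>|h|\<close> is zero.\<close>
    hence "cmod (\<integral>y. h y * f y \<partial>lborel) \<le> e / (?I + 1) * ?I" using I0 by (intro le) (simp add: add_nonneg_pos)
    also have "\<dots> = e * (?I / (?I + 1))" by simp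
    also have "\<dots> \<le> e * 1"
      using \<open>e > 0\<close> I0 by (intro mult_left_mono) (simp_all add: divide_le_eq add_nonneg_pos)
    finally show "cmod (\<integral>y. h y * f y \<partial>lborel) \<le> 0 + e" by simp
  qed
  thus ?thesis by simp
qed

text \<open>All values of \<open>exp (- |y|^2)\<close> lie in \<open>[0, 1]\<close>, so polynomial
  approximation on this interval is uniform over the whole plane, although \<open>h\<close> has no
  compact support.\<close>

lemma integral_gauss_function_zero:
  fixes F :: "real \<Rightarrow> real" and h :: "complex \<Rightarrow> complex"
  assumes h: "integrable lborel h" and 0: "\<And>k::nat. (\<integral>y. h y * of_real (exp (- (cmod y)\<^sup>2) ^ k) \<partial>lborel) = 0"
    and F: "continuous_on UNIV F"
  shows "(\<integral>y. h y * of_real (F (exp (- (cmod y)\<^sup>2))) \<partial>lborel) = 0"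
proof (rule integral_zero_by_approximation[OF h])
  have in01: "exp (- (cmod y)\<^sup>2) \<in> {0..1}" for y by simp
  have bi: "integrable lborel (\<lambda>y. h y * of_real (f (exp (- (cmod y)\<^sup>2))))" if f: "continuous_on UNIV f" for f :: "real \<Rightarrow> real"
  proof -
    have "compact (f ` {0..1})" by (intro compact_continuous_image continuous_on_subset[OF f]) auto
    hence "bounded (f ` {0..1})" by (rule compact_imp_bounded)
    then obtain M where M: "\<forall>z\<in>f ` {0..1}. norm z \<le> M" unfolding bounded_iff by blast
    have [measurable]: "f \<in> borel_measurable borel" by (rule borel_measurable_continuous_onI[OF f])
    show ?thesis
    proof (rule Bochner_Integration.integrable_bound)
      show "integrable lborel (\<lambda>y. M * cmod (h y))" using h by auto
      show "(\<lambda>y. h y * of_real (f (exp (- (cmod y)\<^sup>2)))) \<in> borel_measurable lborel"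
        using h by (intro borel_measurable_times) auto
      show "AE y in lborel. norm (h y * of_real (f (exp (- (cmod y)\<^sup>2)))) \<le> norm (M * cmod (h y))"
      proof (rule AE_I2)
        fix y
        have "\<bar>f (exp (- (cmod y)\<^sup>2))\<bar> \<le> M" using M in01[of y] by auto
        hence "cmod (h y) * \<bar>f (exp (- (cmod y)\<^sup>2))\<bar> \<le> cmod (h y) * \<bar>M\<bar>" by (intro mult_left_mono) auto
        thus "norm (h y * of_real (f (exp (- (cmod y)\<^sup>2)))) \<le> norm (M * cmod (h y))"
          by (simp add: norm_mult mult.commute)
      qed
    qed
  qed
  show "integrable lborel (\<lambda>y. h y * of_real (F (exp (- (cmod y)\<^sup>2))))" by (rule bi[OF F])
  fix e :: real assume "e > 0"
  obtain p where p: "real_polynomial_function p" "\<And>x. x \<in> {0..1} \<Longrightarrow> \<bar>F x - p x\<bar> < e"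
    using Stone_Weierstrass_real_polynomial_function[of "{0..1}" F e] continuous_on_subset[OF F] \<open>e > 0\<close> by auto
  obtain a n where pe: "p = (\<lambda>x. \<Sum>i\<le>n. a i * x ^ i)"
    using p(1) real_polynomial_function_iff_sum by blast
  have mi: "integrable lborel (\<lambda>y. h y * of_real (exp (- (cmod y)\<^sup>2) ^ k))" for k
    by (rule bi) (intro continuous_intros)
  have "(\<integral>y. h y * of_real (p (exp (- (cmod y)\<^sup>2))) \<partial>lborel) = (\<integral>y. (\<Sum>i\<le>n. of_real (a i) * (h y * of_real (exp (- (cmod y)\<^sup>2) ^ i))) \<partial>lborel)"
    unfolding pe by (rule Bochner_Integration.integral_cong) (simp_all add: sum_distrib_left mult_ac)
  also have "\<dots> = (\<Sum>i\<le>n. of_real (a i) * (\<integral>y. h y * of_real (exp (- (cmod y)\<^sup>2) ^ i) \<partial>lborel))"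
    by (subst Bochner_Integration.integral_sum) (intro integrable_mult_right mi, simp only: integral_mult_right_zero)
  also have "\<dots> = 0" by (simp only: 0) simp
  finally have z: "(\<integral>y. h y * of_real (p (exp (- (cmod y)\<^sup>2))) \<partial>lborel) = 0" .
  have pc: "continuous_on UNIV p" unfolding pe by (intro continuous_intros)
  show "\<exists>q. integrable lborel (\<lambda>y. h y * q y) \<and> (\<integral>y. h y * q y \<partial>lborel) = 0 \<and> (\<forall>y. h y \<noteq> 0 \<longrightarrow> cmod (of_real (F (exp (- (cmod y)\<^sup>2))) - q y) \<le> e)"
  proof (intro exI conjI allI impI)
    show "integrable lborel (\<lambda>y. h y * of_real (p (exp (- (cmod y)\<^sup>2))))" by (rule bi[OF pc])
    show "(\<integral>y. h y * of_real (p (exp (- (cmod y)\<^sup>2))) \<partial>lborel) = 0" by (rule z)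
    fix y
    show "cmod (of_real (F (exp (- (cmod y)\<^sup>2))) - of_real (p (exp (- (cmod y)\<^sup>2)))) \<le> e"
      using p(2)[OF in01[of y]] by (simp flip: of_real_diff)
  qed
qed

section \<open>Planar polynomials in \<open>y\<close> and \<open>cnj y\<close>\<close>

inductive_set cpoly :: "(complex \<Rightarrow> complex) set" where
  mono: "(\<lambda>y. c * y ^ i * cnj y ^ l) \<in> cpoly"
| add: "f \<in> cpoly \<Longrightarrow> g \<in> cpoly \<Longrightarrow> (\<lambda>y. f y + g y) \<in> cpoly"

lemma cpoly_mono_mult: "g \<in> cpoly \<Longrightarrow> (\<lambda>y. c * y ^ i * cnj y ^ l * g y) \<in> cpoly"
proof (induction rule: cpoly.induct)
  case (mono c' i' l')
  have "(\<lambda>y. c * y ^ i * cnj y ^ l * (c' * y ^ i' * cnj y ^ l')) = (\<lambda>y. (c * c') * y ^ (i + i') * cnj y ^ (l + l'))"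
    by (simp add: power_add fun_eq_iff)
  thus ?case using cpoly.mono by simp
next
  case (add f g)
  thus ?case using cpoly.add[OF add.IH] by (simp add: distrib_left)
qed

lemma cpoly_mult: "f \<in> cpoly \<Longrightarrow> g \<in> cpoly \<Longrightarrow> (\<lambda>y. f y * g y) \<in> cpoly"
proof (induction rule: cpoly.induct)
  case (mono c i l)
  thus ?case by (rule cpoly_mono_mult)
next
  case (add f h)
  thus ?case using cpoly.add[OF add.IH(1)[OF add.prems] add.IH(2)[OF add.prems]] by (simp add: distrib_right)
qed

lemma cpoly_const: "(\<lambda>y. c) \<in> cpoly"
  using cpoly.mono[of c 0 0] by simp

lemma cpoly_real_polynomial:
  fixes p :: "complex \<Rightarrow> real"
  assumes "real_polynomial_function p"
  shows "(\<lambda>y. complex_of_real (p y)) \<in> cpoly"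
  using assms
proof (induction rule: real_polynomial_function.induct)
  case (linear f)
  let ?a = "(of_real (f 1) - \<i> * of_real (f \<i>)) / 2" and ?b = "(of_real (f 1) + \<i> * of_real (f \<i>)) / 2"
  have alg: "complex_of_real (Re y * A + Im y * B) = (of_real A - \<i> * of_real B) / 2 * y + (of_real A + \<i> * of_real B) / 2 * cnj y"
    for y A B by (simp add: complex_eq_iff field_simps)
  have "f y = Re y * f 1 + Im y * f \<i>" for y
  proof -
    have "y = Re y *\<^sub>R 1 + Im y *\<^sub>R \<i>" by (simp add: complex_eq_iff)
    hence "f y = f (Re y *\<^sub>R 1 + Im y *\<^sub>R \<i>)" by simp
    also have "\<dots> = Re y *\<^sub>R f 1 + Im y *\<^sub>R f \<i>"
      by (simp only: linear_add[OF bounded_linear.linear[OF linear]] linear_scale[OF bounded_linear.linear[OF linear]])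
    finally show ?thesis by simp
  qed
  hence "(\<lambda>y. complex_of_real (f y)) = (\<lambda>y. ?a * y + ?b * cnj y)"
    unfolding alg[symmetric] by (intro ext arg_cong[of _ _ of_real])
  moreover have "(\<lambda>y. ?a * y + ?b * cnj y) \<in> cpoly"
    using cpoly.add[OF cpoly.mono[of ?a 1 0] cpoly.mono[of ?b 0 1]] by (simp only: power_one_right power_0 mult_1_right)
  ultimately show ?case by (simp only:)
next
  case (const c)
  show ?case by (rule cpoly_const)
next
  case (add f g)
  thus ?case using cpoly.add by simp
next
  case (mult f g)
  thus ?case using cpoly_mult by simp
qed

lemma cpoly_polynomial:
  fixes p :: "complex \<Rightarrow> complex"
  assumes "polynomial_function p"
  shows "p \<in> cpoly"
proof -
  have "real_polynomial_function (Re \<circ> p)" "real_polynomial_function (Im \<circ> p)"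
    using assms bounded_linear_Re bounded_linear_Im unfolding polynomial_function_def by blast+
  hence "(\<lambda>y. of_real (Re (p y)) + \<i> * of_real (Im (p y))) \<in> cpoly"
    by (intro cpoly.add cpoly_mult cpoly_const cpoly_real_polynomial) (simp_all add: o_def)
  thus ?thesis by (simp flip: complex_eq)
qed

lemma cpoly_continuous: "f \<in> cpoly \<Longrightarrow> continuous_on S f"
  by (induction rule: cpoly.induct) (auto intro!: continuous_intros)

lemma AE_zero_continuous_imp_zero:
  fixes f :: "complex \<Rightarrow> complex"
  assumes "open U" "continuous_on U f" "AE y in lborel. y \<in> U \<longrightarrow> f y = 0" "y \<in> U"
  shows "f y = 0"
proof -
  let ?N = "U \<inter> f -` (- {0})"
  have o: "open ?N" using assms by (intro continuous_open_preimage) auto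
  have "?N \<in> null_sets lborel"
    using assms(3) o by (subst AE_iff_null_sets) (auto intro: borel_open)
  hence "negligible ?N" by (simp add: negligible_iff_null_sets null_sets_completionI)
  hence "?N = {}" using open_not_negligible[OF o] by blast
  thus ?thesis using assms(4) by blast
qed

text \<open>The function \<open>cnj \<gamma>\<close> is itself a uniform limit of polynomials on a
  disc containing the support. Vanishing moments then give zero for the integral of
  \<open>|\<gamma>|^2\<close>.\<close>

lemma supp0_moments_zero:
  assumes s: "supp0 \<gamma>" and c: "continuous_on (- {0}) \<gamma>"
    and 0: "\<And>i l. (\<integral>y. \<gamma> y * (y ^ i * cnj y ^ l) \<partial>lborel) = 0"
  shows "\<gamma> y = 0"
proof -
  have cU: "continuous_on UNIV \<gamma>" by (rule supp0_continuous_UNIV[OF s c])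
  have i: "integrable lborel \<gamma>" by (rule supp0_integrable[OF s c])
  have fi: "integrable lborel (\<lambda>y. \<gamma> y * f y)" if "continuous_on (- {0}) f" for f
    by (intro supp0_integrable continuous_intros c that) (rule supp0_subset[OF s], simp)
  have z: "(\<integral>y. \<gamma> y * f y \<partial>lborel) = 0" if "f \<in> cpoly" for f
    using that
  proof (induction rule: cpoly.induct)
    case (mono c i l)
    have "(\<integral>y. \<gamma> y * (c * y ^ i * cnj y ^ l) \<partial>lborel) = (\<integral>y. c * (\<gamma> y * (y ^ i * cnj y ^ l)) \<partial>lborel)"
      by (rule Bochner_Integration.integral_cong) (simp_all add: mult_ac)
    thus ?case by (simp only: integral_mult_right_zero 0) simp
  next
    case (add f g)
    thus ?case using fi[OF cpoly_continuous[of f]] fi[OF cpoly_continuous[of g]] by (simp add: distrib_left)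
  qed
  obtain R where R: "\<And>x. \<gamma> x \<noteq> 0 \<Longrightarrow> cmod x \<le> R" using s unfolding supp0_def by blast
  have "(\<integral>y. \<gamma> y * cnj (\<gamma> y) \<partial>lborel) = 0"
  proof (rule integral_zero_by_approximation[OF i])
    show "integrable lborel (\<lambda>y. \<gamma> y * cnj (\<gamma> y))" by (intro fi continuous_intros c)
    fix e :: real assume "e > 0"
    have "continuous_on (cball 0 R) (\<lambda>y. cnj (\<gamma> y))"
      by (intro continuous_intros continuous_on_subset[OF cU]) auto
    from Stone_Weierstrass_polynomial_function[OF compact_cball this \<open>e > 0\<close>]
    obtain p where p: "polynomial_function p" "\<forall>x\<in>cball 0 R. norm (cnj (\<gamma> x) - p x) < e"
      by (elim exE conjE)
    show "\<exists>q. integrable lborel (\<lambda>y. \<gamma> y * q y) \<and> (\<integral>y. \<gamma> y * q y \<partial>lborel) = 0 \<and> (\<forall>y. \<gamma> y \<noteq> 0 \<longrightarrow> cmod (cnj (\<gamma> y) - q y) \<le> e)"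
    proof (intro exI[of _ p] conjI allI impI)
      show "integrable lborel (\<lambda>y. \<gamma> y * p y)" by (intro fi cpoly_continuous cpoly_polynomial p)
      show "(\<integral>y. \<gamma> y * p y \<partial>lborel) = 0" by (intro z cpoly_polynomial p)
      show "cmod (cnj (\<gamma> y) - p y) \<le> e" if "\<gamma> y \<noteq> 0" for y using p(2) R[OF that] by (simp add: less_imp_le)
    qed
  qed
  hence "L2_inner \<gamma> \<gamma> = 0" by (simp add: L2_inner_def)
  hence "L2_norm \<gamma> = 0" by (simp add: L2_inner_self)
  from L2_norm_zero_imp_AE[OF supp0_L2[OF s c] this]
  show ?thesis by (intro AE_zero_continuous_imp_zero[OF open_UNIV cU]) auto
qed

lemma ang_power: "y \<noteq> 0 \<Longrightarrow> ang m y ^ k = ang (m * int k) y"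
  by (simp add: ang_def power_int_mult)

text \<open>This is why polynomials are written in \<open>y\<close> and \<open>cnj y\<close>: every
  monomial has a single angular index and can be matched with one Gaussian mode.\<close>

lemma monomial_conv_ang:
  assumes "y \<noteq> 0"
  shows "y ^ i * cnj y ^ l = of_real (cmod y ^ (i + l)) * ang (int i - int l) y"
proof -
  have y: "y = of_real (cmod y) * ang 1 y"
    using assms by (simp add: ang_def sgn_div_norm scaleR_conv_of_real)
  have cy: "cnj y = of_real (cmod y) * ang (-1) y"
    using arg_cong[OF y, of cnj] by (simp add: cnj_ang)
  have "y ^ i * cnj y ^ l = (of_real (cmod y) * ang 1 y) ^ i * (of_real (cmod y) * ang (-1) y) ^ l"
    using y cy by simp
  also have "\<dots> = of_real (cmod y ^ (i + l)) * (ang (int i) y * ang (- int l) y)"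
    using assms by (simp add: power_mult_distrib ang_power power_add mult_ac)
  also have "ang (int i) y * ang (- int l) y = ang (int i - int l) y" by (simp add: ang_mult)
  finally show ?thesis .
qed

text \<open>Multiplying \<open>g\<close> by a radial cutoff that is nonzero at \<open>|y0|\<close>
  gives \<open>\<gamma>\<close>, supported in an annulus. Each monomial moment of
  \<open>\<gamma>\<close> is an integral of \<open>g\<close> against one mode times a continuous
  function of \<open>exp (- |y|^2)\<close>, hence zero by
  \<open>integral_gauss_function_zero\<close>; then \<open>supp0_moments_zero\<close>
  applies.\<close>

theorem gmode_total:
  assumes c: "continuous_on (- {0}) g"
    and i: "\<And>m (k::nat). integrable lborel (\<lambda>y. g y * gmode \<alpha> m 1 (1 + real k) y)"
    and 0: "\<And>m (k::nat). (\<integral>y. g y * gmode \<alpha> m 1 (1 + real k) y \<partial>lborel) = 0"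
    and "y0 \<noteq> 0"
  shows "g y0 = 0"
proof -
  define st where "st = exp (- (cmod y0)\<^sup>2)"
  have st: "0 < st" "st < 1" using \<open>y0 \<noteq> 0\<close> by (auto simp: st_def)
  \<comment> \<open>In the variable \<open>s = exp (- |y|^2)\<close> the origin is
    \<open>s = 1\<close> and infinity is \<open>s = 0\<close>. The interval from \<open>s0\<close>
    to \<open>s1\<close> surrounds the value \<open>st\<close> belonging to \<open>y0\<close> and
    avoids both ends.\<close>
  define s0 where "s0 = st / 2"
  define s1 where "s1 = (1 + st) / 2"
  have s: "0 < s0" "s0 < st" "st < s1" "s1 < 1" using st by (auto simp: s0_def s1_def)
  define \<rho> where "\<rho> s = max 0 ((s - s0) * (s1 - s))" for s :: real
  have \<rho>c: "continuous_on UNIV \<rho>" unfolding \<rho>_def by (intro continuous_intros)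
  have \<rho>0: "s0 \<le> z \<and> z \<le> s1" if "\<rho> z \<noteq> 0" for z
  proof -
    have "(z - s0) * (s1 - z) > 0" by (rule ccontr) (use that in \<open>simp add: \<rho>_def max_absorb1 not_less\<close>)
    thus ?thesis using s by (auto simp: zero_less_mult_iff)
  qed
  have \<rho>st: "\<rho> st \<noteq> 0" using s by (simp add: \<rho>_def max_def mult_le_0_iff)
  define \<gamma> where "\<gamma> y = g y * of_real (\<rho> (exp (- (cmod y)\<^sup>2)))" for y
  have \<gamma>s: "supp0 \<gamma>"
  proof (rule supp0I[of "sqrt (- ln s1)" _ "sqrt (- ln s0)"])
    show "0 < sqrt (- ln s1)" using s by simp
    fix y assume "\<gamma> y \<noteq> 0"
    hence "s0 \<le> exp (- (cmod y)\<^sup>2)" "exp (- (cmod y)\<^sup>2) \<le> s1" using \<rho>0 by (auto simp: \<gamma>_def)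
    hence "ln s0 \<le> - (cmod y)\<^sup>2" "- (cmod y)\<^sup>2 \<le> ln s1" using s
      by (simp_all add: ln_ge_iff[symmetric] ln_le_cancel_iff[of s0 "exp (- (cmod y)\<^sup>2)", symmetric] ln_le_cancel_iff[of "exp (- (cmod y)\<^sup>2)" s1, symmetric] del: ln_le_cancel_iff)
    thus "sqrt (- ln s1) \<le> cmod y \<and> cmod y \<le> sqrt (- ln s0)"
      by (auto intro!: real_le_rsqrt real_le_lsqrt)
  qed
  have \<gamma>c: "continuous_on (- {0}) \<gamma>"
    unfolding \<gamma>_def by (intro continuous_intros c continuous_on_compose2[OF \<rho>c]) auto
  have "(\<integral>y. \<gamma> y * (y ^ i' * cnj y ^ l) \<partial>lborel) = 0" for i' l
  proof -
    define m where "m = int i' - int l"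
    \<comment> \<open>Since \<open>- ln s = |y|^2\<close>, the factor \<open>(- ln s) powr e\<close>
      changes \<open>|y| powr nu\<close> into \<open>|y| ^ (i' + l)\<close>, and
      \<open>1 / s\<close> removes the Gaussian.\<close>
    define e where "e = (real (i' + l) - nu \<alpha> m) / 2"
    define K where "K s = (- ln s) powr e / s" for s :: real
    \<comment> \<open>Clamping the argument to \<open>[s0, s1]\<close> makes the second factor
      continuous on the whole line and changes nothing where \<open>\<rho>\<close> is
      nonzero.\<close>
    define F where "F s = \<rho> s * K (max s0 (min s1 s))" for s
    have Kc: "continuous_on {s0..s1} K"
      unfolding K_def using s by (intro continuous_intros) auto
    have "continuous_on UNIV (\<lambda>s. K (max s0 (min s1 s)))"
      by (rule continuous_on_compose2[OF Kc]) (use s in \<open>auto intro!: continuous_intros\<close>)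
    hence Fc: "continuous_on UNIV F" unfolding F_def by (intro continuous_intros \<rho>c)
    let ?h = "\<lambda>y. g y * gmode \<alpha> m 1 1 y"
    have hi: "integrable lborel ?h" using i[of m 0] by simp
    have "(\<integral>y. ?h y * of_real (exp (- (cmod y)\<^sup>2) ^ k) \<partial>lborel) = 0" for k :: nat
    proof -
      have "?h y * of_real (exp (- (cmod y)\<^sup>2) ^ k) = g y * gmode \<alpha> m 1 (1 + real k) y" for y
        unfolding gmode_split[of \<alpha> m "real k"] by (simp add: exp_of_nat_mult[symmetric] mult_ac)
      thus ?thesis using 0[of m k] by (simp only:)
    qed
    from integral_gauss_function_zero[OF hi this Fc]
    have z: "(\<integral>y. ?h y * of_real (F (exp (- (cmod y)\<^sup>2))) \<partial>lborel) = 0" .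
    have eq: "?h y * of_real (F (exp (- (cmod y)\<^sup>2))) = \<gamma> y * (y ^ i' * cnj y ^ l)" for y
    proof (cases "y = 0 \<or> \<rho> (exp (- (cmod y)\<^sup>2)) = 0")
      case True
      have "\<rho> 1 = 0" using \<rho>0[of 1] s by auto
      thus ?thesis using True by (auto simp: F_def \<gamma>_def)
    next
      case False
      let ?s = "exp (- (cmod y)\<^sup>2)"
      have y: "y \<noteq> 0" and "s0 \<le> ?s" "?s \<le> s1" using False \<rho>0 by auto
      hence F1: "F ?s = \<rho> ?s * K ?s" by (simp add: F_def)
      have K1: "K ?s = cmod y powr (2 * e) * exp ((cmod y)\<^sup>2)"
      proof -
        have "(cmod y)\<^sup>2 powr e = cmod y powr (2 * e)"
          using y powr_powr[of "cmod y" 2 e] by simp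
        thus ?thesis unfolding K_def ln_exp by (simp add: exp_minus[of "(cmod y)\<^sup>2"] divide_inverse)
      qed
      have G1: "gmode \<alpha> m 1 1 y = of_real (cmod y powr nu \<alpha> m * exp (- (cmod y)\<^sup>2)) * ang m y"
        by (simp add: gmode_eq_gauss gauss_def)
      have P1: "cmod y powr nu \<alpha> m * exp (- (cmod y)\<^sup>2) * (cmod y powr (2 * e) * exp ((cmod y)\<^sup>2)) = cmod y ^ (i' + l)"
      proof -
        have "nu \<alpha> m + 2 * e = real (i' + l)" unfolding e_def by (simp add: field_simps)
        hence "cmod y powr nu \<alpha> m * cmod y powr (2 * e) = cmod y powr (real (i' + l))"
          by (simp only: powr_add[symmetric])
        also have "\<dots> = cmod y ^ (i' + l)" using y by (intro powr_realpow) simp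
        finally show ?thesis by (simp add: exp_minus field_simps)
      qed
      have "?h y * of_real (F ?s) = g y * of_real (\<rho> ?s) * (of_real (cmod y powr nu \<alpha> m * exp (- (cmod y)\<^sup>2) * (cmod y powr (2 * e) * exp ((cmod y)\<^sup>2))) * ang m y)"
        unfolding F1 K1 G1 of_real_mult by (simp only: mult_ac)
      also have "\<dots> = g y * of_real (\<rho> ?s) * (of_real (cmod y ^ (i' + l)) * ang m y)" unfolding P1 ..
      finally have "?h y * of_real (F ?s) = g y * of_real (\<rho> ?s) * (of_real (cmod y ^ (i' + l)) * ang m y)" .
      thus ?thesis unfolding \<gamma>_def monomial_conv_ang[OF y] m_def .
    qed
    show ?thesis using z unfolding eq .
  qed
  from supp0_moments_zero[OF \<gamma>s \<gamma>c this, of y0]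
  show ?thesis using \<rho>st by (simp add: \<gamma>_def st_def)
qed

section \<open>The Bessel series kernel\<close>

text \<open>The Gamma integral is restricted to \<open>t >= M\<close>, where
  \<open>t powr x >= M powr x\<close>. The parameter \<open>M\<close> stays free: chosen larger than
  the Bessel argument, it yields geometric decay in the order.\<close>

lemma Gamma_ge:
  fixes M x :: real
  assumes "M > 0" "x \<ge> 0"
  shows "M powr x * exp (- M) \<le> Gamma (x + 1)"
proof -
  have "((\<lambda>t::real. - exp (- t)) \<longlongrightarrow> - 0) at_top"
    by (intro tendsto_minus filterlim_compose[OF exp_at_bot filterlim_uminus_at_bot_at_top])
  hence "(\<integral>\<^sup>+t. ennreal (exp (- t)) * indicator {M..} t \<partial>lborel) = ennreal (0 - - exp (- M))"
    by (intro nn_integral_FTC_atLeast[where F = "\<lambda>t. - exp (- t)"]) (auto intro!: derivative_eq_intros)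
  hence "ennreal (M powr x * exp (- M)) = ennreal (M powr x) * (\<integral>\<^sup>+t. ennreal (exp (- t)) * indicator {M..} t \<partial>lborel)"
    by (simp add: ennreal_mult)
  also have "ennreal (M powr x) * (\<integral>\<^sup>+t. ennreal (exp (- t)) * indicator {M..} t \<partial>lborel)
     = (\<integral>\<^sup>+t. ennreal (M powr x) * (ennreal (exp (- t)) * indicator {M..} t) \<partial>lborel)"
    by (rule nn_integral_cmult[symmetric]) auto
  also have "\<dots> \<le> (\<integral>\<^sup>+t. ennreal (indicator {0..} t * t powr (x + 1 - 1) / exp t) \<partial>lborel)"
  proof (rule nn_integral_mono)
    fix t :: real
    show "ennreal (M powr x) * (ennreal (exp (- t)) * indicator {M..} t) \<le> ennreal (indicator {0..} t * t powr (x + 1 - 1) / exp t)"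
    proof (cases "t \<ge> M")
      case True
      have "M powr x * exp (- t) \<le> t powr x * exp (- t)"
        using True assms by (intro mult_right_mono powr_mono2) auto
      thus ?thesis using True assms by (simp add: ennreal_mult[symmetric] exp_minus divide_inverse)
    qed simp
  qed
  also have "\<dots> = ennreal (Gamma (x + 1))"
    using assms by (intro Gamma_conv_nn_integral_real[symmetric]) simp
  finally show ?thesis
    using Gamma_real_pos[of "x + 1"] assms by simp
qed

definition bcoeff :: "real \<Rightarrow> nat \<Rightarrow> real" where
  "bcoeff n k = 1 / (fact k * Gamma (real k + n + 1))"

lemma bcoeff_pos: "n \<ge> 0 \<Longrightarrow> bcoeff n k > 0"
  unfolding bcoeff_def by (intro divide_pos_pos mult_pos_pos Gamma_real_pos) auto

lemma bcoeff_term_nonneg: "n \<ge> 0 \<Longrightarrow> s \<ge> 0 \<Longrightarrow> 0 \<le> bcoeff n k * s ^ k"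
  using bcoeff_pos[of n k] by simp

lemma bcoeff_le:
  assumes "n \<ge> 0" "M > 0"
  shows "bcoeff n k \<le> exp M * M powr (- n) * ((1 / M) ^ k / fact k)"
proof -
  have "M powr (real k + n) * exp (- M) \<le> Gamma (real k + n + 1)"
    using assms by (intro Gamma_ge) auto
  hence "1 / Gamma (real k + n + 1) \<le> 1 / (M powr (real k + n) * exp (- M))"
    using assms by (intro divide_left_mono mult_pos_pos Gamma_real_pos) auto
  also have "\<dots> = exp M * M powr (- n) * (1 / M) ^ k"
    using assms by (simp add: powr_add powr_realpow powr_minus exp_minus field_simps)
  finally have "1 / Gamma (real k + n + 1) / fact k \<le> exp M * M powr (- n) * (1 / M) ^ k / fact k"
    by (intro divide_right_mono) auto
  thus ?thesis by (simp add: bcoeff_def mult.commute)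
qed

lemma exp_series_sums: "(\<lambda>k. x ^ k / fact k) sums exp (x::real)"
  using exp_converges[of x] by (simp add: scaleR_conv_of_real divide_inverse mult.commute)

lemma bcoeff_summable:
  assumes "n \<ge> 0"
  shows "summable (\<lambda>k. bcoeff n k * s ^ k)"
proof (rule summable_comparison_test')
  show "summable (\<lambda>k. exp 1 * (\<bar>s\<bar> ^ k / fact k))"
    using exp_series_sums[of "\<bar>s\<bar>"] by (intro summable_mult) (auto simp: sums_iff)
  fix k :: nat
  have "bcoeff n k * \<bar>s\<bar> ^ k \<le> exp 1 * (1 / fact k) * \<bar>s\<bar> ^ k"
    using bcoeff_le[OF assms, of 1 k] by (intro mult_right_mono) auto
  thus "norm (bcoeff n k * s ^ k) \<le> exp 1 * (\<bar>s\<bar> ^ k / fact k)"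
    using bcoeff_pos[OF assms, of k] by (simp add: abs_mult power_abs)
qed

definition bseries :: "real \<Rightarrow> real \<Rightarrow> real" where
  "bseries n s = (\<Sum>k. bcoeff n k * s ^ k)"

lemma bseries_le:
  assumes "n \<ge> 0" "M > 0" "s \<ge> 0"
  shows "bseries n s \<le> exp M * M powr (- n) * exp (s / M)"
proof -
  have "bseries n s \<le> (\<Sum>k. exp M * M powr (- n) * ((s / M) ^ k / fact k))"
    unfolding bseries_def
  proof (rule suminf_le)
    fix k
    have "bcoeff n k * s ^ k \<le> exp M * M powr (- n) * ((1 / M) ^ k / fact k) * s ^ k"
      using bcoeff_le[OF assms(1,2), of k] assms by (intro mult_right_mono) auto
    thus "bcoeff n k * s ^ k \<le> exp M * M powr (- n) * ((s / M) ^ k / fact k)"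
      by (simp add: power_divide mult_ac)
    show "summable (\<lambda>k. bcoeff n k * s ^ k)" by (rule bcoeff_summable[OF assms(1)])
    show "summable (\<lambda>k. exp M * M powr (- n) * ((s / M) ^ k / fact k))"
      by (rule summable_mult[OF sums_summable[OF exp_series_sums]])
  qed
  also have "\<dots> = exp M * M powr (- n) * exp (s / M)"
    using exp_series_sums[of "s / M"] by (subst suminf_mult) (auto simp: sums_iff)
  finally show ?thesis .
qed

lemma bseries_nonneg: "n \<ge> 0 \<Longrightarrow> s \<ge> 0 \<Longrightarrow> 0 \<le> bseries n s"
  unfolding bseries_def by (intro suminf_nonneg bcoeff_summable bcoeff_term_nonneg)

lemma bseries_partial_le:
  assumes "n \<ge> 0" "s \<ge> 0"
  shows "(\<Sum>k<K. bcoeff n k * s ^ k) \<le> bseries n s"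
  unfolding bseries_def using assms
  by (intro sum_le_suminf bcoeff_summable bcoeff_term_nonneg) auto

lemma isCont_bseries: "n \<ge> 0 \<Longrightarrow> isCont (bseries n) s"
  unfolding bseries_def[abs_def] by (rule isCont_powser_converges_everywhere) (rule bcoeff_summable)

lemma bseries_0: "bseries n 0 = 1 / Gamma (1 + n)"
  unfolding bseries_def powser_zero by (simp add: bcoeff_def add.commute)

text \<open>This is the modified Bessel function \<open>I_n\<close> at the argument \<open>2 z\<close>.\<close>
definition besselI :: "real \<Rightarrow> real \<Rightarrow> real" where
  "besselI n z = z powr n * bseries n (z\<^sup>2)"

lemma besselI_nonneg: "n \<ge> 0 \<Longrightarrow> 0 \<le> besselI n z"
  by (simp add: besselI_def bseries_nonneg)

lemma besselI_le:
  assumes "n \<ge> 0" "M > 0" "z > 0"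
  shows "besselI n z \<le> exp M * (z / M) powr n * exp (z\<^sup>2 / M)"
proof -
  have "besselI n z \<le> z powr n * (exp M * M powr (- n) * exp (z\<^sup>2 / M))"
    unfolding besselI_def using assms by (intro mult_left_mono bseries_le) auto
  also have "\<dots> = exp M * (z / M) powr n * exp (z\<^sup>2 / M)"
    using assms by (simp add: powr_divide powr_minus field_simps)
  finally show ?thesis .
qed

lemma besselI_le':
  assumes "n \<ge> 0" "z > 0"
  shows "besselI n z \<le> exp (3 * z + 1) * (1 / 2) powr n"
proof -
  \<comment> \<open>This choice gives \<open>z / ?M <= 1/2\<close> and \<open>z^2 / ?M <= z\<close>
    at the same time; the two exponentials combine to \<open>exp (3 * z + 1)\<close>.\<close>
  let ?M = "2 * z + 1"
  have "besselI n z \<le> exp ?M * (z / ?M) powr n * exp (z\<^sup>2 / ?M)"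
    using assms by (intro besselI_le) auto
  also have "\<dots> \<le> exp ?M * (1 / 2) powr n * exp z"
    using assms by (intro mult_mono mult_left_mono powr_mono2) (auto simp: field_simps power2_eq_square)
  also have "\<dots> = exp (3 * z + 1) * (1 / 2) powr n"
    by (simp add: mult_exp_exp mult.commute mult.left_commute flip: exp_add)
  finally show ?thesis .
qed

lemma continuous_on_besselI: "n \<ge> 0 \<Longrightarrow> continuous_on {0<..} (besselI n)"
proof -
  assume n: "n \<ge> 0"
  have "continuous_on UNIV (bseries n)" using isCont_bseries[OF n] by (intro continuous_at_imp_continuous_on) auto
  hence "continuous_on {0<..} (\<lambda>z. bseries n (z\<^sup>2))"
    by (rule continuous_on_compose2) (auto intro!: continuous_intros)
  thus "continuous_on {0<..} (besselI n)"
    unfolding besselI_def[abs_def] by (intro continuous_intros) auto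
qed

section \<open>Summation over the angular modes\<close>

abbreviation nuj :: "real \<Rightarrow> nat \<Rightarrow> real" where
  "nuj \<alpha> j \<equiv> nu \<alpha> (int_decode j)"

abbreviation phase :: "complex \<Rightarrow> complex \<Rightarrow> nat \<Rightarrow> complex" where
  "phase x y j \<equiv> ang (int_decode j) x * ang (- int_decode j) y"

definition mode_wt :: "real \<Rightarrow> nat \<Rightarrow> real" where
  "mode_wt \<alpha> j = (1 / 2) powr nuj \<alpha> j"

text \<open>The enumeration runs \<open>0, -1, 1, -2, 2, ...\<close>, so the integer at index
  \<open>j\<close> has modulus at least \<open>j / 2\<close>; adding \<open>\<alpha>\<close> costs
  at most \<open>1/2\<close>.\<close>

lemma nu_decode_ge:
  assumes "\<bar>\<alpha>\<bar> \<le> 1 / 2"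
  shows "nuj \<alpha> j \<ge> (real j - 1) / 2"
proof -
  have "j = int_encode (int_decode j)" by simp
  also have "\<dots> \<le> nat (2 * \<bar>int_decode j\<bar>)" by (auto simp: int_encode_def sum_encode_def)
  finally have "real j \<le> 2 * \<bar>real_of_int (int_decode j)\<bar>" by linarith
  moreover have "\<bar>real_of_int (int_decode j)\<bar> \<le> \<bar>real_of_int (int_decode j) + \<alpha>\<bar> + \<bar>\<alpha>\<bar>"
    using abs_triangle_ineq4[of "real_of_int (int_decode j) + \<alpha>" \<alpha>] by simp
  moreover have "J - 1 \<le> 2 * b" if "J \<le> 2 * a" "a \<le> b + d" "d \<le> 1 / 2" for J a b d :: real
    using that by simp
  ultimately have "real j - 1 \<le> 2 * nuj \<alpha> j" unfolding nu_def using assms by blast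
  thus ?thesis by simp
qed

lemma mode_wt_summable:
  assumes "\<bar>\<alpha>\<bar> \<le> 1 / 2"
  shows "summable (mode_wt \<alpha>)"
proof (rule summable_comparison_test')
  let ?q = "(1 / 2) powr (1 / 2) :: real"
  have "?q < 1 powr (1 / 2)" by (intro powr_less_mono2) auto
  hence "?q < 1" by simp
  thus "summable (\<lambda>j. (1 / 2) powr (- 1 / 2) * ?q ^ j)"
    by (intro summable_mult summable_geometric) simp
  fix j :: nat
  have "mode_wt \<alpha> j \<le> (1 / 2) powr ((real j - 1) / 2)"
    unfolding mode_wt_def using nu_decode_ge[OF assms, of j] by (intro powr_mono') auto
  also have "(real j - 1) / 2 = - 1 / 2 + real j * (1 / 2)" by (simp add: field_simps)
  also have "(1 / 2) powr (- 1 / 2 + real j * (1 / 2)) = (1 / 2) powr (- 1 / 2) * ?q ^ j"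
    by (subst powr_add) (simp add: powr_power)
  finally show "norm (mode_wt \<alpha> j) \<le> (1 / 2) powr (- 1 / 2) * ?q ^ j" by (simp add: mode_wt_def)
qed

lemma mode_wt_nonneg: "0 \<le> mode_wt \<alpha> j" by (simp add: mode_wt_def)

lemma mode_summable:
  assumes "\<bar>\<alpha>\<bar> \<le> 1 / 2" "z > 0" "\<And>j. cmod (A j) \<le> 1"
  shows "summable (\<lambda>j. complex_of_real (besselI (nuj \<alpha> j) z) * A j)"
proof (rule summable_comparison_test')
  show "summable (\<lambda>j. exp (3 * z + 1) * mode_wt \<alpha> j)" by (intro summable_mult mode_wt_summable assms)
  fix j
  have "cmod (complex_of_real (besselI (nuj \<alpha> j) z) * A j) \<le> besselI (nuj \<alpha> j) z * 1"
    unfolding norm_mult norm_of_real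
    using besselI_nonneg[OF nu_nonneg, of \<alpha> "int_decode j" z] by (intro mult_mono assms(3)) auto
  also have "\<dots> \<le> exp (3 * z + 1) * mode_wt \<alpha> j"
    unfolding mode_wt_def using assms(2) by (simp add: besselI_le')
  finally show "norm (complex_of_real (besselI (nuj \<alpha> j) z) * A j) \<le> exp (3 * z + 1) * mode_wt \<alpha> j" .
qed

lemma norm_ang_mult_le: "cmod (ang m x * ang k y) \<le> 1"
  unfolding norm_mult using mult_mono[OF norm_ang_le[of m x] norm_ang_le[of k y]] by simp

text \<open>The Weierstrass test on punctured discs, where \<open>exp (3 * z + 1)\<close> is bounded
  and the weights \<open>mode_wt\<close> are summable. General coefficients \<open>A\<close> and
  indices \<open>k\<close> let one statement cover either variable of the kernel.\<close>

lemma continuous_on_mode_series: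
  assumes "\<bar>\<alpha>\<bar> \<le> 1 / 2" "c > 0" "\<And>j. cmod (A j) \<le> 1"
  shows "continuous_on (- {0}) (\<lambda>y. \<Sum>j. of_real (besselI (nuj \<alpha> j) (c * cmod y)) * (A j * ang (k j) y))"
    (is "continuous_on _ ?S")
proof -
  have "isCont ?S y" if y: "y \<noteq> 0" for y
  proof -
    define R where "R = cmod y + 1"
    let ?U = "ball 0 R - {0::complex}"
    have "uniform_limit ?U (\<lambda>n y. \<Sum>j<n. of_real (besselI (nuj \<alpha> j) (c * cmod y)) * (A j * ang (k j) y)) ?S sequentially"
    proof (rule Weierstrass_m_test)
      show "summable (\<lambda>j. exp (3 * (c * R) + 1) * mode_wt \<alpha> j)" by (intro summable_mult mode_wt_summable assms)
      fix j y assume y: "y \<in> ?U"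
      have "cmod (of_real (besselI (nuj \<alpha> j) (c * cmod y)) * (A j * ang (k j) y)) \<le> besselI (nuj \<alpha> j) (c * cmod y) * (1 * 1)"
        unfolding norm_mult norm_of_real
        using besselI_nonneg[OF nu_nonneg, of \<alpha> "int_decode j" "c * cmod y"] by (intro mult_mono norm_ang_le assms(3)) auto
      also have "\<dots> \<le> exp (3 * (c * cmod y) + 1) * mode_wt \<alpha> j"
        unfolding mode_wt_def using y assms by (simp add: besselI_le')
      also have "\<dots> \<le> exp (3 * (c * R) + 1) * mode_wt \<alpha> j"
        using y assms by (intro mult_right_mono mode_wt_nonneg) auto
      finally show "norm (of_real (besselI (nuj \<alpha> j) (c * cmod y)) * (A j * ang (k j) y)) \<le> exp (3 * (c * R) + 1) * mode_wt \<alpha> j" .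
    qed
    hence "continuous_on ?U ?S"
    proof (rule uniform_limit_theorem[rotated])
      have "continuous_on ?U (\<lambda>y. \<Sum>j<n. of_real (besselI (nuj \<alpha> j) (c * cmod y)) * (A j * ang (k j) y))" for n
        using assms(2)
        by (intro continuous_intros continuous_on_subset[OF continuous_on_ang] continuous_on_compose2[OF continuous_on_besselI[OF nu_nonneg]]) (auto simp: zero_less_mult_iff)
      thus "\<forall>\<^sub>F n in sequentially. continuous_on ?U (\<lambda>y. \<Sum>j<n. of_real (besselI (nuj \<alpha> j) (c * cmod y)) * (A j * ang (k j) y))" by simp
    qed simp
    moreover have "open ?U" "y \<in> ?U" using y by (auto simp: R_def)
    ultimately show ?thesis using continuous_on_eq_continuous_at by blast
  qed
  thus ?thesis by (intro continuous_at_imp_continuous_on) auto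
qed

text \<open>The sum over all integers is a series over \<open>nat\<close> via \<open>int_decode\<close>.\<close>
definition AB_kernel :: "real \<Rightarrow> real \<Rightarrow> complex \<Rightarrow> complex \<Rightarrow> complex" where
  "AB_kernel \<alpha> t x y = of_real (exp (- ((cmod x)\<^sup>2 + (cmod y)\<^sup>2) / (4 * t)) / (4 * pi * t)) *
     (\<Sum>j. of_real (besselI (nuj \<alpha> j) (cmod x * cmod y / (4 * t))) * phase x y j)"

lemma continuous_on_AB_kernel_right:
  assumes "\<bar>\<alpha>\<bar> \<le> 1 / 2" "t > 0" "x \<noteq> 0"
  shows "continuous_on (- {0}) (\<lambda>y. AB_kernel \<alpha> t x y)"
proof -
  have "continuous_on (- {0}) (\<lambda>y. \<Sum>j. of_real (besselI (nuj \<alpha> j) (cmod x / (4 * t) * cmod y)) * phase x y j)"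
    using assms by (intro continuous_on_mode_series norm_ang_le) auto
  thus ?thesis unfolding AB_kernel_def using assms by (intro continuous_intros) (auto simp: mult.commute)
qed

lemma continuous_on_AB_kernel_left:
  assumes "\<bar>\<alpha>\<bar> \<le> 1 / 2" "t > 0" "y \<noteq> 0"
  shows "continuous_on (- {0}) (\<lambda>x. AB_kernel \<alpha> t x y)"
proof -
  have "continuous_on (- {0}) (\<lambda>x. \<Sum>j. of_real (besselI (nuj \<alpha> j) (cmod y / (4 * t) * cmod x)) * (ang (- int_decode j) y * ang (int_decode j) x))"
    using assms by (intro continuous_on_mode_series norm_ang_le) auto
  thus ?thesis unfolding AB_kernel_def using assms by (intro continuous_intros) (auto simp: mult.commute)
qed

section \<open>Integrals of the kernel against Gaussian modes\<close>

lemma integral_dominated_series: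
  fixes f :: "nat \<Rightarrow> complex \<Rightarrow> complex"
  assumes f: "\<And>k. integrable lborel (f k)" and w: "integrable lborel w"
    and S: "\<And>y. (\<lambda>k. f k y) sums S y" and b: "\<And>K y. cmod (\<Sum>k<K. f k y) \<le> w y"
  shows "integrable lborel S" "(\<lambda>k. \<integral>y. f k y \<partial>lborel) sums (\<integral>y. S y \<partial>lborel)"
proof -
  have lim: "AE y in lborel. (\<lambda>K. \<Sum>k<K. f k y) \<longlonglongrightarrow> S y" using S by (auto simp: sums_def)
  have m: "(\<lambda>y. \<Sum>k<K. f k y) \<in> borel_measurable lborel" for K using f by auto
  have Sm: "S \<in> borel_measurable lborel"
    by (rule borel_measurable_LIMSEQ_metric[OF m]) (use S in \<open>simp add: sums_def\<close>)
  show "integrable lborel S"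
    by (rule integrable_dominated_convergence[OF Sm m w lim]) (use b in auto)
  have "(\<lambda>K. \<integral>y. (\<Sum>k<K. f k y) \<partial>lborel) \<longlonglongrightarrow> (\<integral>y. S y \<partial>lborel)"
    by (rule integral_dominated_convergence[OF Sm m w lim]) (use b in auto)
  thus "(\<lambda>k. \<integral>y. f k y \<partial>lborel) sums (\<integral>y. S y \<partial>lborel)"
    unfolding sums_def using f by simp
qed

lemma gauss_integrable:
  assumes "B > 0" "s > -2"
  shows "integrable lborel (gauss s B l)"
  by (rule Bochner_Integration.integrable_bound[OF integrable_gaussian_moment[OF assms]])
    (use norm_gauss_le in auto)

lemma integral_gauss_0:
  assumes "B > 0" "s > -2"
  shows "(\<integral>y. gauss s B 0 y \<partial>lborel) = of_real (pi * Gamma (s/2 + 1) / B powr (s/2 + 1))"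
proof -
  have "(\<integral>y. gauss s B 0 y \<partial>lborel) = (\<integral>y. of_real (cmod y powr s * exp (- B * (cmod y)\<^sup>2)) \<partial>lborel)"
  proof (rule integral_cong_AE)
    show "AE y in lborel. gauss s B 0 y = of_real (cmod y powr s * exp (- B * (cmod y)\<^sup>2))"
      using AE_lborel_singleton[of "0::complex"] by eventually_elim (simp add: gauss_def ang_def)
  qed auto
  also have "\<dots> = of_real (\<integral>y. cmod y powr s * exp (- B * (cmod y)\<^sup>2) \<partial>lborel)"
    by (rule integral_complex_of_real)
  also have "(\<integral>y. cmod y powr s * exp (- B * (cmod y)\<^sup>2) \<partial>lborel) = pi * Gamma (s/2 + 1) / B powr (s/2 + 1)"
    by (rule has_bochner_integral_integral_eq[OF has_bochner_integral_gaussian_moment[OF assms]])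
  finally show ?thesis .
qed

text \<open>For \<open>l\<close> nonzero the integrand is, up to the factor \<open>\<i> * l\<close>,
  an angular derivative. Integration by parts needs support off the origin, so logarithmic cutoffs
  are inserted and removed by dominated convergence.\<close>

lemma integral_gauss_nonzero:
  assumes "B > 0" "s > -2" "l \<noteq> 0"
  shows "(\<integral>y. gauss s B l y \<partial>lborel) = 0"
proof -
  define b where "b n y = complex_of_real (bump (1 / real (Suc n)) (ln (cmod y)))" for n and y :: complex
  have z: "(\<integral>y. b n y * gauss s B l y \<partial>lborel) = 0" for n
  proof -
    let ?e = "1 / real (Suc n)"
    \<comment> \<open>The exponent \<open>s + 2\<close> compensates the weight
      \<open>1 / |x|^2\<close> in \<open>integral_radial_angular_zero\<close>.\<close>
    let ?g = "\<lambda>\<tau>. complex_of_real (bump ?e \<tau>) * of_real (exp ((s + 2) * \<tau> - B * exp (2 * \<tau>)))"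
    have cs: "cs_smooth ?g" by (rule cs_smooth_mult(1)[OF cs_smooth_bump Ck_exp_exp])
    obtain g' where g': "\<And>\<tau>. (?g has_vector_derivative g' \<tau>) (at \<tau>)" "cs_smooth g'"
      using cs_smooth_deriv[OF cs] by blast
    have "Ck (Suc 0) g'" using g'(2) by (simp only: cs_smooth_def)
    then obtain g'' where "\<And>\<tau>. (g' has_vector_derivative g'' \<tau>) (at \<tau>)" by auto
    hence g'c: "continuous_on UNIV g'"
      by (intro continuous_at_imp_continuous_on ballI has_vector_derivative_continuous)
    note C = C1_off_0_lpol[OF g'(1) g'c, of l]
    from integral_radial_angular_zero(2)[OF lpol_sums_supp0[OF lpol_sums.lpol[OF cs, of l]] C, of \<i>]
    have z0: "(\<integral>x. (of_real (Re (\<i> * x / x)) * g' (ln (cmod x)) + \<i> * of_real (of_int l * Im (\<i> * x / x)) * ?g (ln (cmod x))) * ang l x / of_real ((cmod x)\<^sup>2) \<partial>lborel) = 0" .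
    have eq: "(of_real (Re (\<i> * x / x)) * g' (ln (cmod x)) + \<i> * of_real (of_int l * Im (\<i> * x / x)) * ?g (ln (cmod x))) * ang l x / of_real ((cmod x)\<^sup>2)
       = \<i> * of_int l * (b n x * gauss s B l x)" for x
    proof (cases "x = 0")
      case False
      have "exp ((s + 2) * ln (cmod x) - B * exp (2 * ln (cmod x))) = cmod x powr s * exp (- B * (cmod x)\<^sup>2) * (cmod x)\<^sup>2"
      proof -
        have "exp ((s + 2) * ln (cmod x)) = cmod x powr s * (cmod x)\<^sup>2"
          unfolding distrib_right exp_add exp_2_ln[OF False] using False by (simp add: powr_def)
        thus ?thesis using False by (simp add: exp_2_ln exp_diff exp_minus divide_inverse mult_ac)
      qed
      thus ?thesis using False by (simp add: b_def gauss_def mult_ac)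
    qed (simp add: gauss_def ang_def)
    have "\<i> * of_int l * (\<integral>x. b n x * gauss s B l x \<partial>lborel) = 0"
      using z0 unfolding eq integral_mult_right_zero .
    thus ?thesis using assms(3) by simp
  qed
  have "(\<lambda>n. \<integral>y. b n y * gauss s B l y \<partial>lborel) \<longlonglongrightarrow> (\<integral>y. gauss s B l y \<partial>lborel)"
  proof (rule integral_dominated_convergence[where w = "\<lambda>y. cmod (gauss s B l y)"])
    show "integrable lborel (\<lambda>y. cmod (gauss s B l y))" by (intro integrable_norm gauss_integrable assms)
    show "(\<lambda>y. b n y * gauss s B l y) \<in> borel_measurable lborel" for n unfolding b_def by measurable
    show "AE y in lborel. (\<lambda>n. b n y * gauss s B l y) \<longlonglongrightarrow> gauss s B l y"
    proof (rule AE_I2)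
      fix y
      have "(\<lambda>n. b n y * gauss s B l y) \<longlonglongrightarrow> of_real 1 * gauss s B l y"
        unfolding b_def by (intro tendsto_intros bump_tendsto_1)
      thus "(\<lambda>n. b n y * gauss s B l y) \<longlonglongrightarrow> gauss s B l y" by simp
    qed
    fix n
    show "AE y in lborel. norm (b n y * gauss s B l y) \<le> cmod (gauss s B l y)"
      using bump_nonneg bump_le_1 by (intro AE_I2) (simp add: norm_mult b_def mult_left_le_one_le)
  qed auto
  thus ?thesis unfolding z by (simp add: LIMSEQ_const_iff)
qed

context
  fixes \<alpha> t a :: real and x :: complex and m :: int
  assumes \<alpha>: "\<bar>\<alpha>\<bar> \<le> 1 / 2" and t: "t > 0" and a: "a > 0" and x: "x \<noteq> 0"
begin

text \<open>\<open>c * |y|\<close> is the Bessel argument, \<open>B\<close> is the joint Gaussian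
  rate of kernel and mode in \<open>y\<close>, and \<open>T j\<close> is the \<open>j\<close>-th
  term of the product. The prefactor depending only on \<open>x\<close> and \<open>t\<close> is
  restored in \<open>AB_kernel_gmode\<close>.\<close>

private definition "c = cmod x / (4 * t)"
private definition "B = a + 1 / (4 * t)"
private definition "T j y = complex_of_real (besselI (nuj \<alpha> j) (c * cmod y)) * phase x y j * gauss (nu \<alpha> m) B m y"
private definition "majorant y = exp (9 * c\<^sup>2 / (4 * a) + 1) * (cmod y powr nu \<alpha> m * exp (- (1 / (4 * t)) * (cmod y)\<^sup>2))"

private lemma c_pos: "c > 0" using x t by (simp add: c_def)
private lemma B_pos: "B > 0" using a t by (simp add: B_def add_pos_pos)

private lemma nu_gt: "nu \<alpha> k > -2" using nu_nonneg[of \<alpha> k] by linarith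

private lemma exponent_gt: "nu \<alpha> k + 2 * real i + nu \<alpha> l > -2"
  using nu_nonneg[of \<alpha> k] nu_nonneg[of \<alpha> l] by linarith

private lemma majorant_integrable: "integrable lborel majorant"
  unfolding majorant_def[abs_def] using t by (intro integrable_mult_right integrable_gaussian_moment nu_gt) auto

text \<open>Completing the square gives \<open>3 * c * r <= a * r^2 + 9 * c^2 / (4 * a)\<close>: the
  part \<open>a\<close> of \<open>B\<close> absorbs the growth of the Bessel bound, and the rate
  \<open>1 / (4 * t)\<close> remains for integrability.\<close>

private lemma exp_majorant: "exp (3 * (c * r) + 1) * exp (- B * r\<^sup>2) \<le> exp (9 * c\<^sup>2 / (4 * a) + 1) * exp (- (1 / (4 * t)) * r\<^sup>2)"
proof -
  have "0 \<le> (2 * a * r - 3 * c)\<^sup>2 / (4 * a)" using a by simp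
  also have "\<dots> = a * r\<^sup>2 - 3 * (c * r) + 9 * c\<^sup>2 / (4 * a)"
    using a by (simp add: field_simps power2_eq_square)
  finally have "3 * (c * r) + 1 + - B * r\<^sup>2 \<le> 9 * c\<^sup>2 / (4 * a) + 1 + - (1 / (4 * t)) * r\<^sup>2"
    by (simp add: B_def algebra_simps)
  thus ?thesis by (simp only: mult_exp_exp exp_le_cancel_iff)
qed

private lemma T_bound: "cmod (T j y) \<le> mode_wt \<alpha> j * majorant y"
proof (cases "y = 0")
  case True
  thus ?thesis by (simp add: T_def gauss_def ang_def majorant_def mode_wt_def)
next
  case False
  let ?b = "besselI (nuj \<alpha> j) (c * cmod y)"
  have b: "0 \<le> ?b" "?b \<le> exp (3 * (c * cmod y) + 1) * mode_wt \<alpha> j"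
    unfolding mode_wt_def using False c_pos by (auto intro!: besselI_nonneg besselI_le')
  have "cmod (T j y) \<le> ?b * (1 * 1) * (cmod y powr nu \<alpha> m * exp (- B * (cmod y)\<^sup>2))"
    unfolding T_def norm_mult norm_of_real using b by (intro mult_mono norm_ang_le norm_gauss_le) auto
  also have "\<dots> \<le> exp (3 * (c * cmod y) + 1) * mode_wt \<alpha> j * (cmod y powr nu \<alpha> m * exp (- B * (cmod y)\<^sup>2))"
    using b by (intro mult_right_mono) auto
  also have "\<dots> = mode_wt \<alpha> j * (cmod y powr nu \<alpha> m * (exp (3 * (c * cmod y) + 1) * exp (- B * (cmod y)\<^sup>2)))" by (simp add: mult_ac)
  also have "\<dots> \<le> mode_wt \<alpha> j * (cmod y powr nu \<alpha> m * (exp (9 * c\<^sup>2 / (4 * a) + 1) * exp (- (1 / (4 * t)) * (cmod y)\<^sup>2)))"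
    by (intro mult_left_mono exp_majorant mode_wt_nonneg) auto
  finally show ?thesis by (simp add: majorant_def mult_ac)
qed

text \<open>Expanding the Bessel function in \<open>T j\<close> as a power series makes every term a
  constant times one \<open>gauss\<close> function, whose integral is known. The angular indices of
  kernel and mode combine to \<open>m - int_decode j\<close>.\<close>

private definition "cf j k = complex_of_real (bcoeff (nuj \<alpha> j) k * (c powr nuj \<alpha> j * (c\<^sup>2) ^ k)) * ang (int_decode j) x"
private definition "Tk j k y = cf j k * gauss (nuj \<alpha> j + 2 * real k + nu \<alpha> m) B (m - int_decode j) y"

private lemma Tk_eq:
  "Tk j k y = complex_of_real ((c * cmod y) powr nuj \<alpha> j * (bcoeff (nuj \<alpha> j) k * ((c * cmod y)\<^sup>2) ^ k))
     * phase x y j * gauss (nu \<alpha> m) B m y"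
proof (cases "y = 0")
  case True
  thus ?thesis by (simp add: Tk_def gauss_def ang_def)
next
  case False
  have "cmod y powr (2 * real k) = ((cmod y)\<^sup>2) ^ k"
    using False powr_realpow[of "cmod y" "2 * k"] by (simp add: power_mult)
  hence "cmod y powr (nuj \<alpha> j + 2 * real k + nu \<alpha> m) = cmod y powr nuj \<alpha> j * ((cmod y)\<^sup>2) ^ k * cmod y powr nu \<alpha> m"
    by (simp add: powr_add)
  moreover have "ang (m - int_decode j) y = ang (- int_decode j) y * ang m y" by (simp add: ang_mult)
  moreover have "(c * cmod y) powr nuj \<alpha> j = c powr nuj \<alpha> j * cmod y powr nuj \<alpha> j"
    by (simp add: powr_mult)
  ultimately show ?thesis
    unfolding Tk_def cf_def gauss_def by (simp add: power_mult_distrib mult_ac)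
qed

private lemma Tk_sums: "(\<lambda>k. Tk j k y) sums T j y"
proof -
  have "(\<lambda>k. bcoeff (nuj \<alpha> j) k * ((c * cmod y)\<^sup>2) ^ k) sums bseries (nuj \<alpha> j) ((c * cmod y)\<^sup>2)"
    unfolding bseries_def by (intro summable_sums bcoeff_summable) simp
  hence "(\<lambda>k. (c * cmod y) powr nuj \<alpha> j * (bcoeff (nuj \<alpha> j) k * ((c * cmod y)\<^sup>2) ^ k)) sums besselI (nuj \<alpha> j) (c * cmod y)"
    unfolding besselI_def by (rule sums_mult)
  hence "(\<lambda>k. complex_of_real ((c * cmod y) powr nuj \<alpha> j * (bcoeff (nuj \<alpha> j) k * ((c * cmod y)\<^sup>2) ^ k))) sums complex_of_real (besselI (nuj \<alpha> j) (c * cmod y))"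
    by (rule sums_of_real)
  from sums_mult2[OF sums_mult2[OF this]] show ?thesis unfolding Tk_eq T_def .
qed

text \<open>For fixed \<open>y\<close> all terms share one complex factor and have nonnegative
  coefficients, so no partial sum exceeds the full sum \<open>T j\<close> in modulus.\<close>

private lemma Tk_partial: "cmod (\<Sum>k<K. Tk j k y) \<le> mode_wt \<alpha> j * majorant y"
proof (cases "y = 0")
  case True
  thus ?thesis by (simp add: Tk_def gauss_def ang_def majorant_def mode_wt_def)
next
  case False
  let ?n = "nuj \<alpha> j" and ?z = "c * cmod y"
  have "(\<Sum>k<K. Tk j k y) = complex_of_real (?z powr ?n * (\<Sum>k<K. bcoeff ?n k * (?z\<^sup>2) ^ k)) * phase x y j * gauss (nu \<alpha> m) B m y"
    unfolding Tk_eq by (simp add: sum_distrib_left sum_distrib_right)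
  hence "cmod (\<Sum>k<K. Tk j k y) = (?z powr ?n * \<bar>\<Sum>k<K. bcoeff ?n k * (?z\<^sup>2) ^ k\<bar>) * cmod (ang (int_decode j) x * ang (- int_decode j) y * gauss (nu \<alpha> m) B m y)"
    by (simp only: norm_mult norm_of_real abs_mult abs_of_nonneg[OF powr_ge_zero] mult.assoc)
  also have "\<bar>\<Sum>k<K. bcoeff ?n k * (?z\<^sup>2) ^ k\<bar> = (\<Sum>k<K. bcoeff ?n k * (?z\<^sup>2) ^ k)"
    by (intro abs_of_nonneg sum_nonneg bcoeff_term_nonneg) auto
  also have "(?z powr ?n * (\<Sum>k<K. bcoeff ?n k * (?z\<^sup>2) ^ k)) * cmod (ang (int_decode j) x * ang (- int_decode j) y * gauss (nu \<alpha> m) B m y)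
     \<le> (?z powr ?n * bseries ?n (?z\<^sup>2)) * cmod (ang (int_decode j) x * ang (- int_decode j) y * gauss (nu \<alpha> m) B m y)"
    by (intro mult_right_mono mult_left_mono bseries_partial_le) auto
  also have "\<dots> = cmod (T j y)"
    unfolding T_def norm_mult norm_of_real besselI_def[symmetric] abs_of_nonneg[OF besselI_nonneg[OF nu_nonneg]]
    by (simp only: mult.assoc)
  also have "\<dots> \<le> mode_wt \<alpha> j * majorant y" by (rule T_bound)
  finally show ?thesis .
qed

private lemma Tk_integrable: "integrable lborel (Tk j k)"
  unfolding Tk_def[abs_def] by (intro integrable_mult_right gauss_integrable B_pos exponent_gt)

private lemma T_integral:
  "integrable lborel (T j)"
  "(\<lambda>k. \<integral>y. Tk j k y \<partial>lborel) sums (\<integral>y. T j y \<partial>lborel)"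
  using integral_dominated_series[OF Tk_integrable integrable_mult_right[OF majorant_integrable] Tk_sums Tk_partial] by auto

private lemma T_integral_0:
  assumes "int_decode j \<noteq> m"
  shows "(\<integral>y. T j y \<partial>lborel) = 0"
proof -
  have "(\<integral>y. Tk j k y \<partial>lborel) = 0" for k
    unfolding Tk_def integral_mult_right_zero
    using integral_gauss_nonzero[OF B_pos exponent_gt, of "m - int_decode j"] assms by simp
  thus ?thesis using T_integral(2)[of j] by (simp add: sums_iff)
qed

text \<open>The moment of the \<open>k\<close>-th term carries \<open>Gamma (k + nu + 1)\<close>,
  which is the Gamma factor in the denominator of \<open>bcoeff\<close>. What is left is the
  exponential series of \<open>c^2 / B\<close>.\<close>

private lemma T_integral_m:
  "(\<integral>y. T (int_encode m) y \<partial>lborel) = of_real (pi * c powr nu \<alpha> m / B powr (nu \<alpha> m + 1) * exp (c\<^sup>2 / B)) * ang m x"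
proof -
  let ?n = "nu \<alpha> m"
  have "(\<integral>y. Tk (int_encode m) k y \<partial>lborel) = of_real (pi * c powr ?n / B powr (?n + 1)) * ang m x * of_real ((c\<^sup>2 / B) ^ k / fact k)" for k
  proof -
    have s: "(?n + 2 * real k + ?n) / 2 + 1 = real k + ?n + 1" by simp
    have "(\<integral>y. Tk (int_encode m) k y \<partial>lborel) = cf (int_encode m) k * of_real (pi * Gamma (real k + ?n + 1) / B powr (real k + ?n + 1))"
      unfolding Tk_def integral_mult_right_zero
      using integral_gauss_0[OF B_pos exponent_gt[of m k m], unfolded s] by simp
    also have "\<dots> = of_real (bcoeff ?n k * (c powr ?n * (c\<^sup>2) ^ k) * (pi * Gamma (real k + ?n + 1) / B powr (real k + ?n + 1))) * ang m x"
      by (simp add: cf_def)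
    also have "bcoeff ?n k * (c powr ?n * (c\<^sup>2) ^ k) * (pi * Gamma (real k + ?n + 1) / B powr (real k + ?n + 1)) = pi * c powr ?n / B powr (?n + 1) * ((c\<^sup>2 / B) ^ k / fact k)"
    proof -
      have "Gamma (real k + ?n + 1) > 0" using nu_nonneg[of \<alpha> m] by (intro Gamma_real_pos) (simp add: add_nonneg_pos)
      moreover have "B powr (real k + ?n + 1) = B ^ k * B powr (?n + 1)"
        using B_pos by (simp add: powr_add powr_realpow)
      ultimately show ?thesis using B_pos by (simp add: bcoeff_def power_divide mult_ac)
    qed
    finally show ?thesis by (simp add: mult_ac)
  qed
  with T_integral(2)[of "int_encode m"]
  have "(\<lambda>k. of_real (pi * c powr ?n / B powr (?n + 1)) * ang m x * of_real ((c\<^sup>2 / B) ^ k / fact k)) sums (\<integral>y. T (int_encode m) y \<partial>lborel)"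
    by simp
  moreover have "(\<lambda>k. of_real (pi * c powr ?n / B powr (?n + 1)) * ang m x * of_real ((c\<^sup>2 / B) ^ k / fact k)) sums (of_real (pi * c powr ?n / B powr (?n + 1)) * ang m x * of_real (exp (c\<^sup>2 / B)))"
    by (intro sums_mult sums_of_real exp_series_sums)
  ultimately have "(\<integral>y. T (int_encode m) y \<partial>lborel) = of_real (pi * c powr ?n / B powr (?n + 1)) * ang m x * of_real (exp (c\<^sup>2 / B))"
    by (rule sums_unique2)
  thus ?thesis by (simp add: mult_ac)
qed

text \<open>The summable weights \<open>mode_wt\<close> permit integration term by term over
  \<open>j\<close>; by angular orthogonality only \<open>j = int_encode m\<close>
  contributes.\<close>

private lemma T_series:
  shows "integrable lborel (\<lambda>y. \<Sum>j. T j y)"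
    "(\<integral>y. (\<Sum>j. T j y) \<partial>lborel) = of_real (pi * c powr nu \<alpha> m / B powr (nu \<alpha> m + 1) * exp (c\<^sup>2 / B)) * ang m x"
proof -
  have S: "(\<lambda>j. T j y) sums (\<Sum>j. T j y)" for y
    by (rule summable_sums, rule summable_comparison_test'[where g = "\<lambda>j. mode_wt \<alpha> j * majorant y"])
      (auto intro!: summable_mult2 mode_wt_summable \<alpha> T_bound)
  have d0: "0 \<le> majorant y" for y by (simp add: majorant_def)
  have b: "cmod (\<Sum>j<K. T j y) \<le> (\<Sum>j. mode_wt \<alpha> j) * majorant y" for K y
  proof -
    have "cmod (\<Sum>j<K. T j y) \<le> (\<Sum>j<K. mode_wt \<alpha> j * majorant y)" by (intro sum_norm_le T_bound)
    also have "\<dots> = (\<Sum>j<K. mode_wt \<alpha> j) * majorant y" by (simp add: sum_distrib_right)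
    also have "\<dots> \<le> (\<Sum>j. mode_wt \<alpha> j) * majorant y"
      by (intro mult_right_mono sum_le_suminf mode_wt_summable \<alpha> d0) (auto simp: mode_wt_nonneg)
    finally show ?thesis .
  qed
  note I = integral_dominated_series[OF T_integral(1) integrable_mult_right[OF majorant_integrable] S b]
  show "integrable lborel (\<lambda>y. \<Sum>j. T j y)" by (rule I(1))
  have "(\<lambda>j. \<integral>y. T j y \<partial>lborel) sums (\<Sum>j\<in>{int_encode m}. \<integral>y. T j y \<partial>lborel)"
  proof (rule sums_finite)
    fix j assume "j \<notin> {int_encode m}"
    hence "int_decode j \<noteq> m" by (metis int_decode_inverse singletonI)
    thus "(\<integral>y. T j y \<partial>lborel) = 0" by (rule T_integral_0)
  qed simp
  from sums_unique2[OF I(2) this] show "(\<integral>y. (\<Sum>j. T j y) \<partial>lborel) = of_real (pi * c powr nu \<alpha> m / B powr (nu \<alpha> m + 1) * exp (c\<^sup>2 / B)) * ang m x"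
    by (simp only: T_integral_m sum.insert[OF finite.emptyI] sum.empty add_0_right empty_iff not_False_eq_True)
qed

lemma AB_kernel_gmode:
  shows "integrable lborel (\<lambda>y. AB_kernel \<alpha> t x y * gmode \<alpha> m 1 a y)"
    "(\<integral>y. AB_kernel \<alpha> t x y * gmode \<alpha> m 1 a y \<partial>lborel) = hmode \<alpha> m a t x"
proof -
  let ?n = "nu \<alpha> m"
  let ?C = "exp (- (cmod x)\<^sup>2 / (4 * t)) / (4 * pi * t)"
  have eq: "AB_kernel \<alpha> t x y * gmode \<alpha> m 1 a y = of_real ?C * (\<Sum>j. T j y)" for y
  proof -
    let ?U = "\<lambda>j. complex_of_real (besselI (nuj \<alpha> j) (c * cmod y)) * phase x y j"
    have "summable ?U"
    proof (cases "y = 0")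
      case True
      thus ?thesis by (simp add: ang_def)
    next
      case False
      show ?thesis using False c_pos by (intro mode_summable \<alpha> norm_ang_mult_le) auto
    qed
    hence "(\<Sum>j. T j y) = (\<Sum>j. ?U j) * gauss ?n B m y" unfolding T_def by (rule suminf_mult2[symmetric])
    moreover have "AB_kernel \<alpha> t x y = of_real (?C * exp (- (cmod y)\<^sup>2 / (4 * t))) * (\<Sum>j. ?U j)"
    proof -
      have "- ((cmod x)\<^sup>2 + (cmod y)\<^sup>2) / (4 * t) = - (cmod x)\<^sup>2 / (4 * t) + - (cmod y)\<^sup>2 / (4 * t)"
        by (simp only: minus_add_distrib add_divide_distrib)
      hence "exp (- ((cmod x)\<^sup>2 + (cmod y)\<^sup>2) / (4 * t)) / (4 * pi * t) = ?C * exp (- (cmod y)\<^sup>2 / (4 * t))"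
        by (simp only: exp_add times_divide_eq_left)
      moreover have "cmod x * cmod y / (4 * t) = c * cmod y" by (simp add: c_def)
      ultimately show ?thesis unfolding AB_kernel_def by (simp only:)
    qed
    moreover have "of_real (exp (- (cmod y)\<^sup>2 / (4 * t))) * gmode \<alpha> m 1 a y = gauss ?n B m y"
    proof -
      have "exp (- (cmod y)\<^sup>2 / (4 * t)) * exp (- a * (cmod y)\<^sup>2) = exp (- B * (cmod y)\<^sup>2)"
        by (simp add: mult_exp_exp B_def algebra_simps)
      thus ?thesis unfolding gmode_eq_gauss gauss_def by (simp add: mult_ac flip: of_real_mult)
    qed
    ultimately show ?thesis by (simp add: mult_ac)
  qed
  show "integrable lborel (\<lambda>y. AB_kernel \<alpha> t x y * gmode \<alpha> m 1 a y)"
    unfolding eq by (intro integrable_mult_right T_series)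
  have D: "hwidth a t = 4 * t * B" "hwidth a t > 0" using t a by (simp_all add: hwidth_def B_def field_simps add_pos_pos)
  have "(\<integral>y. AB_kernel \<alpha> t x y * gmode \<alpha> m 1 a y \<partial>lborel) = of_real (?C * (pi * c powr ?n / B powr (?n + 1) * exp (c\<^sup>2 / B))) * ang m x"
    unfolding eq integral_mult_right_zero T_series(2) by simp
  also have "?C * (pi * c powr ?n / B powr (?n + 1) * exp (c\<^sup>2 / B)) = hrad ?n a (cmod x) t"
  proof -
    \<comment> \<open>The exponents match because \<open>hwidth a t - 1 = 4 * a * t\<close>, so
      \<open>(1 - 1 / hwidth a t) / (4 * t) = a / hwidth a t\<close>.\<close>
    have 1: "exp (- (cmod x)\<^sup>2 / (4 * t)) * exp (c\<^sup>2 / B) = exp (- (a / hwidth a t) * (cmod x)\<^sup>2)"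
    proof -
      have "c\<^sup>2 / B = (cmod x)\<^sup>2 / (4 * t * hwidth a t)"
        unfolding D(1) using t B_pos by (simp add: c_def field_simps power2_eq_square)
      moreover have "- (cmod x)\<^sup>2 / (4 * t) + (cmod x)\<^sup>2 / (4 * t * hwidth a t) = - (a / hwidth a t) * (cmod x)\<^sup>2"
        using t D(2) by (simp add: field_simps) (simp add: hwidth_def algebra_simps)
      ultimately show ?thesis by (simp only: mult_exp_exp)
    qed
    have 2: "c powr ?n = cmod x powr ?n / (4 * t) powr ?n"
      unfolding c_def using t by (simp add: powr_divide)
    have 3: "hwidth a t powr (- 1 - ?n) = 1 / ((4 * t) powr (?n + 1) * B powr (?n + 1))"
    proof -
      have "hwidth a t powr (- 1 - ?n) = 1 / hwidth a t powr (?n + 1)"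
        using powr_minus_divide[of "hwidth a t" "?n + 1"] by (simp add: add.commute)
      also have "hwidth a t powr (?n + 1) = (4 * t) powr (?n + 1) * B powr (?n + 1)"
        unfolding D(1) using t B_pos by (simp add: powr_mult)
      finally show ?thesis .
    qed
    have 4: "(4 * t) powr (?n + 1) = (4 * t) powr ?n * (4 * t)" using t by (simp add: powr_add)
    have "?C * (pi * c powr ?n / B powr (?n + 1) * exp (c\<^sup>2 / B)) = (exp (- (cmod x)\<^sup>2 / (4 * t)) * exp (c\<^sup>2 / B)) * (c powr ?n / (B powr (?n + 1) * (4 * t)))"
      by (simp add: mult_ac)
    also have "\<dots> = hrad ?n a (cmod x) t"
      unfolding 1 2 hrad_def 3 4 by (simp add: mult_ac)
    finally show ?thesis .
  qed
  finally show "(\<integral>y. AB_kernel \<alpha> t x y * gmode \<alpha> m 1 a y \<partial>lborel) = hmode \<alpha> m a t x" by (simp add: hmode_eq)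
qed

end

section \<open>Identification of the kernel and asymptotics\<close>

text \<open>A heat solution is determined only up to null sets in \<open>x\<close>. For almost every
  \<open>x\<close> the two kernels have equal integrals against all modes, and
  \<open>gmode_total\<close> gives equality in \<open>y\<close>; continuity in \<open>x\<close> then
  removes the exceptional points.\<close>

theorem heat_kernel_eq_AB_kernel:
  assumes \<alpha>: "\<bar>\<alpha>\<bar> \<le> 1 / 2" and p: "AB_heat_kernel \<alpha> p" and t: "t > 0" and "x \<noteq> 0" "y \<noteq> 0"
  shows "p t x y = AB_kernel \<alpha> t x y"
proof -
  have pc: "continuous_on {(x, y). x \<noteq> 0 \<and> y \<noteq> 0} (\<lambda>(x, y). p t x y)"
    using p t by (auto simp: AB_heat_kernel_def)
  have pc1: "continuous_on (- {0}) (\<lambda>y. p t x y)" if "x \<noteq> 0" for x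
  proof -
    have "continuous_on (- {0}) (\<lambda>y. (x, y))" by (intro continuous_intros)
    from continuous_on_compose2[OF pc this] show ?thesis using that by auto
  qed
  have pc2: "continuous_on (- {0}) (\<lambda>x. p t x y)"
  proof -
    have "continuous_on (- {0}) (\<lambda>x. (x, y))" by (intro continuous_intros)
    from continuous_on_compose2[OF pc this] show ?thesis using \<open>y \<noteq> 0\<close> by auto
  qed
  have gL: "gmode \<alpha> m 1 (1 + real k) \<in> L2" for m and k :: nat by (intro gmode_L2) simp
  have "AE x in lborel. (\<integral>y. p t x y * gmode \<alpha> m 1 (1 + real k) y \<partial>lborel) = hmode \<alpha> m (1 + real k) t x" for m and k :: nat
  proof (rule heat_solution_gmode_unique[where u = "\<lambda>t x. \<integral>y. p t x y * gmode \<alpha> m 1 (1 + real k) y \<partial>lborel"])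
    show "heat_solution \<alpha> (gmode \<alpha> m 1 (1 + real k)) (\<lambda>t x. \<integral>y. p t x y * gmode \<alpha> m 1 (1 + real k) y \<partial>lborel)"
      using p gL[of m k] unfolding AB_heat_kernel_def by blast
  qed (use t in simp_all)
  \<comment> \<open>The null set depends on the mode, but \<open>m\<close> and \<open>k\<close>
    range over countable types, so one null set serves all modes.\<close>
  hence ae: "AE x in lborel. \<forall>m. \<forall>k::nat. (\<integral>y. p t x y * gmode \<alpha> m 1 (1 + real k) y \<partial>lborel) = hmode \<alpha> m (1 + real k) t x"
    unfolding AE_all_countable by blast
  have "AE x in lborel. x \<in> - {0} \<longrightarrow> p t x y - AB_kernel \<alpha> t x y = 0"
    using ae
  proof eventually_elim
    fix x assume mom: "\<forall>m. \<forall>k::nat. (\<integral>y. p t x y * gmode \<alpha> m 1 (1 + real k) y \<partial>lborel) = hmode \<alpha> m (1 + real k) t x"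
    show "x \<in> - {0} \<longrightarrow> p t x y - AB_kernel \<alpha> t x y = 0"
    proof
      assume "x \<in> - {0}"
      hence x: "x \<noteq> 0" by simp
      have i1: "integrable lborel (\<lambda>y. p t x y * gmode \<alpha> m 1 (1 + real k) y)" for m and k :: nat
        using p gL[of m k] t x unfolding AB_heat_kernel_def by blast
      have i2: "integrable lborel (\<lambda>y. AB_kernel \<alpha> t x y * gmode \<alpha> m 1 (1 + real k) y)" for m and k :: nat
        using AB_kernel_gmode(1)[OF \<alpha> t _ x, of "1 + real k" m] by simp
      have e2: "(\<integral>y. AB_kernel \<alpha> t x y * gmode \<alpha> m 1 (1 + real k) y \<partial>lborel) = hmode \<alpha> m (1 + real k) t x" for m and k :: nat
        using AB_kernel_gmode(2)[OF \<alpha> t _ x, of "1 + real k" m] by simp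
      show "p t x y - AB_kernel \<alpha> t x y = 0"
      proof (rule gmode_total[where \<alpha> = \<alpha> and g = "\<lambda>y. p t x y - AB_kernel \<alpha> t x y"])
        show "continuous_on (- {0}) (\<lambda>y. p t x y - AB_kernel \<alpha> t x y)"
          by (intro continuous_on_diff pc1 continuous_on_AB_kernel_right \<alpha> t x)
        show "integrable lborel (\<lambda>y. (p t x y - AB_kernel \<alpha> t x y) * gmode \<alpha> m 1 (1 + real k) y)" for m and k :: nat
          unfolding left_diff_distrib by (intro Bochner_Integration.integrable_diff i1 i2)
        show "(\<integral>y. (p t x y - AB_kernel \<alpha> t x y) * gmode \<alpha> m 1 (1 + real k) y \<partial>lborel) = 0" for m and k :: nat
          unfolding left_diff_distrib by (subst Bochner_Integration.integral_diff[OF i1 i2]) (simp add: mom e2)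
      qed (rule \<open>y \<noteq> 0\<close>)
    qed
  qed
  \<comment> \<open>With \<open>y\<close> fixed both kernels are continuous in \<open>x\<close> off
    the origin, so equality almost everywhere there is equality at every nonzero
    \<open>x\<close>.\<close>
  hence "p t x y - AB_kernel \<alpha> t x y = 0"
    by (intro AE_zero_continuous_imp_zero[of "- {0}" "\<lambda>x. p t x y - AB_kernel \<alpha> t x y"] continuous_on_diff pc2
        continuous_on_AB_kernel_left \<alpha> t) (use assms in auto)
  thus ?thesis by simp
qed

section \<open>Large times\<close>

lemma nu_ge_abs:
  assumes "\<bar>\<alpha>\<bar> \<le> 1 / 2"
  shows "\<bar>\<alpha>\<bar> \<le> nu \<alpha> n"
proof (cases "n = 0")
  case False
  hence "1 \<le> \<bar>real_of_int n\<bar>" by linarith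
  moreover have "\<bar>real_of_int n\<bar> \<le> \<bar>real_of_int n + \<alpha>\<bar> + \<bar>\<alpha>\<bar>"
    using abs_triangle_ineq4[of "real_of_int n + \<alpha>" \<alpha>] by simp
  moreover have "d \<le> b" if "1 \<le> c" "c \<le> b + d" "d \<le> 1 / 2" for b c d :: real
    using that by simp
  ultimately show ?thesis unfolding nu_def using assms by blast
qed (simp add: nu_def)

lemma scaled_mode_eq:
  assumes "t > 0" "w > 0"
  shows "t powr b * besselI n (w / t) = w powr n * t powr (- (n - b)) * bseries n ((w / t)\<^sup>2)"
  unfolding besselI_def using assms by (simp add: powr_divide powr_diff powr_minus field_simps)

text \<open>The scaled mode behaves like \<open>w powr n * t powr (b - n)\<close> times the value
  \<open>1 / Gamma (1 + n)\<close> of the series at \<open>0\<close>, so it survives only for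
  \<open>n = b\<close>.\<close>

lemma scaled_mode_tendsto:
  assumes "n \<ge> b" "b \<ge> 0" "w > 0"
  shows "((\<lambda>t. t powr b * besselI n (w / t)) \<longlongrightarrow> (if n = b then w powr b / Gamma (1 + b) else 0)) at_top"
proof -
  have n: "n \<ge> 0" using assms by simp
  have "((\<lambda>t. (w / t)\<^sup>2) \<longlongrightarrow> 0\<^sup>2) at_top"
    by (intro tendsto_power tendsto_divide_0[OF tendsto_const] filterlim_at_top_imp_at_infinity filterlim_ident)
  hence "((\<lambda>t. (w / t)\<^sup>2) \<longlongrightarrow> 0) at_top" by simp
  hence P: "((\<lambda>t. bseries n ((w / t)\<^sup>2)) \<longlongrightarrow> 1 / Gamma (1 + n)) at_top"
    using isCont_tendsto_compose[OF isCont_bseries[OF n, of 0]] unfolding bseries_0 by blast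
  have "((\<lambda>t. w powr n * t powr (- (n - b)) * bseries n ((w / t)\<^sup>2)) \<longlongrightarrow> (if n = b then w powr b / Gamma (1 + b) else 0)) at_top"
  proof (cases "n = b")
    case True
    have "((\<lambda>t. w powr n * bseries n ((w / t)\<^sup>2)) \<longlongrightarrow> w powr n * (1 / Gamma (1 + n))) at_top"
      by (intro tendsto_mult tendsto_const P)
    moreover have "\<forall>\<^sub>F t in at_top. w powr n * bseries n ((w / t)\<^sup>2) = w powr n * t powr (- (n - b)) * bseries n ((w / t)\<^sup>2)"
      using eventually_gt_at_top[of 0] by eventually_elim (use True in simp)
    ultimately show ?thesis using True by (auto intro: Lim_transform_eventually)
  next
    case False
    have "((\<lambda>t. t powr (- (n - b))) \<longlongrightarrow> 0) at_top"
      using False assms by (intro tendsto_neg_powr filterlim_ident) auto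
    from tendsto_mult[OF tendsto_mult[OF tendsto_const[of "w powr n"] this] P]
    show ?thesis using False by simp
  qed
  moreover have "\<forall>\<^sub>F t in at_top. w powr n * t powr (- (n - b)) * bseries n ((w / t)\<^sup>2) = t powr b * besselI n (w / t)"
    using eventually_gt_at_top[of 0] by eventually_elim (simp only: scaled_mode_eq[OF _ assms(3)])
  ultimately show ?thesis by (rule Lim_transform_eventually)
qed

text \<open>The power \<open>(w / t) powr n\<close> is split at \<open>b\<close>: the first part
  cancels \<open>t powr b\<close>, the second is at most \<open>(1 / 2) powr (n - b)\<close> once
  \<open>t >= 2 * w\<close>. The bound is free of \<open>t\<close> and summable over the
  modes.\<close>

lemma scaled_mode_bound:
  assumes "n \<ge> b" "b \<ge> 0" "w > 0" "t \<ge> 1" "t \<ge> 2 * w"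
  shows "t powr b * besselI n (w / t) \<le> exp 2 * (2 * w) powr b * (1 / 2) powr n"
proof -
  have z: "w / t > 0" "w / t \<le> 1 / 2" using assms by (auto simp: field_simps)
  have "(w / t)\<^sup>2 \<le> 1" using z by (intro power_le_one) linarith+
  have "besselI n (w / t) \<le> exp 1 * (w / t / 1) powr n * exp ((w / t)\<^sup>2 / 1)"
    using assms z by (intro besselI_le) auto
  also have "\<dots> \<le> exp 1 * (w / t) powr n * exp 1"
    using \<open>(w / t)\<^sup>2 \<le> 1\<close> by (intro mult_mono) auto
  also have "\<dots> = exp 2 * ((w / t) powr b * (w / t) powr (n - b))"
    by (simp add: mult_exp_exp[of 1 1, simplified] powr_add[symmetric] mult_ac)
  also have "\<dots> \<le> exp 2 * ((w / t) powr b * (1 / 2) powr (n - b))"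
    using z assms by (intro mult_left_mono powr_mono2) auto
  finally have "t powr b * besselI n (w / t) \<le> t powr b * (exp 2 * ((w / t) powr b * (1 / 2) powr (n - b)))"
    by (intro mult_left_mono) auto
  also have "\<dots> = exp 2 * (2 * w) powr b * (1 / 2) powr n"
    using assms by (simp add: powr_divide powr_diff powr_mult field_simps)
  finally show ?thesis .
qed

lemma AB_kernel_tendsto:
  assumes \<alpha>: "\<bar>\<alpha>\<bar> \<le> 1 / 2" and xy: "x \<noteq> 0" "y \<noteq> 0"
  defines "w \<equiv> cmod x * cmod y / 4"
  shows "((\<lambda>t. of_real (t powr (1 + \<bar>\<alpha>\<bar>)) * AB_kernel \<alpha> t x y) \<longlongrightarrow>
    of_real (1 / (4 * pi)) * (\<Sum>j. of_real (if nuj \<alpha> j = \<bar>\<alpha>\<bar> then w powr \<bar>\<alpha>\<bar> / Gamma (1 + \<bar>\<alpha>\<bar>) else 0) * phase x y j)) at_top"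
proof -
  let ?b = "\<bar>\<alpha>\<bar>"
  let ?a = "\<lambda>j t. complex_of_real (t powr ?b * besselI (nuj \<alpha> j) (w / t)) * phase x y j"
  have w: "w > 0" using xy by (simp add: w_def)
  have S: "((\<lambda>t. \<Sum>j. ?a j t) \<longlongrightarrow> (\<Sum>j. of_real (if nuj \<alpha> j = ?b then w powr ?b / Gamma (1 + ?b) else 0) * phase x y j)) at_top"
  \<comment> \<open>Limit and series are exchanged under the domination by a constant times
    \<open>mode_wt\<close>, valid for \<open>t >= max 1 (2 * w)\<close>.\<close>
  proof (rule tannerys_theorem[THEN conjunct2, THEN conjunct2])
    show "((\<lambda>t. ?a j t) \<longlongrightarrow> of_real (if nuj \<alpha> j = ?b then w powr ?b / Gamma (1 + ?b) else 0) * phase x y j) at_top" for j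
      by (intro tendsto_mult tendsto_const tendsto_of_real scaled_mode_tendsto nu_ge_abs \<alpha> w) simp
    show "summable (\<lambda>j. exp 2 * (2 * w) powr ?b * mode_wt \<alpha> j)" by (intro summable_mult mode_wt_summable \<alpha>)
    have "norm (?a j t) \<le> exp 2 * (2 * w) powr ?b * mode_wt \<alpha> j" if "t \<ge> max 1 (2 * w)" for j t
    proof -
      have "norm (?a j t) \<le> (t powr ?b * besselI (nuj \<alpha> j) (w / t)) * 1"
        unfolding norm_mult norm_of_real
        using besselI_nonneg[OF nu_nonneg, of \<alpha> "int_decode j" "w / t"] norm_ang_mult_le[of "int_decode j" x "- int_decode j" y, unfolded norm_mult]
        by (intro mult_mono) auto
      also have "\<dots> \<le> exp 2 * (2 * w) powr ?b * mode_wt \<alpha> j"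
        unfolding mode_wt_def mult_1_right using that by (intro scaled_mode_bound nu_ge_abs \<alpha> w) auto
      finally show ?thesis .
    qed
    thus "\<forall>\<^sub>F (j, t) in at_top \<times>\<^sub>F at_top. norm (?a j t) \<le> exp 2 * (2 * w) powr ?b * mode_wt \<alpha> j"
      unfolding eventually_prod_filter
      by (intro exI[of _ "\<lambda>_. True"] exI[of _ "\<lambda>t. t \<ge> max 1 (2 * w)"] conjI eventually_ge_at_top) auto
  qed simp
  have E: "((\<lambda>t. exp (- ((cmod x)\<^sup>2 + (cmod y)\<^sup>2) / (4 * t)) / (4 * pi)) \<longlongrightarrow> exp 0 / (4 * pi)) at_top"
    by (intro tendsto_divide tendsto_exp tendsto_const tendsto_divide_0[OF tendsto_const] filterlim_at_top_imp_at_infinity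
        filterlim_tendsto_pos_mult_at_top[OF tendsto_const _ filterlim_ident]) auto
  have "((\<lambda>t. of_real (exp (- ((cmod x)\<^sup>2 + (cmod y)\<^sup>2) / (4 * t)) / (4 * pi)) * (\<Sum>j. ?a j t)) \<longlongrightarrow>
     of_real (1 / (4 * pi)) * (\<Sum>j. of_real (if nuj \<alpha> j = ?b then w powr ?b / Gamma (1 + ?b) else 0) * phase x y j)) at_top"
    using tendsto_mult[OF tendsto_of_real[OF E] S] by (simp only: exp_zero)
  moreover have "\<forall>\<^sub>F t in at_top. of_real (exp (- ((cmod x)\<^sup>2 + (cmod y)\<^sup>2) / (4 * t)) / (4 * pi)) * (\<Sum>j. ?a j t) = of_real (t powr (1 + ?b)) * AB_kernel \<alpha> t x y"
    using eventually_gt_at_top[of 0]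
  proof eventually_elim
    fix t :: real assume t: "t > 0"
    have z: "cmod x * cmod y / (4 * t) = w / t" by (simp add: w_def)
    have "summable (\<lambda>j. complex_of_real (besselI (nuj \<alpha> j) (w / t)) * phase x y j)"
      using w t by (intro mode_summable \<alpha> norm_ang_mult_le) auto
    hence "(\<Sum>j. ?a j t) = of_real (t powr ?b) * (\<Sum>j. complex_of_real (besselI (nuj \<alpha> j) (w / t)) * phase x y j)"
      unfolding of_real_mult mult.assoc by (rule suminf_mult)
    \<comment> \<open>The extra power of \<open>t\<close> cancels the \<open>t\<close> in the
      prefactor \<open>1 / (4 * pi * t)\<close>; only \<open>t powr |\<alpha>|\<close> acts on the
      modes.\<close>
    moreover have "t powr (1 + ?b) = t * t powr ?b" using t by (simp add: powr_add)
    ultimately show "of_real (exp (- ((cmod x)\<^sup>2 + (cmod y)\<^sup>2) / (4 * t)) / (4 * pi)) * (\<Sum>j. ?a j t) = of_real (t powr (1 + ?b)) * AB_kernel \<alpha> t x y"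
      unfolding AB_kernel_def z using t by simp
  qed
  ultimately show ?thesis by (rule Lim_transform_eventually)
qed

lemma ang_rcis: "r > 0 \<Longrightarrow> ang m (rcis r \<theta>) = exp (\<i> * of_real (of_int m * \<theta>))"
proof -
  assume "r > 0"
  hence "sgn (rcis r \<theta>) = exp (\<i> * of_real \<theta>)"
    by (simp add: rcis_def sgn_mult sgn_of_real cis_conv_exp[symmetric] sgn_cis)
  thus ?thesis using \<open>r > 0\<close> by (simp add: ang_def exp_power_int mult_ac)
qed

lemma phase_rcis:
  assumes "r > 0" "r' > 0"
  shows "ang m (rcis r \<theta>) * ang (- m) (rcis r' \<theta>') = exp (\<i> * of_real (of_int m * (\<theta> - \<theta>')))"
  unfolding ang_rcis[OF assms(1)] ang_rcis[OF assms(2)] exp_add[symmetric] by (simp add: algebra_simps)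

theorem theorem6p2:
  fixes \<alpha> r r' \<theta> \<theta>' :: real and p :: "real \<Rightarrow> complex \<Rightarrow> complex \<Rightarrow> complex"
  assumes "\<bar>\<alpha>\<bar> \<le> 1/2" and "AB_heat_kernel \<alpha> p" and "r > 0" and "r' > 0"
  shows "(\<bar>\<alpha>\<bar> < 1/2 \<longrightarrow>
           ((\<lambda>t. of_real (t powr (1 + \<bar>\<alpha>\<bar>)) * p t (rcis r \<theta>) (rcis r' \<theta>'))
             \<longlongrightarrow> of_real (1 / (4 * pi * Gamma (1 + \<bar>\<alpha>\<bar>)) * (r * r' / 4) powr \<bar>\<alpha>\<bar>)) at_top)
       \<and> (\<alpha> = 1/2 \<longrightarrow>
           ((\<lambda>t. of_real (t powr (3/2)) * p t (rcis r \<theta>) (rcis r' \<theta>'))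
             \<longlongrightarrow> of_real (1 / (4 * pi * Gamma (3/2)) * (r * r' / 4) powr (1/2))
                   * (1 + exp (- \<i> * of_real (\<theta> - \<theta>')))) at_top)
       \<and> (\<alpha> = -1/2 \<longrightarrow>
           ((\<lambda>t. of_real (t powr (3/2)) * p t (rcis r \<theta>) (rcis r' \<theta>'))
             \<longlongrightarrow> of_real (1 / (4 * pi * Gamma (3/2)) * (r * r' / 4) powr (1/2))
                   * (1 + exp (\<i> * of_real (\<theta> - \<theta>')))) at_top)"
proof -
  let ?x = "rcis r \<theta>" and ?y = "rcis r' \<theta>'"
  have xy: "?x \<noteq> 0" "?y \<noteq> 0" "cmod ?x = r" "cmod ?y = r'" using assms by auto
  define L where "L j = complex_of_real (if nuj \<alpha> j = \<bar>\<alpha>\<bar> then (r * r' / 4) powr \<bar>\<alpha>\<bar> / Gamma (1 + \<bar>\<alpha>\<bar>) else 0)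
     * exp (\<i> * of_real (of_int (int_decode j) * (\<theta> - \<theta>')))" for j
  have "((\<lambda>t. of_real (t powr (1 + \<bar>\<alpha>\<bar>)) * AB_kernel \<alpha> t ?x ?y) \<longlongrightarrow> of_real (1 / (4 * pi)) * (\<Sum>j. L j)) at_top"
    using AB_kernel_tendsto[OF assms(1) xy(1,2)] unfolding xy(3,4) phase_rcis[OF assms(3,4)] L_def .
  moreover have "\<forall>\<^sub>F t in at_top. of_real (t powr (1 + \<bar>\<alpha>\<bar>)) * AB_kernel \<alpha> t ?x ?y = of_real (t powr (1 + \<bar>\<alpha>\<bar>)) * p t ?x ?y"
    using eventually_gt_at_top[of 0]
    by eventually_elim (simp add: heat_kernel_eq_AB_kernel[OF assms(1,2) _ xy(1,2)])
  ultimately have lim: "((\<lambda>t. of_real (t powr (1 + \<bar>\<alpha>\<bar>)) * p t ?x ?y) \<longlongrightarrow> of_real (1 / (4 * pi)) * (\<Sum>j. L j)) at_top"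
    by (rule Lim_transform_eventually)
  have L0: "L j = 0" if "nuj \<alpha> j \<noteq> \<bar>\<alpha>\<bar>" for j using that by (simp add: L_def)
  \<comment> \<open>For \<open>|\<alpha>| <= 1/2\<close> the minimisers of
    \<open>|m + \<alpha>|\<close> lie among \<open>0\<close>, \<open>-1\<close> and
    \<open>1\<close>, which are the first three integers in the enumeration.\<close>
  have dec: "int_decode 0 = 0" "int_decode (Suc 0) = -1" "int_decode 2 = 1"
    by (simp_all add: int_decode_def sum_decode_def)
  have enc: "j = int_encode n" if "int_decode j = n" for j n using that by auto
  have encs: "int_encode 0 = 0" "int_encode (-1) = 1" "int_encode 1 = 2"
    by (simp_all add: int_encode_def sum_encode_def)
  show ?thesis
  proof (intro conjI impI)
    assume a: "\<bar>\<alpha>\<bar> < 1 / 2"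
    \<comment> \<open>For nonzero \<open>m\<close>,
      \<open>|m + \<alpha>| >= 1 - |\<alpha>| > |\<alpha>|\<close>; the strict bound
      \<open>|\<alpha>| < 1/2\<close> is what singles out \<open>m = 0\<close>.\<close>
    have "L j = 0" if "j \<notin> {0}" for j
    proof (rule L0)
      have n: "int_decode j \<noteq> 0" using that enc[of j 0] encs by auto
      hence "\<bar>real_of_int (int_decode j)\<bar> \<ge> 1" by linarith
      moreover have "\<bar>real_of_int (int_decode j)\<bar> \<le> \<bar>real_of_int (int_decode j) + \<alpha>\<bar> + \<bar>\<alpha>\<bar>"
        using abs_triangle_ineq4[of "real_of_int (int_decode j) + \<alpha>" \<alpha>] by simp
      moreover have "b \<noteq> d" if "1 \<le> c" "c \<le> b + d" "d < 1 / 2" for b c d :: real using that by auto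
      ultimately show "nuj \<alpha> j \<noteq> \<bar>\<alpha>\<bar>" unfolding nu_def using a by blast
    qed
    hence "(\<Sum>j. L j) = (\<Sum>j\<in>{0}. L j)" by (intro suminf_finite) auto
    also have "\<dots> = of_real ((r * r' / 4) powr \<bar>\<alpha>\<bar> / Gamma (1 + \<bar>\<alpha>\<bar>))" by (simp add: L_def dec nu_def)
    finally show "((\<lambda>t. of_real (t powr (1 + \<bar>\<alpha>\<bar>)) * p t ?x ?y) \<longlongrightarrow> of_real (1 / (4 * pi * Gamma (1 + \<bar>\<alpha>\<bar>)) * (r * r' / 4) powr \<bar>\<alpha>\<bar>)) at_top"
      using lim by (simp add: mult_ac)
  next
    assume a: "\<alpha> = 1 / 2"
    \<comment> \<open>\<open>|m + 1/2| = 1/2\<close> has the solutions \<open>m = 0\<close> and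
      \<open>m = -1\<close>, at indices \<open>0\<close> and \<open>1\<close>; the second one yields
      the exponential with the minus sign.\<close>
    have "L j = 0" if "j \<notin> {0, 1}" for j
    proof (rule L0)
      have "int_decode j \<noteq> 0" "int_decode j \<noteq> -1" using that enc[of j 0] enc[of j "-1"] encs by auto
      thus "nuj \<alpha> j \<noteq> \<bar>\<alpha>\<bar>" unfolding nu_def a by linarith
    qed
    hence "(\<Sum>j. L j) = (\<Sum>j\<in>{0, 1}. L j)" by (intro suminf_finite) auto
    also have "\<dots> = of_real ((r * r' / 4) powr (1/2) / Gamma (3/2)) * (1 + exp (- \<i> * of_real (\<theta> - \<theta>')))"
      by (simp add: L_def dec nu_def a distrib_left flip: mult_minus_right)
    finally show "((\<lambda>t. of_real (t powr (3/2)) * p t ?x ?y) \<longlongrightarrow> of_real (1 / (4 * pi * Gamma (3/2)) * (r * r' / 4) powr (1/2)) * (1 + exp (- \<i> * of_real (\<theta> - \<theta>')))) at_top"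
      using lim by (simp add: a mult_ac)
  next
    assume a: "\<alpha> = - 1 / 2"
    \<comment> \<open>The second minimiser is now \<open>m = 1\<close>, which has index
      \<open>2\<close>, and the sign of the phase is reversed.\<close>
    have "L j = 0" if "j \<notin> {0, 2}" for j
    proof (rule L0)
      have "int_decode j \<noteq> 0" "int_decode j \<noteq> 1" using that enc[of j 0] enc[of j 1] encs by auto
      thus "nuj \<alpha> j \<noteq> \<bar>\<alpha>\<bar>" unfolding nu_def a by linarith
    qed
    hence "(\<Sum>j. L j) = (\<Sum>j\<in>{0, 2}. L j)" by (intro suminf_finite) auto
    also have "\<dots> = of_real ((r * r' / 4) powr (1/2) / Gamma (3/2)) * (1 + exp (\<i> * of_real (\<theta> - \<theta>')))"
      by (simp add: L_def dec nu_def a distrib_left)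
    finally show "((\<lambda>t. of_real (t powr (3/2)) * p t ?x ?y) \<longlongrightarrow> of_real (1 / (4 * pi * Gamma (3/2)) * (r * r' / 4) powr (1/2)) * (1 + exp (\<i> * of_real (\<theta> - \<theta>')))) at_top"
      using lim by (simp add: a mult_ac)
  qed
qed

end
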